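(* Let $\{\mathcal T_n\}$ be a family of polytopic meshes of $\Omega\subset\mathbb R^d$ satisfying the regularity assumptions described in the context, with regularity constant $\gamma>0$, and let $q\in[1,\infty)$. Then, for every element $K$ of any mesh $\mathcal T_n$ of the family and every $v\in W^{1,q}(K)$, $$ \|v\|_{L^{q}(\partial K)}\le C_{TR}(q,q,d,\gamma)\Big(h_K^{-\frac1q}\|v\|_{L^{q}(K)}+h_K^{\frac1{q'}}\|\nabla v\|_{\mathbf L^{q}(K)}\Big), $$ and, if $q$ further belongs to $[1,d)$, $$ \|v\|_{L^{q^\sharp}(\partial K)}\le C_{TR}(q^\sharp,q^*,d,\gamma)\Big(\|v\|_{L^{q^*}(K)}+\|\nabla v\|_{\mathbf L^{q}(K)}\Big). $$
   Context: $d\ge 2$ is an integer and $\Omega\subset\mathbb R^d$ is a polytopic, open, Lipschitz domain which is star-shaped with respect to a ball. Each mesh $\mathcal T_n$ is a finite collection of disjoint (i.e. non-overlapping), closed, polytopic elements $K$ with $\overline\Omega=\bigcup_{K\in\mathcal T_n}K$; $\partial K$ and $h_K$ are the boundary and the diameter of $K$. Regularity assumptions on the family: (i) for every $K$ in any $\mathcal T_n$ there is a partition $\mathfrak T_K$ of $K$ into non-overlapping $d$-dimensional simplices; (ii) there is a universal constant $\gamma>0$ such that, for every $K$ in any $\mathcal T_n$ and every $T\in\mathfrak T_K$ with $\partial T\cap\partial K\neq\emptyset$, denoting by $F_K^T$ the $(d-1)$-dimensional simplex $\partial T\cap\partial K$, one has $\gamma h_K\le d\,|T|\,|F_K^T|^{-1}$.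 No restriction is imposed on the number of facets per element or on their size. Indices: $q'=q/(q-1)$ (so $1/q'=0$ if $q=1$); for $q<d$, $q^*=\frac{qd}{d-q}$ and $q^\sharp=\frac{q(d-1)}{d-q}$. Constant: for $r\in[1,\infty)$ and $s\in[r,\infty)$, with $\Gamma(\cdot)$ Euler's Gamma function, $$ C_{TR}(r,s,d,\gamma):=\left(\frac{d\,\pi^{\frac{d(s-r)}{2s}}}{\gamma\,\Gamma\big(\frac d2+1\big)^{\frac{s-r}{s}}}+\frac{r-1}{\gamma}\right)^{\frac1r}. $$ Boldface denotes spaces of vector fields. Values of $v$ on $\partial K$ are understood in the sense of traces.
   Formalization: In regularity assumption (ii), the simplex ∂T∩∂K is required to be a whole facet of T (automatic for conforming partitions); if it may be a proper part of a facet, the inequality can fail, e.g. for a polygon with a thin spike and q=1. *)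

theory Defs
  imports "HOL-Analysis.Analysis"
begin

section \<open>Lebesgue spaces\<close>

text \<open>The norm takes values in \<^typ>\<open>ennreal\<close>, so that it is \<open>\<infinity>\<close> (and not a junk value)
  for functions outside of the space.\<close>

definition Lp_norm :: "real \<Rightarrow> 'a measure \<Rightarrow> ('a \<Rightarrow> 'b::real_normed_vector) \<Rightarrow> ennreal" where
  "Lp_norm p M f =
     (let I = (\<integral>\<^sup>+x. ennreal (norm (f x) powr p) \<partial>M)
      in if I = \<infinity> then \<infinity> else ennreal (enn2real I powr (1 / p)))"

definition Lp_space :: "real \<Rightarrow> 'a measure \<Rightarrow> ('a \<Rightarrow> 'b::real_normed_vector) set" where
  "Lp_space p M = {f \<in> borel_measurable M. Lp_norm p M f < \<infinity>}"


section \<open>Surface measure on piecewise flat sets\<close>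

definition hyperplanes :: "'a::euclidean_space set set" where
  "hyperplanes = {H. \<exists>a b. a \<noteq> 0 \<and> H = {x. a \<bullet> x = b}}"

text \<open>The \<open>(d-1)\<close>-dimensional Lebesgue measure on a hyperplane \<open>H\<close>, as a Borel measure on the
  whole space: by Fubini, the \<open>(d-1)\<close>-dimensional measure of \<open>A \<inter> H\<close> is the \<open>d\<close>-dimensional
  measure of the right prism of height \<open>1\<close> over \<open>A \<inter> H\<close>.\<close>

definition hyperplane_measure :: "'a::euclidean_space set \<Rightarrow> 'a measure" where
  "hyperplane_measure H =
     distr (restrict_space lborel {x. infdist x H \<le> 1/2}) borel (closest_point H)"

text \<open>Each \<open>(d-1)\<close>-dimensional polytope is charged only by the measure of its own hyperplane,
  since its intersection with any other hyperplane has lower dimension. Hence on finite unions of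
  \<open>(d-1)\<close>-dimensional polytopes the following sum over all hyperplanes is the usual surface
  measure, i.e.\ \<open>(d-1)\<close>-dimensional Lebesgue measure on each flat piece. Only such sets occur
  below (boundaries of polytopic elements and facets of simplices).\<close>

definition surface_measure :: "'a::euclidean_space measure" where
  "surface_measure = measure_of UNIV (sets borel)
     (\<lambda>A. \<integral>\<^sup>+H. emeasure (hyperplane_measure H) A \<partial>count_space hyperplanes)"

lemma sets_surface_measure [simp, measurable_cong]: "sets surface_measure = sets borel"
  by (simp add: surface_measure_def sets.sigma_sets_eq[of borel, simplified])

lemma space_surface_measure [simp]: "space surface_measure = UNIV"
  by (simp add: surface_measure_def)

lemma sets_hyperplane_measure [simp]: "sets (hyperplane_measure H) = sets borel"
  by (simp add: hyperplane_measure_def)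

lemma emeasure_surface_measure:
  fixes A :: "'a::euclidean_space set"
  assumes "A \<in> sets borel"
  shows "emeasure surface_measure A =
    (\<integral>\<^sup>+H. emeasure (hyperplane_measure H) A \<partial>count_space hyperplanes)"
proof (rule emeasure_measure_of[OF surface_measure_def])
  show "countably_additive (sets surface_measure)
    (\<lambda>A::'a set. \<integral>\<^sup>+H. emeasure (hyperplane_measure H) A \<partial>count_space hyperplanes)"
  proof (rule countably_additiveI)
    fix B :: "nat \<Rightarrow> 'a set"
    assume B: "range B \<subseteq> sets surface_measure" "disjoint_family B"
    have "(\<Sum>i. \<integral>\<^sup>+H. emeasure (hyperplane_measure H) (B i) \<partial>count_space hyperplanes) =
      (\<integral>\<^sup>+H. (\<Sum>i. emeasure (hyperplane_measure H) (B i)) \<partial>count_space hyperplanes)"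
      by (rule nn_integral_suminf[symmetric]) simp
    also have "\<dots> = (\<integral>\<^sup>+H. emeasure (hyperplane_measure H) (\<Union>i. B i) \<partial>count_space hyperplanes)"
      using B by (intro nn_integral_cong suminf_emeasure) auto
    finally show "(\<Sum>i. \<integral>\<^sup>+H. emeasure (hyperplane_measure H) (B i) \<partial>count_space hyperplanes) =
      (\<integral>\<^sup>+H. emeasure (hyperplane_measure H) (\<Union>i. B i) \<partial>count_space hyperplanes)" .
  qed
qed (use assms in \<open>auto simp: positive_def\<close>)


section \<open>The Sobolev space \<open>W\<^sup>1\<^sup>,\<^sup>q\<close>\<close>

coinductive smooth :: "('a::euclidean_space \<Rightarrow> real) \<Rightarrow> bool" where
  "smooth \<phi>" if "\<forall>x. \<phi> differentiable (at x)"
    and "\<forall>b\<in>Basis. smooth (\<lambda>x. frechet_derivative \<phi> (at x) b)"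

definition test_function :: "'a::euclidean_space set \<Rightarrow> ('a \<Rightarrow> real) \<Rightarrow> bool" where
  "test_function U \<phi> \<longleftrightarrow> smooth \<phi> \<and> compact (closure {x. \<phi> x \<noteq> 0}) \<and> closure {x. \<phi> x \<noteq> 0} \<subseteq> U"

definition locally_integrable :: "'a::euclidean_space set \<Rightarrow> ('a \<Rightarrow> 'b::euclidean_space) \<Rightarrow> bool" where
  "locally_integrable U f \<longleftrightarrow> (\<forall>C. compact C \<longrightarrow> C \<subseteq> U \<longrightarrow> f absolutely_integrable_on C)"

definition has_weak_gradient :: "'a::euclidean_space set \<Rightarrow> ('a \<Rightarrow> real) \<Rightarrow> ('a \<Rightarrow> 'a) \<Rightarrow> bool" where
  "has_weak_gradient U v g \<longleftrightarrow>
     locally_integrable U v \<and> locally_integrable U g \<and>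
     (\<forall>\<phi>. test_function U \<phi> \<longrightarrow> (\<forall>b\<in>Basis.
        (LINT x|lebesgue_on U. v x * frechet_derivative \<phi> (at x) b) =
        - (LINT x|lebesgue_on U. (g x \<bullet> b) * \<phi> x)))"

text \<open>Weak gradients are unique up to null sets.\<close>

definition weak_gradient :: "'a::euclidean_space set \<Rightarrow> ('a \<Rightarrow> real) \<Rightarrow> 'a \<Rightarrow> 'a" where
  "weak_gradient U v = (SOME g. has_weak_gradient U v g)"

definition W1 :: "real \<Rightarrow> 'a::euclidean_space set \<Rightarrow> ('a \<Rightarrow> real) set" where
  "W1 q U = {v \<in> Lp_space q (lebesgue_on U).
     \<exists>g. has_weak_gradient U v g \<and> g \<in> Lp_space q (lebesgue_on U)}"


section \<open>Traces\<close>

abbreviation boundary_measure :: "'a::euclidean_space set \<Rightarrow> 'a measure" where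
  "boundary_measure K \<equiv> restrict_space surface_measure (frontier K)"

text \<open>\<open>w\<close> is the trace of \<open>v\<close> on \<open>\<partial>K\<close>: the trace operator \<open>W\<^sup>1\<^sup>,\<^sup>q(K) \<rightarrow> L\<^sup>q(\<partial>K)\<close> is the extension by
  continuity of the restriction map \<open>u \<mapsto> u\<restriction>\<^sub>\<partial>\<^sub>K\<close> from functions that are continuous up to the
  boundary. An exceptional surface-null set \<open>N\<close> is allowed in the boundary because polytopic
  elements need not be Lipschitz sets: if, say, \<open>K\<close> consists of two squares that meet in a vertex,
  then functions in \<open>W\<^sup>1\<^sup>,\<^sup>q\<close> that are continuous on all of \<open>K\<close> are not dense for \<open>q > 2\<close>, whereas
  those continuous off the lower-dimensional faces of \<open>\<partial>K\<close> always are.\<close>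

definition has_trace :: "real \<Rightarrow> 'a::euclidean_space set \<Rightarrow> ('a \<Rightarrow> real) \<Rightarrow> ('a \<Rightarrow> real) \<Rightarrow> bool" where
  "has_trace q K v w \<longleftrightarrow>
     w \<in> Lp_space q (boundary_measure K) \<and>
     (\<exists>u :: nat \<Rightarrow> 'a \<Rightarrow> real.
        (\<forall>n. u n \<in> W1 q (interior K) \<and> u n \<in> Lp_space q (boundary_measure K) \<and>
             (\<exists>N \<in> null_sets surface_measure. N \<subseteq> frontier K \<and> continuous_on (K - N) (u n))) \<and>
        (\<lambda>n. Lp_norm q (lebesgue_on (interior K)) (\<lambda>x. u n x - v x)) \<longlonglongrightarrow> 0 \<and>
        (\<lambda>n. Lp_norm q (lebesgue_on (interior K))
           (\<lambda>x. weak_gradient (interior K) (u n) x - weak_gradient (interior K) v x)) \<longlonglongrightarrow> 0 \<and>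
        (\<lambda>n. Lp_norm q (boundary_measure K) (\<lambda>x. u n x - w x)) \<longlonglongrightarrow> 0)"


section \<open>Domains and polytopic meshes\<close>

text \<open>Polytopic sets need not be convex, while the library's \<^const>\<open>polytope\<close> is a convex hull.\<close>

definition polytopic :: "'a::euclidean_space set \<Rightarrow> bool" where
  "polytopic S \<longleftrightarrow> (\<exists>\<P>. finite \<P> \<and> \<P> \<noteq> {} \<and>
     (\<forall>P\<in>\<P>. polytope P \<and> interior P \<noteq> {}) \<and> S = \<Union>\<P>)"

text \<open>Locally, and in a suitable orthogonal coordinate system with last axis \<open>e\<close>, the set is the
  strict epigraph of a Lipschitz function of the first \<open>d - 1\<close> coordinates \<open>y - (y \<bullet> e) e\<close>.\<close>

definition lipschitz_domain :: "'a::euclidean_space set \<Rightarrow> bool" where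
  "lipschitz_domain \<Omega> \<longleftrightarrow> open \<Omega> \<and> connected \<Omega> \<and> \<Omega> \<noteq> {} \<and> bounded \<Omega> \<and>
     (\<forall>x\<in>frontier \<Omega>. \<exists>r>0. \<exists>e. norm e = 1 \<and>
        (\<exists>(f :: 'a \<Rightarrow> real) L. L-lipschitz_on {y. y \<bullet> e = 0} f \<and>
           \<Omega> \<inter> ball x r = {y \<in> ball x r. f (y - (y \<bullet> e) *\<^sub>R e) < y \<bullet> e}))"

definition star_shaped_wrt_ball :: "'a::euclidean_space set \<Rightarrow> bool" where
  "star_shaped_wrt_ball \<Omega> \<longleftrightarrow>
     (\<exists>c r. 0 < r \<and> ball c r \<subseteq> \<Omega> \<and> (\<forall>x\<in>\<Omega>. \<forall>y\<in>ball c r. closed_segment x y \<subseteq> \<Omega>))"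

definition non_overlapping :: "'a::topological_space set set \<Rightarrow> bool" where
  "non_overlapping \<S> \<longleftrightarrow> pairwise (\<lambda>S T. interior S \<inter> interior T = {}) \<S>"

definition polytopic_mesh :: "'a::euclidean_space set \<Rightarrow> 'a set set \<Rightarrow> bool" where
  "polytopic_mesh \<Omega> \<T> \<longleftrightarrow>
     finite \<T> \<and> (\<forall>K\<in>\<T>. polytopic K) \<and> non_overlapping \<T> \<and> closure \<Omega> = \<Union>\<T>"

definition simplicial_partition :: "'a::euclidean_space set \<Rightarrow> 'a set set \<Rightarrow> bool" where
  "simplicial_partition K \<S> \<longleftrightarrow>
     finite \<S> \<and> (\<forall>T\<in>\<S>. int DIM('a) simplex T) \<and> non_overlapping \<S> \<and> K = \<Union>\<S>"

text \<open>For each simplex \<open>T\<close> that touches \<open>\<partial>K\<close>, the set \<open>F = \<partial>T \<inter> \<partial>K\<close> is a \<open>(d-1)\<close>-simplex, namely a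
  facet of \<open>T\<close>, so that \<open>d |T| / |F|\<close> is the height of \<open>T\<close> over \<open>F\<close>. A \<open>(d-1)\<close>-simplex \<open>\<partial>T \<inter> \<partial>K\<close> that
  is a proper part of a facet of \<open>T\<close>, which a non-conforming partition could produce, is excluded:
  for it \<open>d |T| / |F|\<close> exceeds the height, and no trace inequality follows from a lower bound.\<close>

definition regular_mesh_family :: "real \<Rightarrow> (nat \<Rightarrow> 'a::euclidean_space set set) \<Rightarrow> bool" where
  "regular_mesh_family \<gamma> \<T> \<longleftrightarrow> 0 < \<gamma> \<and>
     (\<forall>n. \<forall>K\<in>\<T> n. \<exists>\<S>. simplicial_partition K \<S> \<and>
        (\<forall>T\<in>\<S>. frontier T \<inter> frontier K \<noteq> {} \<longrightarrow>
           (let F = frontier T \<inter> frontier K in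
              (int DIM('a) - 1) simplex F \<and> F facet_of T \<and>
              \<gamma> * diameter K \<le> real DIM('a) * measure lebesgue T / measure surface_measure F)))"


section \<open>Indices and the constant\<close>

text \<open>For \<open>q = 1\<close> the convention \<open>1 / q' = 0\<close> is implied by \<^prop>\<open>x / 0 = (0::real)\<close>.\<close>

definition conj_index :: "real \<Rightarrow> real" where
  "conj_index q = q / (q - 1)"

definition sobolev_index :: "nat \<Rightarrow> real \<Rightarrow> real" where
  "sobolev_index d q = q * real d / (real d - q)"

definition trace_index :: "nat \<Rightarrow> real \<Rightarrow> real" where
  "trace_index d q = q * (real d - 1) / (real d - q)"

definition C_TR :: "real \<Rightarrow> real \<Rightarrow> nat \<Rightarrow> real \<Rightarrow> real" where
  "C_TR r s d \<gamma> =
     (real d * pi powr (real d * (s - r) / (2 * s)) /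
        (\<gamma> * Gamma (real d / 2 + 1) powr ((s - r) / s)) + (r - 1) / \<gamma>) powr (1 / r)"

end

theory Submission
  imports Defs
begin

text \<open>Let \<open>T\<close> be a simplex of the partition with facet \<open>F\<close> on \<open>\<partial>K\<close> and height \<open>b\<close> over \<open>F\<close>, and place the
  opposite vertex at the origin. For \<open>\<Phi>\<close> convex of linear growth with slopes bounded by \<open>\<eta>\<close>, compare \<open>u\<close>
  with its dilation: convexity gives \<open>\<Phi>(u x) - \<Phi>(u (l x)) \<le> \<eta>(u x) \<bar>u x - u (l x)\<bar>\<close>, and
  \<open>u x - u (l x)\<close> is the integral of \<open>\<nabla>u\<close> along the ray through \<open>x\<close>. Integrating over \<open>T\<close>, dividing by
  \<open>1 - l\<close> and letting \<open>l\<close> tend to \<open>1\<close>, the layer \<open>T - l T\<close> concentrates on \<open>F\<close>, whence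
  \<open>b \<integral>\<^sub>F \<Phi>(u) \<le> d \<integral>\<^sub>T \<Phi>(u) + h\<^sub>K \<integral>\<^sub>T \<eta>(u) \<bar>\<nabla>u\<bar>\<close>. Here \<open>\<gamma> h\<^sub>K \<le> b\<close> because \<open>d \<bar>T\<bar> = b \<bar>F\<bar>\<close>. Summing
  over the boundary simplices, passing to the limit that defines the trace, and letting \<open>\<Phi>\<close> increase to
  \<open>s \<mapsto> \<bar>s\<bar>\<^sup>r\<close> gives
  \<open>\<gamma> h\<^sub>K \<integral>\<^bsub>\<partial>K\<^esub> \<bar>v\<bar>\<^sup>r \<le> d \<integral>\<^sub>K \<bar>v\<bar>\<^sup>r + h\<^sub>K \<integral>\<^sub>K r \<bar>v\<bar>\<^bsup>r-1\<^esup> \<bar>\<nabla>v\<bar>\<close> for every \<open>r \<ge> 1\<close>; the two estimates follow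
  from Hoelder's inequality with \<open>r = q\<close> and with \<open>r = q (d - 1) / (d - q)\<close>. The linear growth of \<open>\<Phi>\<close>
  makes the passage to the limit possible although the approximating functions need not be in \<open>L\<^sup>r\<close>.\<close>

section \<open>Hyperplanes and surface measure\<close>

text \<open>Classically one applies the divergence theorem on \<open>T\<close> to the field
  \<open>\<Phi>(u) (x - p)\<close>, where \<open>p\<close> is the vertex opposite \<open>F\<close>:
  its normal component is \<open>b \<Phi>(u)\<close> on \<open>F\<close> and 0 on the other facets.
  The approximating functions are merely continuous Sobolev functions, so neither the chain rule nor
  a boundary integral is at hand. Differentiation in a dilation parameter replaces the latter, and
  convexity turns the former into an inequality. The simplices have disjoint interiors, so their
  volume terms add up to at most those of \<open>K\<close>; this is why number and size of the
  facets never enter. The additive form of \<open>C_TR\<close> stems from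
  \<open>D S^r + r S^(r-1) B <= (D + r - 1) (S + B)^r\<close> for \<open>D >= 1\<close> and
  \<open>S, B >= 0\<close>. The first estimate takes \<open>D = d\<close> and norms weighted by
  powers of \<open>h\<close>. The second takes \<open>D = d \<omega>^(1/d)\<close> with
  \<open>\<omega>\<close> the volume of the unit ball: Hoelder's inequality on \<open>K\<close>
  produces \<open>\<bar>K\<bar>^(1/d)\<close>, because \<open>1 - r/s = 1/d\<close> for the two
  Sobolev indices, and \<open>\<bar>K\<bar>^(1/d) <= \<omega>^(1/d) h\<close>. The powers of pi and
  Gamma in \<open>C_TR\<close> are then exactly \<open>\<omega>^(1/d)\<close>.\<close>

lemma nn_integral_lborel_affine:
  fixes f :: "'a::euclidean_space \<Rightarrow> ennreal"
  assumes [measurable]: "f \<in> borel_measurable borel" and c: "c \<noteq> 0"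
  shows "(\<integral>\<^sup>+x. f x \<partial>lborel) = ennreal (\<bar>c\<bar> ^ DIM('a)) * (\<integral>\<^sup>+x. f (t + c *\<^sub>R x) \<partial>lborel)"
  by (subst lborel_affine[OF c, of t])
     (simp add: nn_integral_density nn_integral_distr nn_integral_cmult)

lemma nn_integral_lborel_shift:
  fixes f :: "'a::euclidean_space \<Rightarrow> ennreal"
  assumes "f \<in> borel_measurable borel"
  shows "(\<integral>\<^sup>+x. f (x + t) \<partial>lborel) = (\<integral>\<^sup>+x. f x \<partial>lborel)"
  using nn_integral_lborel_affine[OF assms, of 1 t] by (simp add: add.commute)

section \<open>Hyperplane measures and integration over cones\<close>

context
  fixes n :: "'a::euclidean_space" and b :: real
  assumes n: "norm n = 1"
begin

lemma unit_normal_inner: "n \<bullet> n = 1"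
  using n by (simp add: dot_square_norm)

lemma closest_point_hyperplane:
  "closest_point {x. n \<bullet> x = b} x = x - (n \<bullet> x - b) *\<^sub>R n"
proof (rule closest_point_unique[symmetric])
  have "dist x (x - (n \<bullet> x - b) *\<^sub>R n) \<le> dist x z" if "z \<in> {x. n \<bullet> x = b}" for z
  proof -
    have "\<bar>n \<bullet> (x - z)\<bar> \<le> norm n * norm (x - z)"
      by (rule Cauchy_Schwarz_ineq2)
    then show ?thesis using that n by (simp add: dist_norm inner_diff_right)
  qed
  then show "\<forall>z\<in>{x. n \<bullet> x = b}. dist x (x - (n \<bullet> x - b) *\<^sub>R n) \<le> dist x z" by blast
qed (auto simp: convex_hyperplane closed_hyperplane inner_diff_right unit_normal_inner)

lemma infdist_hyperplane: "infdist x {x. n \<bullet> x = b} = \<bar>n \<bullet> x - b\<bar>"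
proof -
  have "b *\<^sub>R n \<in> {x. n \<bullet> x = b}" by (simp add: unit_normal_inner)
  then have "{x. n \<bullet> x = b} \<noteq> {}" by blast
  then have "infdist x {x. n \<bullet> x = b} = dist x (closest_point {x. n \<bullet> x = b} x)"
    by (simp add: infdist_eq_setdist setdist_closest_point closed_hyperplane)
  then show ?thesis
    using n by (simp add: closest_point_hyperplane dist_norm)
qed

text \<open>Unfolds the push-forward into a Lebesgue integral over the slab of thickness 1. The
  further properties of \<open>hyperplane_measure\<close> go back to this formula and to the
  invariance of Lebesgue measure.\<close>

lemma nn_integral_hyperplane_measure:
  assumes [measurable]: "f \<in> borel_measurable borel"
  shows "(\<integral>\<^sup>+z. f z \<partial>hyperplane_measure {x. n \<bullet> x = b}) =
    (\<integral>\<^sup>+x. indicator {-1/2..1/2} (n \<bullet> x - b) * f (x - (n \<bullet> x - b) *\<^sub>R n) \<partial>lborel)"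
proof -
  have [measurable]: "closest_point {x. n \<bullet> x = b} \<in> borel_measurable borel"
    unfolding closest_point_hyperplane[abs_def] by measurable
  have m: "{x. infdist x {x. n \<bullet> x = b} \<le> 1/2} \<in> sets lborel"
    unfolding infdist_hyperplane by measurable
  have "closest_point {x. n \<bullet> x = b} \<in>
      restrict_space lborel {x. infdist x {x. n \<bullet> x = b} \<le> 1/2} \<rightarrow>\<^sub>M borel"
    by (rule measurable_restrict_space1) measurable
  then show ?thesis
    using m unfolding hyperplane_measure_def
    by (subst nn_integral_distr)
      (auto simp: nn_integral_restrict_space closest_point_hyperplane infdist_hyperplane
        abs_if intro!: nn_integral_cong split: split_indicator if_splits)
qed

text \<open>Both sides are compared with the double integral of
  \<open>(x, s) \<mapsto> 1\<^bsub>\<bar>n \<bullet> x - b\<bar> \<le> 1/2\<^esub> f (x + s n)\<close>, using only translation invariance.\<close>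

lemma nn_integral_lborel_hyperplane:
  assumes [measurable]: "f \<in> borel_measurable borel"
  shows "(\<integral>\<^sup>+x. f x \<partial>lborel) =
    (\<integral>\<^sup>+z. (\<integral>\<^sup>+s. f (z + s *\<^sub>R n) \<partial>lborel) \<partial>hyperplane_measure {x. n \<bullet> x = b})"
proof -
  let ?I = "\<lambda>t. indicator {-1/2..1/2::real} t :: ennreal"
  have "(\<integral>\<^sup>+z. (\<integral>\<^sup>+s. f (z + s *\<^sub>R n) \<partial>lborel) \<partial>hyperplane_measure {x. n \<bullet> x = b}) =
    (\<integral>\<^sup>+x. ?I (n \<bullet> x - b) * (\<integral>\<^sup>+s. f (x - (n \<bullet> x - b) *\<^sub>R n + s *\<^sub>R n) \<partial>lborel) \<partial>lborel)"
    by (subst nn_integral_hyperplane_measure) simp_all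
  also have "\<dots> = (\<integral>\<^sup>+x. (\<integral>\<^sup>+s. ?I (n \<bullet> x - b) * f (x + s *\<^sub>R n) \<partial>lborel) \<partial>lborel)"
  proof (rule nn_integral_cong)
    fix x :: 'a
    have "(\<integral>\<^sup>+s. f (x + s *\<^sub>R n) \<partial>lborel) = (\<integral>\<^sup>+s. f (x + (s + - (n \<bullet> x - b)) *\<^sub>R n) \<partial>lborel)"
      by (rule nn_integral_lborel_shift[symmetric]) measurable
    then show "?I (n \<bullet> x - b) * (\<integral>\<^sup>+s. f (x - (n \<bullet> x - b) *\<^sub>R n + s *\<^sub>R n) \<partial>lborel) =
      (\<integral>\<^sup>+s. ?I (n \<bullet> x - b) * f (x + s *\<^sub>R n) \<partial>lborel)"
      by (subst nn_integral_cmult) (simp_all add: algebra_simps)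
  qed
  also have "\<dots> = (\<integral>\<^sup>+s. (\<integral>\<^sup>+x. ?I (n \<bullet> x - b) * f (x + s *\<^sub>R n) \<partial>lborel) \<partial>lborel)"
    by (rule lborel_pair.Fubini') measurable
  also have "\<dots> = (\<integral>\<^sup>+s. (\<integral>\<^sup>+x. ?I (n \<bullet> x - b - s) * f x \<partial>lborel) \<partial>lborel)"
  proof (rule nn_integral_cong)
    fix s :: real
    have "(\<integral>\<^sup>+x. ?I (n \<bullet> x - b - s) * f x \<partial>lborel)
      = (\<integral>\<^sup>+x. ?I (n \<bullet> (x + s *\<^sub>R n) - b - s) * f (x + s *\<^sub>R n) \<partial>lborel)"
      by (rule nn_integral_lborel_shift[symmetric]) measurable
    then show "(\<integral>\<^sup>+x. ?I (n \<bullet> x - b) * f (x + s *\<^sub>R n) \<partial>lborel) =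
      (\<integral>\<^sup>+x. ?I (n \<bullet> x - b - s) * f x \<partial>lborel)"
      by (simp add: inner_add_right unit_normal_inner)
  qed
  also have "\<dots> = (\<integral>\<^sup>+x. (\<integral>\<^sup>+s. ?I (n \<bullet> x - b - s) * f x \<partial>lborel) \<partial>lborel)"
    by (rule lborel_pair.Fubini') measurable
  also have "\<dots> = (\<integral>\<^sup>+x. f x \<partial>lborel)"
  proof (rule nn_integral_cong)
    fix x :: 'a
    have "(\<integral>\<^sup>+s. ?I (n \<bullet> x - b - s) \<partial>lborel) =
      (\<integral>\<^sup>+s. indicator {n \<bullet> x - b - 1/2..n \<bullet> x - b + 1/2} s \<partial>lborel)"
      by (rule nn_integral_cong) (auto split: split_indicator)
    also have "\<dots> = 1"
      by simp
    finally show "(\<integral>\<^sup>+s. ?I (n \<bullet> x - b - s) * f x \<partial>lborel) = f x"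
      by (simp add: nn_integral_multc)
  qed
  finally show ?thesis by simp
qed

lemma AE_hyperplane_measure_mem: "AE z in hyperplane_measure {x. n \<bullet> x = b}. n \<bullet> z = b"
proof (rule AE_I[where N = "{z. n \<bullet> z \<noteq> b}"])
  have "(\<integral>\<^sup>+z. indicator {z. n \<bullet> z \<noteq> b} z \<partial>hyperplane_measure {x. n \<bullet> x = b}) = 0"
    by (subst nn_integral_hyperplane_measure) (simp_all add: inner_diff_right unit_normal_inner)
  then show "emeasure (hyperplane_measure {x. n \<bullet> x = b}) {z. n \<bullet> z \<noteq> b} = 0"
    by simp
qed auto

text \<open>Provides Fubini's theorem for \<open>nn_integral_cone\<close>. The slab has half-width
  1/2, so the part of it that projects into the ball of radius \<open>k\<close> lies in the ball of
  radius \<open>k + 1/2\<close>.\<close>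

lemma sigma_finite_hyperplane_measure:
  "sigma_finite_measure (hyperplane_measure {x. n \<bullet> x = b})"
proof
  let ?A = "\<lambda>k::nat. cball (0::'a) (real k)"
  have "emeasure (hyperplane_measure {x. n \<bullet> x = b}) (?A k) \<noteq> \<infinity>" for k
  proof -
    have "emeasure (hyperplane_measure {x. n \<bullet> x = b}) (?A k) =
      (\<integral>\<^sup>+z. indicator (?A k) z \<partial>hyperplane_measure {x. n \<bullet> x = b})"
      by simp
    also have "\<dots> = (\<integral>\<^sup>+x. indicator {-1/2..1/2} (n \<bullet> x - b) *
      indicator (?A k) (x - (n \<bullet> x - b) *\<^sub>R n) \<partial>lborel)"
      by (intro nn_integral_hyperplane_measure borel_measurable_indicator borel_closed closed_cball)
    also have "\<dots> \<le> (\<integral>\<^sup>+x. indicator (cball (0::'a) (k + 1/2)) x \<partial>lborel)"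
    proof (rule nn_integral_mono)
      fix x :: 'a
      have "norm x \<le> norm (x - (n \<bullet> x - b) *\<^sub>R n) + norm ((n \<bullet> x - b) *\<^sub>R n)"
        by (metis diff_add_cancel norm_triangle_ineq)
      moreover have "norm ((n \<bullet> x - b) *\<^sub>R n) = \<bar>n \<bullet> x - b\<bar>" using n by simp
      ultimately show "indicator {-1/2..1/2} (n \<bullet> x - b) *
          indicator (?A k) (x - (n \<bullet> x - b) *\<^sub>R n) \<le> (indicator (cball 0 (k + 1/2)) x :: ennreal)"
        by (auto split: split_indicator)
    qed
    also have "\<dots> < \<infinity>" using emeasure_lborel_cball_finite[of "0::'a" "k + 1/2"] by simp
    finally show ?thesis by simp
  qed
  moreover have "(\<Union>k. ?A k) = UNIV"
    by (auto simp: real_arch_simple)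
  ultimately show "\<exists>A. countable A \<and> A \<subseteq> sets (hyperplane_measure {x. n \<bullet> x = b}) \<and>
     \<Union> A = space (hyperplane_measure {x. n \<bullet> x = b}) \<and>
     (\<forall>a\<in>A. emeasure (hyperplane_measure {x. n \<bullet> x = b}) a \<noteq> \<infinity>)"
    by (intro exI[of _ "range ?A"]) (auto simp: hyperplane_measure_def)
qed

text \<open>The thickness 1 in the definition is a normalisation. A slab of arbitrary thickness
  \<open>t\<close> is needed because a dilation changes the thickness.\<close>

lemma nn_integral_hyperplane_measure_slab:
  assumes [measurable]: "f \<in> borel_measurable borel" and "0 \<le> t"
  shows "ennreal t * (\<integral>\<^sup>+z. f z \<partial>hyperplane_measure {x. n \<bullet> x = b}) =
    (\<integral>\<^sup>+x. indicator {0..t} (n \<bullet> x - b) * f (x - (n \<bullet> x - b) *\<^sub>R n) \<partial>lborel)"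
proof -
  have "(\<integral>\<^sup>+x. indicator {0..t} (n \<bullet> x - b) * f (x - (n \<bullet> x - b) *\<^sub>R n) \<partial>lborel) =
    (\<integral>\<^sup>+z. (\<integral>\<^sup>+s. indicator {0..t} (n \<bullet> (z + s *\<^sub>R n) - b) *
        f (z + s *\<^sub>R n - (n \<bullet> (z + s *\<^sub>R n) - b) *\<^sub>R n) \<partial>lborel)
      \<partial>hyperplane_measure {x. n \<bullet> x = b})"
    by (rule nn_integral_lborel_hyperplane) measurable
  also have "\<dots> = (\<integral>\<^sup>+z. (\<integral>\<^sup>+s. indicator {0..t} s * f z \<partial>lborel)
      \<partial>hyperplane_measure {x. n \<bullet> x = b})"
    using AE_hyperplane_measure_mem
    by (intro nn_integral_cong_AE, eventually_elim)
      (simp add: inner_add_right unit_normal_inner)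
  also have "\<dots> = ennreal t * (\<integral>\<^sup>+z. f z \<partial>hyperplane_measure {x. n \<bullet> x = b})"
    using \<open>0 \<le> t\<close> by (simp add: nn_integral_multc nn_integral_cmult
        measurable_cong_sets[OF sets_hyperplane_measure refl])
  finally show ?thesis ..
qed

text \<open>The dilation by \<open>t\<close> about the point \<open>b n\<close> of the hyperplane
  maps the slab of thickness 1 onto the slab of thickness \<open>t\<close>. Lebesgue measure
  contributes \<open>t^d\<close>, and one factor \<open>t\<close> is the thickness and
  cancels.\<close>

lemma nn_integral_hyperplane_measure_scale:
  assumes [measurable]: "f \<in> borel_measurable borel" and "0 < t"
  shows "(\<integral>\<^sup>+z. f z \<partial>hyperplane_measure {x. n \<bullet> x = b}) = ennreal (t ^ (DIM('a) - 1)) *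
    (\<integral>\<^sup>+z. f (b *\<^sub>R n + t *\<^sub>R (z - b *\<^sub>R n)) \<partial>hyperplane_measure {x. n \<bullet> x = b})"
proof -
  let ?\<sigma> = "hyperplane_measure {x. n \<bullet> x = b}"
  have "ennreal t * (\<integral>\<^sup>+z. f z \<partial>?\<sigma>) =
    (\<integral>\<^sup>+x. indicator {0..t} (n \<bullet> x - b) * f (x - (n \<bullet> x - b) *\<^sub>R n) \<partial>lborel)"
    using assms by (intro nn_integral_hyperplane_measure_slab) auto
  also have "\<dots> = ennreal (\<bar>t\<bar> ^ DIM('a)) *
     (\<integral>\<^sup>+x. indicator {0..t} (n \<bullet> ((b *\<^sub>R n - t *\<^sub>R b *\<^sub>R n) + t *\<^sub>R x) - b) *
      f ((b *\<^sub>R n - t *\<^sub>R b *\<^sub>R n) + t *\<^sub>R x - (n \<bullet> ((b *\<^sub>R n - t *\<^sub>R b *\<^sub>R n) + t *\<^sub>R x) - b) *\<^sub>R n) \<partial>lborel)"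
    using assms by (intro nn_integral_lborel_affine) auto
  also have "(\<integral>\<^sup>+x. indicator {0..t} (n \<bullet> ((b *\<^sub>R n - t *\<^sub>R b *\<^sub>R n) + t *\<^sub>R x) - b) *
      f ((b *\<^sub>R n - t *\<^sub>R b *\<^sub>R n) + t *\<^sub>R x - (n \<bullet> ((b *\<^sub>R n - t *\<^sub>R b *\<^sub>R n) + t *\<^sub>R x) - b) *\<^sub>R n) \<partial>lborel) =
      (\<integral>\<^sup>+x. indicator {0..1} (n \<bullet> x - b) *
        f (b *\<^sub>R n + t *\<^sub>R (x - (n \<bullet> x - b) *\<^sub>R n - b *\<^sub>R n)) \<partial>lborel)"
  proof (rule nn_integral_cong)
    fix x :: 'a
    have e: "n \<bullet> ((b *\<^sub>R n - t *\<^sub>R b *\<^sub>R n) + t *\<^sub>R x) - b = t * (n \<bullet> x - b)"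
      by (simp add: inner_add_right inner_diff_right unit_normal_inner algebra_simps)
    have i: "t * (n \<bullet> x - b) \<in> {0..t} \<longleftrightarrow> n \<bullet> x - b \<in> {0..1}"
      using \<open>0 < t\<close> mult_le_cancel_left_pos[of t "n \<bullet> x - b" 1]
      by (auto simp: zero_le_mult_iff)
    show "indicator {0..t} (n \<bullet> ((b *\<^sub>R n - t *\<^sub>R b *\<^sub>R n) + t *\<^sub>R x) - b) *
      f ((b *\<^sub>R n - t *\<^sub>R b *\<^sub>R n) + t *\<^sub>R x - (n \<bullet> ((b *\<^sub>R n - t *\<^sub>R b *\<^sub>R n) + t *\<^sub>R x) - b) *\<^sub>R n) =
      indicator {0..1} (n \<bullet> x - b) * f (b *\<^sub>R n + t *\<^sub>R (x - (n \<bullet> x - b) *\<^sub>R n - b *\<^sub>R n))"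
      unfolding e indicator_def i by (simp add: algebra_simps)
  qed
  also have "\<dots> = ennreal 1 * (\<integral>\<^sup>+z. f (b *\<^sub>R n + t *\<^sub>R (z - b *\<^sub>R n)) \<partial>?\<sigma>)"
    by (rule nn_integral_hyperplane_measure_slab[symmetric]) auto
  also have "ennreal (\<bar>t\<bar> ^ DIM('a)) = ennreal t * ennreal (t ^ (DIM('a) - 1))"
    using \<open>0 < t\<close> power_minus_mult[of "DIM('a)" t]
    by (simp add: ennreal_mult'[symmetric] mult.commute)
  finally have "ennreal t * (\<integral>\<^sup>+z. f z \<partial>?\<sigma>) =
    ennreal t * (ennreal (t ^ (DIM('a) - 1)) * (\<integral>\<^sup>+z. f (b *\<^sub>R n + t *\<^sub>R (z - b *\<^sub>R n)) \<partial>?\<sigma>))"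
    by (simp add: mult.assoc)
  then show ?thesis
    using \<open>0 < t\<close> by (simp add: ennreal_mult_cancel_left)
qed

text \<open>Polar coordinates with a hyperplane in place of the sphere. The plane
  \<open>n \<bullet> x = b t\<close> is the \<open>t\<close>-dilate of
  \<open>n \<bullet> x = b\<close>, which gives \<open>t^(d-1)\<close>, and the distance between
  neighbouring planes is \<open>b dt\<close>. Only the half-space in \<open>supp\<close> is reached
  by \<open>t > 0\<close>.\<close>

lemma nn_integral_cone:
  assumes [measurable]: "f \<in> borel_measurable borel" and "0 < b"
    and supp: "\<And>x. f x \<noteq> 0 \<Longrightarrow> 0 < n \<bullet> x"
  shows "(\<integral>\<^sup>+x. f x \<partial>lborel) = ennreal b *
    (\<integral>\<^sup>+y. (\<integral>\<^sup>+t. indicator {0<..} t * ennreal (t ^ (DIM('a) - 1)) * f (t *\<^sub>R y) \<partial>lborel)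
      \<partial>hyperplane_measure {x. n \<bullet> x = b})"
proof -
  let ?\<sigma> = "hyperplane_measure {x. n \<bullet> x = b}"
  interpret \<sigma>: sigma_finite_measure ?\<sigma> by (rule sigma_finite_hyperplane_measure)
  interpret P: pair_sigma_finite ?\<sigma> "lborel :: real measure" ..
  note [measurable_cong] = sets_hyperplane_measure
  have "(\<integral>\<^sup>+x. f x \<partial>lborel) = (\<integral>\<^sup>+z. (\<integral>\<^sup>+s. f (z + s *\<^sub>R n) \<partial>lborel) \<partial>?\<sigma>)"
    by (rule nn_integral_lborel_hyperplane) measurable
  \<comment> \<open>The signed distance \<open>s = - b + b t\<close> from the base plane makes
    \<open>t\<close> the height over the origin in units of \<open>b\<close>.\<close>
  also have "\<dots> = (\<integral>\<^sup>+z. ennreal b * (\<integral>\<^sup>+t. f (z + (- b + b * t) *\<^sub>R n) \<partial>lborel) \<partial>?\<sigma>)"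
  proof (rule nn_integral_cong)
    fix z show "(\<integral>\<^sup>+s. f (z + s *\<^sub>R n) \<partial>lborel) =
       ennreal b * (\<integral>\<^sup>+t. f (z + (- b + b * t) *\<^sub>R n) \<partial>lborel)"
      using \<open>0 < b\<close> nn_integral_real_affine[of "\<lambda>s. f (z + s *\<^sub>R n)" b "-b"] by simp
  qed
  also have "\<dots> = ennreal b * (\<integral>\<^sup>+z. (\<integral>\<^sup>+t. f (z + (- b + b * t) *\<^sub>R n) \<partial>lborel) \<partial>?\<sigma>)"
    by (rule nn_integral_cmult) measurable
  also have "(\<integral>\<^sup>+z. (\<integral>\<^sup>+t. f (z + (- b + b * t) *\<^sub>R n) \<partial>lborel) \<partial>?\<sigma>) =
    (\<integral>\<^sup>+t. (\<integral>\<^sup>+z. f (z + (- b + b * t) *\<^sub>R n) \<partial>?\<sigma>) \<partial>lborel)"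
    by (rule P.Fubini'[symmetric]) measurable
  also have "\<dots> = (\<integral>\<^sup>+t. (\<integral>\<^sup>+y. indicator {0<..} t * ennreal (t ^ (DIM('a) - 1)) * f (t *\<^sub>R y) \<partial>?\<sigma>) \<partial>lborel)"
  proof (rule nn_integral_cong)
    fix t :: real
    show "(\<integral>\<^sup>+z. f (z + (- b + b * t) *\<^sub>R n) \<partial>?\<sigma>) =
      (\<integral>\<^sup>+y. indicator {0<..} t * ennreal (t ^ (DIM('a) - 1)) * f (t *\<^sub>R y) \<partial>?\<sigma>)"
    proof (cases "0 < t")
      case True
      have "(\<integral>\<^sup>+z. f (z + (- b + b * t) *\<^sub>R n) \<partial>?\<sigma>) = ennreal (t ^ (DIM('a) - 1)) *
        (\<integral>\<^sup>+z. f (b *\<^sub>R n + t *\<^sub>R (z - b *\<^sub>R n) + (- b + b * t) *\<^sub>R n) \<partial>?\<sigma>)"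
        by (rule nn_integral_hyperplane_measure_scale[OF _ True]) measurable
      also have "\<dots> = (\<integral>\<^sup>+y. ennreal (t ^ (DIM('a) - 1)) * f (t *\<^sub>R y) \<partial>?\<sigma>)"
        by (subst nn_integral_cmult) (measurable, simp add: algebra_simps)
      finally show ?thesis using True by simp
    next
      case False
      have "(\<integral>\<^sup>+z. f (z + (- b + b * t) *\<^sub>R n) \<partial>?\<sigma>) = (\<integral>\<^sup>+z. 0 \<partial>?\<sigma>)"
      proof (rule nn_integral_cong_AE, use AE_hyperplane_measure_mem in eventually_elim)
        case (elim z)
        have "\<not> 0 < n \<bullet> (z + (- b + b * t) *\<^sub>R n)"
          using False \<open>0 < b\<close> elim
          by (simp add: inner_add_right unit_normal_inner zero_less_mult_iff)
        then show ?case using supp by blast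
      qed
      then show ?thesis using False by simp
    qed
  qed
  also have "\<dots> = (\<integral>\<^sup>+y. (\<integral>\<^sup>+t. indicator {0<..} t * ennreal (t ^ (DIM('a) - 1)) * f (t *\<^sub>R y) \<partial>lborel) \<partial>?\<sigma>)"
    by (rule P.Fubini') measurable
  finally show ?thesis .
qed

end

text \<open>The preimage of \<open>A\<close> under the projection onto the other hyperplane lies in
  \<open>{x. a \<bullet> x = e}\<close>, where \<open>a\<close> is the component of \<open>n\<close>
  orthogonal to \<open>m\<close>. If \<open>a\<close> is nonzero, this is a null set of Lebesgue
  measure; if \<open>a = 0\<close>, the two planes are parallel and distinct, so \<open>e\<close> is
  nonzero and the set is empty.\<close>

lemma hyperplane_measure_other:
  fixes n m :: "'a::euclidean_space"
  assumes n: "norm n = 1" and m: "norm m = 1"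
    and ne: "{x. m \<bullet> x = c} \<noteq> {x. n \<bullet> x = b}"
    and A: "A \<in> sets borel" "A \<subseteq> {x. n \<bullet> x = b}"
  shows "emeasure (hyperplane_measure {x. m \<bullet> x = c}) A = 0"
proof -
  define a where "a = n - (n \<bullet> m) *\<^sub>R m"
  define e where "e = b - (n \<bullet> m) * c"
  have eq: "n \<bullet> (x - (m \<bullet> x - c) *\<^sub>R m) = b \<longleftrightarrow> a \<bullet> x = e" for x
    by (auto simp: a_def e_def inner_diff_right inner_diff_left algebra_simps)
  have "AE x in lborel. a \<bullet> x \<noteq> e"
  proof (cases "a = 0")
    case True
    have "n = (n \<bullet> m) *\<^sub>R m" using True by (simp add: a_def)
    moreover from this n m have "\<bar>n \<bullet> m\<bar> = 1"
      by (metis norm_scaleR mult.right_neutral)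
    ultimately have nm: "n = m \<and> n \<bullet> m = 1 \<or> n = - m \<and> n \<bullet> m = -1"
      by (cases "n \<bullet> m = 1") (auto simp: abs_if split: if_splits)
    have "e \<noteq> 0"
      using ne nm by (auto simp: e_def)
    with True show ?thesis by simp
  next
    case False
    then have "AE x in lborel. x \<notin> {x. a \<bullet> x = e}"
      using negligible_hyperplane[of a e] closed_hyperplane[of a e]
      by (intro AE_not_in) (simp add: null_sets_completion_iff negligible_iff_null_sets borel_closed)
    then show ?thesis by simp
  qed
  then have "(\<integral>\<^sup>+x. indicator {-1/2..1/2} (m \<bullet> x - c) * indicator A (x - (m \<bullet> x - c) *\<^sub>R m) \<partial>lborel) =
    (\<integral>\<^sup>+x. 0 \<partial>(lborel :: 'a measure))"
    using A(2) eq by (intro nn_integral_cong_AE) (force elim: eventually_mono split: split_indicator)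
  moreover have "(\<integral>\<^sup>+z. indicator A z \<partial>hyperplane_measure {x. m \<bullet> x = c}) =
    (\<integral>\<^sup>+x. indicator {-1/2..1/2} (m \<bullet> x - c) * indicator A (x - (m \<bullet> x - c) *\<^sub>R m) \<partial>lborel)"
    using A by (intro nn_integral_hyperplane_measure[OF m] borel_measurable_indicator)
  ultimately show ?thesis using A by simp
qed

section \<open>The surface measure inside a single hyperplane\<close>

lemma hyperplanes_unit_normal:
  assumes "H \<in> hyperplanes"
  obtains m c where "norm m = 1" "H = {x. m \<bullet> x = c}"
proof -
  obtain a b where ab: "a \<noteq> 0" "H = {x. a \<bullet> x = b}"
    using assms by (auto simp: hyperplanes_def)
  have "H = {x. (a /\<^sub>R norm a) \<bullet> x = b / norm a}"
    using ab by (auto simp: field_simps)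
  with ab show thesis by (intro that[of "a /\<^sub>R norm a" "b / norm a"]) auto
qed

text \<open>In the sum over all hyperplanes only the term of the plane containing \<open>A\<close>
  survives.\<close>

lemma emeasure_surface_measure_hyperplane:
  fixes n :: "'a::euclidean_space"
  assumes n: "norm n = 1" and A: "A \<in> sets borel" "A \<subseteq> {x. n \<bullet> x = b}"
  shows "emeasure surface_measure A = emeasure (hyperplane_measure {x. n \<bullet> x = b}) A"
proof -
  let ?H = "{x. n \<bullet> x = b}"
  have H: "?H \<in> hyperplanes" using n by (auto simp: hyperplanes_def intro!: exI[of _ n])
  have "emeasure surface_measure A =
    (\<integral>\<^sup>+H. emeasure (hyperplane_measure H) A * indicator {?H} H \<partial>count_space hyperplanes)"
    unfolding emeasure_surface_measure[OF A(1)]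
  proof (rule nn_integral_cong)
    fix H assume "H \<in> space (count_space (hyperplanes :: 'a set set))"
    then have "H \<in> hyperplanes" by simp
    then obtain m c where "norm m = 1" "H = {x. m \<bullet> x = c}" by (rule hyperplanes_unit_normal)
    then show "emeasure (hyperplane_measure H) A =
      emeasure (hyperplane_measure H) A * indicator {?H} H"
      using hyperplane_measure_other[OF n _ _ A] by (auto split: split_indicator)
  qed
  also have "\<dots> = emeasure (hyperplane_measure ?H) A"
    using H by (subst nn_integral_indicator_singleton) auto
  finally show ?thesis .
qed

lemma nn_integral_surface_measure_hyperplane:
  fixes n :: "'a::euclidean_space"
  assumes n: "norm n = 1" and F: "F \<in> sets borel" "F \<subseteq> {x. n \<bullet> x = b}"
  shows "(\<integral>\<^sup>+x. f x * indicator F x \<partial>surface_measure) =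
    (\<integral>\<^sup>+x. f x * indicator F x \<partial>hyperplane_measure {x. n \<bullet> x = b})"
proof -
  have "restrict_space surface_measure F = restrict_space (hyperplane_measure {x. n \<bullet> x = b}) F"
  proof (rule measure_eqI)
    fix A assume "A \<in> sets (restrict_space surface_measure F)"
    then have "A \<subseteq> F" "A \<in> sets borel"
      using F by (auto simp: sets_restrict_space)
    then show "emeasure (restrict_space surface_measure F) A =
      emeasure (restrict_space (hyperplane_measure {x. n \<bullet> x = b}) F) A"
      using F by (subst (1 2) emeasure_restrict_space)
        (auto intro!: emeasure_surface_measure_hyperplane[OF n])
  qed (simp add: sets_restrict_space)
  then show ?thesis
    using F nn_integral_restrict_space[of F surface_measure f]
      nn_integral_restrict_space[of F "hyperplane_measure {x. n \<bullet> x = b}" f]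
    by simp
qed

text \<open>A sum of nonnegative terms vanishes only if each of them does. This carries the
  exceptional set of an approximating function over to the plane of each facet.\<close>

lemma null_sets_surface_measure_hyperplane:
  assumes "N \<in> null_sets surface_measure" "norm n = 1"
  shows "N \<in> null_sets (hyperplane_measure {x. n \<bullet> x = b})"
proof -
  have N: "N \<in> sets borel" "(\<integral>\<^sup>+H. emeasure (hyperplane_measure H) N \<partial>count_space hyperplanes) = 0"
    using assms by (auto simp: null_sets_def emeasure_surface_measure)
  moreover have "{x. n \<bullet> x = b} \<in> hyperplanes"
    using assms by (auto simp: hyperplanes_def intro!: exI[of _ n])
  ultimately show ?thesis
    by (auto simp: nn_integral_0_iff_AE AE_count_space null_sets_def)
qed

section \<open>Test functions\<close>

text \<open>The standard smooth function \<open>exp (- 1 / x)\<close>, extended by 0. Dividing by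
  powers of \<open>x\<close> makes the family closed under differentiation up to linear
  combinations.\<close>

definition bump :: "nat \<Rightarrow> real \<Rightarrow> real" where
  "bump k x = (if 0 < x then exp (- 1 / x) / x ^ k else 0)"

lemma bump_0_bounds: "0 \<le> bump 0 x" "bump 0 x \<le> 1" "bump 0 x \<noteq> 0 \<longleftrightarrow> 0 < x"
  by (auto simp: bump_def)

lemma bump_tendsto_0: "(bump k \<longlongrightarrow> 0) (at 0)"
proof (rule filterlim_split_at)
  show "(bump k \<longlongrightarrow> 0) (at_left 0)"
    by (rule tendsto_eventually) (auto simp: eventually_at_filter bump_def)
  have "((\<lambda>x. inverse x ^ k / exp (inverse x :: real)) \<longlongrightarrow> 0) (at_right 0)"
    by (rule filterlim_compose[OF tendsto_power_div_exp_0 filterlim_inverse_at_top_right])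
  moreover have "\<forall>\<^sub>F x in at_right 0. inverse x ^ k / exp (inverse x) = bump k x"
    by (auto simp: eventually_at_filter bump_def field_simps exp_minus)
  ultimately show "(bump k \<longlongrightarrow> 0) (at_right 0)"
    by (rule Lim_transform_eventually)
qed

lemma bump_has_real_derivative:
  "(bump k has_real_derivative (bump (k + 2) x - real k * bump (k + 1) x)) (at x)"
proof -
  consider "x < 0" | "x = 0" | "0 < x" by linarith
  then show ?thesis
  proof cases
    case 1
    have "((\<lambda>_. 0) has_real_derivative 0) (at x)" by simp
    then have "(bump k has_real_derivative 0) (at x)"
      by (rule has_field_derivative_transform_within_open[where S = "{..<0}"])
        (use 1 in \<open>auto simp: bump_def\<close>)
    then show ?thesis using 1 by (simp add: bump_def)
  next
    case 2
    \<comment> \<open>The difference quotient of \<open>bump k\<close> at 0 is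
      \<open>bump (k + 1)\<close>, which tends to 0.\<close>
    have "\<forall>\<^sub>F y in at 0. bump (k + 1) y = bump k y / y"
      by (auto simp: eventually_at_filter bump_def)
    then have "((\<lambda>y. bump k y / y) \<longlongrightarrow> 0) (at 0)"
      by (rule Lim_transform_eventually[OF bump_tendsto_0])
    then show ?thesis
      using 2 by (simp add: has_field_derivative_iff bump_def)
  next
    case 3
    have k: "real k * x ^ (k - 1) = real k * x ^ k / x"
      using 3 by (cases k) auto
    have "((\<lambda>x. exp (- 1 / x) / x ^ k) has_real_derivative
      (exp (- 1 / x) / (x * x) * x ^ k - exp (- 1 / x) * (real k * x ^ (k - 1))) / (x ^ k * x ^ k)) (at x)"
      using 3 by (auto intro!: derivative_eq_intros)
    also have "(exp (- 1 / x) / (x * x) * x ^ k - exp (- 1 / x) * (real k * x ^ (k - 1))) / (x ^ k * x ^ k) =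
      bump (k + 2) x - real k * bump (k + 1) x"
      using 3 unfolding k bump_def by (simp add: field_simps)
    finally have "((\<lambda>x. exp (- 1 / x) / x ^ k) has_real_derivative
      bump (k + 2) x - real k * bump (k + 1) x) (at x)" .
    then show ?thesis
      by (rule has_field_derivative_transform_within_open[where S = "{0<..}"])
        (use 3 in \<open>auto simp: bump_def\<close>)
  qed
qed

text \<open>An algebra of functions that is closed under partial derivatives; its members are smooth by
  coinduction.\<close>

inductive smooth_algebra :: "('a::euclidean_space \<Rightarrow> real) \<Rightarrow> bool" where
  smooth: "smooth \<phi> \<Longrightarrow> smooth_algebra (\<lambda>x. \<phi> (p + c *\<^sub>R x))"
| const: "smooth_algebra (\<lambda>_. c)"
| inner: "smooth_algebra (\<lambda>x. x \<bullet> b)"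
| bump: "smooth_algebra f \<Longrightarrow> smooth_algebra (\<lambda>x. bump k (f x))"
| add: "smooth_algebra f \<Longrightarrow> smooth_algebra g \<Longrightarrow> smooth_algebra (\<lambda>x. f x + g x)"
| mult: "smooth_algebra f \<Longrightarrow> smooth_algebra g \<Longrightarrow> smooth_algebra (\<lambda>x. f x * g x)"

lemma has_derivative_frechet:
  "f differentiable (at x) \<Longrightarrow> (f has_derivative frechet_derivative f (at x)) (at x)"
  by (simp add: frechet_derivative_works)

text \<open>The invariant for the coinduction in \<open>smooth_algebra_imp_smooth\<close>. The
  affine argument in the first introduction rule covers the rescaled test functions along rays and
  the translated ones that arise when the vertex of a simplex is moved to the origin.\<close>

lemma smooth_algebra_derivative:
  fixes f :: "'a::euclidean_space \<Rightarrow> real"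
  assumes "smooth_algebra f"
  shows "(\<forall>x. f differentiable (at x)) \<and>
    (\<forall>b. b \<in> Basis \<longrightarrow> smooth_algebra (\<lambda>x. frechet_derivative f (at x) b))"
  using assms
proof induction
  case (smooth \<phi> p c)
  have d: "\<phi> differentiable (at x)" for x using smooth.cases[OF smooth] by blast
  have D: "((\<lambda>x. \<phi> (p + c *\<^sub>R x)) has_derivative
     (\<lambda>h. frechet_derivative \<phi> (at (p + c *\<^sub>R x)) (c *\<^sub>R h))) (at x)" for x
  proof -
    have "((\<lambda>x. p + c *\<^sub>R x) has_derivative (\<lambda>h. c *\<^sub>R h)) (at x)"
      by (auto intro!: derivative_eq_intros)
    from has_derivative_compose[OF this has_derivative_frechet[OF d]] show ?thesis by simp
  qed
  have "smooth_algebra (\<lambda>x. frechet_derivative (\<lambda>x. \<phi> (p + c *\<^sub>R x)) (at x) b)" if "b \<in> Basis" for b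
  proof -
    have "smooth (\<lambda>x. frechet_derivative \<phi> (at x) b)"
      using smooth.cases[OF smooth] that by blast
    then have "smooth_algebra (\<lambda>x. c * frechet_derivative \<phi> (at (p + c *\<^sub>R x)) b)"
      by (intro smooth_algebra.intros(2,6) smooth_algebra.intros(1)[of "\<lambda>x. frechet_derivative \<phi> (at x) b"])
    moreover have "frechet_derivative (\<lambda>x. \<phi> (p + c *\<^sub>R x)) (at x) b =
        c * frechet_derivative \<phi> (at (p + c *\<^sub>R x)) b" for x
      using frechet_derivative_at[OF D, of x, symmetric]
        linear_frechet_derivative[OF d, of "p + c *\<^sub>R x"] by (simp add: linear_scale)
    ultimately show ?thesis by simp
  qed
  then show ?case using D differentiable_def by blast
next
  case (const c)
  then show ?case by (auto intro: smooth_algebra.intros)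
next
  case (inner b)
  have D: "((\<lambda>x. x \<bullet> b) has_derivative (\<lambda>h. h \<bullet> b)) (at x)" for x :: 'a
    by (auto intro!: derivative_eq_intros)
  then show ?case
    by (auto simp: frechet_derivative_at[OF D, symmetric] differentiable_def intro: smooth_algebra.intros)
next
  case (bump f k)
  then have D: "((\<lambda>x. bump k (f x)) has_derivative
     (\<lambda>h. (bump (k + 2) (f x) + (- real k) * bump (k + 1) (f x)) * frechet_derivative f (at x) h)) (at x)" for x
    using has_derivative_compose[OF has_derivative_frechet[of f x]
        bump_has_real_derivative[of k "f x", unfolded has_field_derivative_def]]
    by (simp add: algebra_simps)
  have "smooth_algebra (\<lambda>x. (bump (k + 2) (f x) + (- real k) * bump (k + 1) (f x)) *
      frechet_derivative f (at x) b)" if "b \<in> Basis" for b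
    using bump that
    by (intro smooth_algebra.mult smooth_algebra.add smooth_algebra.const smooth_algebra.bump) auto
  then show ?case
    using D unfolding frechet_derivative_at[OF D, symmetric] differentiable_def by blast
next
  case (add f g)
  then have D: "((\<lambda>x. f x + g x) has_derivative
     (\<lambda>h. frechet_derivative f (at x) h + frechet_derivative g (at x) h)) (at x)" for x
    by (intro has_derivative_add has_derivative_frechet) auto
  then show ?case
    using add by (auto simp: frechet_derivative_at[OF D, symmetric] differentiable_def
        intro!: smooth_algebra.intros)
next
  case (mult f g)
  then have D: "((\<lambda>x. f x * g x) has_derivative
     (\<lambda>h. f x * frechet_derivative g (at x) h + frechet_derivative f (at x) h * g x)) (at x)" for x
    by (intro has_derivative_mult has_derivative_frechet) auto
  then show ?case
    using mult by (auto simp: frechet_derivative_at[OF D, symmetric] differentiable_def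
        intro!: smooth_algebra.intros)
qed

lemma smooth_algebra_imp_smooth: "smooth_algebra f \<Longrightarrow> smooth f"
  by (coinduction arbitrary: f rule: smooth.coinduct) (use smooth_algebra_derivative in blast)

lemma smooth_imp_smooth_algebra: "smooth \<phi> \<Longrightarrow> smooth_algebra \<phi>"
  using smooth_algebra.smooth[of \<phi> 0 1] by simp

lemma smooth_algebra_prod:
  "finite A \<Longrightarrow> (\<And>i. i \<in> A \<Longrightarrow> smooth_algebra (f i)) \<Longrightarrow> smooth_algebra (\<lambda>x. \<Prod>i\<in>A. f i x)"
  by (induction A rule: finite_induct) (auto intro: smooth_algebra.intros)

lemma smooth_mult: "smooth f \<Longrightarrow> smooth g \<Longrightarrow> smooth (\<lambda>x. f x * g x)"
  by (rule smooth_algebra_imp_smooth[OF smooth_algebra.mult]) (rule smooth_imp_smooth_algebra; assumption)+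

lemma smooth_differentiable: "smooth \<phi> \<Longrightarrow> \<phi> differentiable (at x)"
  by (erule smooth.cases) blast

lemma smooth_continuous_on: "smooth \<phi> \<Longrightarrow> continuous_on S \<phi>"
  by (meson smooth_differentiable continuous_at_imp_continuous_on differentiable_imp_continuous_within)

lemma smooth_derivative: "smooth \<phi> \<Longrightarrow> b \<in> Basis \<Longrightarrow> smooth (\<lambda>x. frechet_derivative \<phi> (at x) b)"
  by (erule smooth.cases) blast

lemma test_functionI:
  assumes "smooth \<phi>" "compact C" "C \<subseteq> U" "\<And>x. \<phi> x \<noteq> 0 \<Longrightarrow> x \<in> C"
  shows "test_function U \<phi>"
proof -
  have "closure {x. \<phi> x \<noteq> 0} \<subseteq> C"
    using assms by (intro closure_minimal compact_imp_closed) auto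
  then show ?thesis
    using assms compact_imp_bounded[of C] bounded_subset[of C "{x. \<phi> x \<noteq> 0}"]
    by (auto simp: test_function_def)
qed

section \<open>Supports and bounds of test functions\<close>

lemma integrable_mult_bounded:
  fixes f h :: "'a \<Rightarrow> real"
  assumes f: "integrable M f" and [measurable]: "h \<in> borel_measurable M" and B: "\<And>x. \<bar>h x\<bar> \<le> B"
  shows "integrable M (\<lambda>x. f x * h x)"
proof (rule Bochner_Integration.integrable_bound)
  show "integrable M (\<lambda>x. B * f x)" using f by simp
  have "\<bar>f x\<bar> * \<bar>h x\<bar> \<le> \<bar>f x\<bar> * \<bar>B\<bar>" for x
    using B[of x] by (intro mult_left_mono) auto
  then show "AE x in M. norm (f x * h x) \<le> norm (B * f x)"
    by (simp add: abs_mult mult.commute)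
qed (use f in measurable)

lemma compact_support_bounded:
  fixes f :: "'a::euclidean_space \<Rightarrow> real"
  assumes "continuous_on UNIV f" "compact C" "\<And>x. x \<notin> C \<Longrightarrow> f x = 0"
  obtains B where "0 \<le> B" "\<And>x. \<bar>f x\<bar> \<le> B"
proof -
  have "bounded (f ` C)"
    using assms by (intro compact_imp_bounded compact_continuous_image) (auto intro: continuous_on_subset)
  then obtain B where B: "\<And>x. x \<in> C \<Longrightarrow> \<bar>f x\<bar> \<le> B"
    by (auto simp: bounded_iff)
  have "\<bar>f x\<bar> \<le> max B 0" for x
    using B[of x] assms(3)[of x] by (cases "x \<in> C") auto
  then show thesis by (intro that[of "max B 0"]) auto
qed

lemma frechet_derivative_zero_outside:
  assumes "\<And>x. x \<notin> C \<Longrightarrow> \<phi> x = 0" "closed C" "x \<notin> C"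
  shows "frechet_derivative \<phi> (at x) b = (0::real)"
proof -
  have "(\<phi> has_derivative (\<lambda>_. 0)) (at x)"
    by (rule has_derivative_transform_within_open[of "\<lambda>_. 0" _ _ _ "- C"]) (use assms in auto)
  from frechet_derivative_at[OF this] show ?thesis by (metis)
qed

lemma test_function_zero: "test_function U \<phi> \<Longrightarrow> x \<notin> closure {x. \<phi> x \<noteq> 0} \<Longrightarrow> \<phi> x = 0"
  using closure_subset[of "{x. \<phi> x \<noteq> 0}"] by blast

lemma test_function_zero_outside:
  assumes "test_function U \<phi>" "x \<notin> U"
  shows "\<phi> x = 0" "frechet_derivative \<phi> (at x) b = 0"
proof -
  have x: "x \<notin> closure {x. \<phi> x \<noteq> 0}" using assms by (auto simp: test_function_def)
  show "\<phi> x = 0" using test_function_zero[OF assms(1) x] .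
  show "frechet_derivative \<phi> (at x) b = 0"
    by (rule frechet_derivative_zero_outside[OF test_function_zero[OF assms(1)] closed_closure x])
qed

lemma test_function_bounded:
  assumes \<phi>: "test_function U \<phi>" obtains B where "\<And>x. \<bar>\<phi> x\<bar> \<le> B"
proof (rule compact_support_bounded[OF smooth_continuous_on _ test_function_zero[OF \<phi>]])
  show "smooth \<phi>" "compact (closure {x. \<phi> x \<noteq> 0})" using \<phi> by (simp_all add: test_function_def)
qed (assumption, rule that)

lemma smooth_measurable: "smooth \<phi> \<Longrightarrow> \<phi> \<in> borel_measurable borel"
  by (intro borel_measurable_continuous_onI smooth_continuous_on)

text \<open>The parameter \<open>k\<close> controls the steepness: \<open>k = 1\<close> serves as a
  cutoff that is positive exactly on the open box, and large \<open>k\<close> as an approximation of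
  the indicator of the box.\<close>

definition box_bump :: "'a::euclidean_space \<Rightarrow> 'a \<Rightarrow> real \<Rightarrow> 'a \<Rightarrow> real" where
  "box_bump a b k x = (\<Prod>i\<in>Basis. bump 0 (k * (x \<bullet> i - a \<bullet> i)) * bump 0 (k * (b \<bullet> i - x \<bullet> i)))"

lemma smooth_box_bump: "smooth (box_bump a b k)"
proof -
  have "smooth_algebra (\<lambda>x. bump 0 (k * (x \<bullet> i + - (a \<bullet> i))) * bump 0 (k * (b \<bullet> i + (- 1) * (x \<bullet> i))))"
    for i by (intro smooth_algebra.intros)
  then show ?thesis
    unfolding box_bump_def[abs_def] by (intro smooth_algebra_imp_smooth smooth_algebra_prod) auto
qed

lemma box_bump_bounds: "0 \<le> box_bump a b k x" "box_bump a b k x \<le> 1"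
  unfolding box_bump_def
  by (auto intro!: prod_nonneg prod_le_1 mult_nonneg_nonneg mult_le_one simp: bump_0_bounds)

lemma box_bump_nonzero: "0 < k \<Longrightarrow> box_bump a b k x \<noteq> 0 \<longleftrightarrow> x \<in> box a b"
  by (simp add: box_bump_def bump_0_bounds(3) mem_box zero_less_mult_iff)

lemma bump_0_tendsto: "(\<lambda>k. bump 0 (real (Suc k) * t)) \<longlonglongrightarrow> (if 0 < t then 1 else 0)"
proof (cases "0 < t")
  case True
  have "(\<lambda>k. exp (- (inverse (real (Suc k)) / t))) \<longlonglongrightarrow> exp (- (0 / t))"
    using True by (intro tendsto_intros LIMSEQ_inverse_real_of_nat) auto
  moreover have "bump 0 (real (Suc k) * t) = exp (- (inverse (real (Suc k)) / t))" for k
    using True by (simp add: bump_def divide_simps zero_less_mult_iff)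
  ultimately show ?thesis using True by simp
next
  case False
  then have "bump 0 (real (Suc k) * t) = 0" for k
    using bump_0_bounds(3)[of "real (Suc k) * t"] by (auto simp: zero_less_mult_iff)
  then show ?thesis using False by simp
qed

lemma box_bump_tendsto: "(\<lambda>k. box_bump a b (real (Suc k)) x) \<longlonglongrightarrow> indicator (box a b) x"
proof -
  have "(\<lambda>k. box_bump a b (real (Suc k)) x) \<longlonglongrightarrow> (\<Prod>i\<in>Basis. (if 0 < x \<bullet> i - a \<bullet> i then 1 else 0) *
    (if 0 < b \<bullet> i - x \<bullet> i then 1 else 0))"
    unfolding box_bump_def by (intro tendsto_intros bump_0_tendsto)
  also have "(\<Prod>i\<in>Basis. (if 0 < x \<bullet> i - a \<bullet> i then 1 else 0) * (if 0 < b \<bullet> i - x \<bullet> i then 1 else 0)) =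
    (indicator (box a b) x :: real)"
    by (cases "x \<in> box a b") (auto simp: mem_box)
  finally show ?thesis .
qed

text \<open>The positive and the negative part of \<open>h\<close> are densities of two measures of
  finite mass that agree on boxes. Boxes form an intersection-stable generator, so the measures
  coincide, and densities are unique almost everywhere.\<close>

lemma AE_zero_if_box_integrals_zero:
  fixes h :: "'a::euclidean_space \<Rightarrow> real"
  assumes h: "integrable lborel h" and z: "\<And>a b. (\<integral>x. h x * indicator (box a b) x \<partial>lborel) = 0"
  shows "AE x in lborel. h x = 0"
proof -
  have [measurable]: "h \<in> borel_measurable borel" using borel_measurable_integrable[OF h] by simp
  let ?P = "density lborel (\<lambda>x. ennreal (h x))" and ?N = "density lborel (\<lambda>x. ennreal (- h x))"
  have fin: "(\<integral>\<^sup>+x. ennreal (h x) \<partial>lborel) < \<infinity>" "(\<integral>\<^sup>+x. ennreal (- h x) \<partial>lborel) < \<infinity>"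
    using h by (auto simp: real_integrable_def less_top)
  have le: "emeasure ?P A \<le> (\<integral>\<^sup>+x. ennreal (h x) \<partial>lborel)" "emeasure ?N A \<le> (\<integral>\<^sup>+x. ennreal (- h x) \<partial>lborel)"
    if "A \<in> sets borel" for A
    using that by (auto simp: emeasure_density intro!: nn_integral_mono split: split_indicator)
  have "?P = ?N"
  proof (rule measure_eqI_generator_eq)
    let ?E = "range (\<lambda>(a, b). box a b::'a set)"
    let ?A = "\<lambda>n::nat. box (- (real n *\<^sub>R One)) (real n *\<^sub>R One) :: 'a set"
    show "Int_stable ?E" by (auto simp: Int_stable_def box_Int_box)
    show "?E \<subseteq> Pow UNIV" "sets ?P = sigma_sets UNIV ?E" "sets ?N = sigma_sets UNIV ?E"
      by (simp_all add: borel_eq_box)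
    show "range ?A \<subseteq> ?E" "(\<Union>i. ?A i) = UNIV" unfolding UN_box_eq_UNIV by auto
    show "emeasure ?P (?A i) \<noteq> \<infinity>" for i
      using le(1)[of "?A i"] fin(1) by (auto simp: top_unique)
    fix X assume "X \<in> ?E"
    then obtain a b where X: "X = box a b" by auto
    have eP: "emeasure ?P X = (\<integral>\<^sup>+x. ennreal (h x * indicator (box a b) x) \<partial>lborel)"
      unfolding X by (subst emeasure_density) (auto intro!: nn_integral_cong split: split_indicator)
    have eN: "emeasure ?N X = (\<integral>\<^sup>+x. ennreal (- (h x * indicator (box a b) x)) \<partial>lborel)"
      unfolding X by (subst emeasure_density) (auto intro!: nn_integral_cong split: split_indicator)
    have "integrable lborel (\<lambda>x. h x * indicator (box a b) x)"
      using h by (intro integrable_real_mult_indicator) auto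
    then have "enn2real (emeasure ?P X) = enn2real (emeasure ?N X)"
      unfolding eP eN using z[of a b] by (simp add: real_lebesgue_integral_def)
    moreover have "emeasure ?P X < \<infinity>" "emeasure ?N X < \<infinity>"
      using le[of X] fin X by (auto intro: le_less_trans)
    ultimately show "emeasure ?P X = emeasure ?N X"
      by (metis ennreal_enn2real infinity_ennreal_def)
  qed
  \<comment> \<open>\<open>ennreal\<close> sends negative numbers to 0, so one of the two equal
    values is 0, and hence both are.\<close>
  then have "AE x in lborel. ennreal (h x) = ennreal (- h x)"
    by (subst (asm) sigma_finite_measure.density_unique_iff[OF sigma_finite_lborel]) auto
  then show ?thesis
  proof eventually_elim
    case (elim x)
    then show ?case
      by (cases "0 \<le> h x") (auto simp: ennreal_neg ennreal_eq_0_iff dest: sym)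
  qed
qed

text \<open>The fundamental lemma of the calculus of variations. The fixed cutoff
  \<open>box_bump c d 1\<close> keeps the support inside \<open>U\<close>, so the second factor may
  approximate the indicator of an arbitrary box; hence \<open>f\<close> times the cutoff has
  vanishing integral over every box. Since the cutoff is positive on its box, \<open>f\<close>
  vanishes there, and countably many such boxes exhaust \<open>U\<close> up to a null set.\<close>

theorem AE_zero_if_test_integrals_zero:
  fixes f :: "'a::euclidean_space \<Rightarrow> real"
  assumes U: "open U" and f: "integrable lborel f"
    and z: "\<And>\<phi>. test_function U \<phi> \<Longrightarrow> (\<integral>x. f x * \<phi> x \<partial>lborel) = 0"
  shows "AE x in lborel. x \<in> U \<longrightarrow> f x = 0"
proof -
  have [measurable]: "f \<in> borel_measurable borel" using borel_measurable_integrable[OF f] by simp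
  have [measurable]: "box_bump a b k \<in> borel_measurable borel" for a b :: 'a and k
    by (intro borel_measurable_continuous_onI smooth_continuous_on smooth_box_bump)
  have box: "AE x in lborel. x \<in> box c d \<longrightarrow> f x = 0" if "cbox c d \<subseteq> U" for c d
  proof -
    let ?h = "\<lambda>x. f x * box_bump c d 1 x"
    have int: "integrable lborel ?h"
      by (rule Bochner_Integration.integrable_bound[OF f])
        (auto simp: abs_mult box_bump_bounds mult_left_le)
    have "(\<integral>x. ?h x * indicator (box a b) x \<partial>lborel) = 0" for a b
    proof (rule LIMSEQ_unique)
      show "(\<lambda>k. \<integral>x. ?h x * box_bump a b (real (Suc k)) x \<partial>lborel) \<longlonglongrightarrow>
        (\<integral>x. ?h x * indicator (box a b) x \<partial>lborel)"
      proof (rule integral_dominated_convergence[where w = "\<lambda>x. norm (?h x)"])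
        show "integrable lborel (\<lambda>x. norm (?h x))" using int by (rule integrable_norm)
        show "AE x in lborel. (\<lambda>k. ?h x * box_bump a b (real (Suc k)) x) \<longlonglongrightarrow> ?h x * indicator (box a b) x"
          by (intro AE_I2 tendsto_intros box_bump_tendsto)
      qed (auto simp: abs_mult box_bump_bounds mult_left_le)
      have "test_function U (\<lambda>x. box_bump c d 1 x * box_bump a b (real (Suc k)) x)" for k
        using that box_subset_cbox[of c d] box_bump_nonzero[of 1 c d]
        by (intro test_functionI[where C = "cbox c d"] smooth_mult smooth_box_bump) auto
      then have "(\<integral>x. ?h x * box_bump a b (real (Suc k)) x \<partial>lborel) = 0" for k
        using z by (simp add: mult.assoc)
      then show "(\<lambda>k. \<integral>x. ?h x * box_bump a b (real (Suc k)) x \<partial>lborel) \<longlonglongrightarrow> 0"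
        by simp
    qed
    from AE_zero_if_box_integrals_zero[OF int this] show ?thesis
      by eventually_elim (use box_bump_nonzero[of 1 c d] in auto)
  qed
  obtain \<D> where \<D>: "countable \<D>" "\<And>X. X \<in> \<D> \<Longrightarrow> \<exists>a b. X = cbox a b" "\<Union>\<D> = U"
    using open_countable_Union_open_cbox[OF U] by metis
  have "AE x in lborel. x \<in> X \<longrightarrow> f x = 0" if X: "X \<in> \<D>" for X
  proof -
    obtain c d where cd: "X = cbox c d" using \<D>(2)[OF X] by blast
    then have "cbox c d \<subseteq> U" using X \<D>(3) by blast
    from box[OF this] AE_not_in[OF null_sets_cbox_Diff_box[of c d]] show ?thesis
      unfolding cd by eventually_elim auto
  qed
  then have "AE x in lborel. \<forall>X\<in>\<D>. x \<in> X \<longrightarrow> f x = 0"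
    using \<D>(1) by (subst AE_ball_countable) auto
  then show ?thesis
    by eventually_elim (use \<D>(3) in blast)
qed

section \<open>Weak derivatives along rays\<close>

lemma integral_lborel_affine:
  fixes f :: "'a::euclidean_space \<Rightarrow> real"
  assumes [measurable]: "f \<in> borel_measurable borel" and c: "c \<noteq> 0"
  shows "(\<integral>x. f x \<partial>lborel) = \<bar>c\<bar> ^ DIM('a) * (\<integral>x. f (t + c *\<^sub>R x) \<partial>lborel)"
  by (subst lborel_affine[OF c, of t]) (simp add: integral_density integral_distr)

lemma integrable_lborel_scale:
  fixes f :: "'a::euclidean_space \<Rightarrow> real"
  assumes f: "integrable lborel f" and c: "0 < c"
  shows "integrable lborel (\<lambda>x. f (c *\<^sub>R x))"
proof -
  have "integrable (density (distr lborel borel (\<lambda>x. 0 + c *\<^sub>R x)) (\<lambda>_. ennreal (\<bar>c\<bar> ^ DIM('a)))) f"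
    using assms by (subst lborel_affine[symmetric]) auto
  then show ?thesis
    using c borel_measurable_integrable[OF f] by (subst (asm) integrable_density) (auto simp: integrable_distr_eq)
qed

lemma integrable_pair_lborelI:
  fixes F :: "real \<times> 'a::euclidean_space \<Rightarrow> real"
  assumes [measurable]: "F \<in> borel_measurable (lborel \<Otimes>\<^sub>M lborel)"
    and le: "\<And>t. (\<integral>\<^sup>+x. norm (F (t, x)) \<partial>lborel) \<le> c * indicator {l..r} t" and c: "c < \<infinity>"
  shows "integrable (lborel \<Otimes>\<^sub>M lborel) F"
proof (rule integrableI_bounded)
  have "(\<integral>\<^sup>+p. ennreal (norm (F p)) \<partial>(lborel \<Otimes>\<^sub>M lborel)) =
    (\<integral>\<^sup>+t. (\<integral>\<^sup>+x. norm (F (t, x)) \<partial>lborel) \<partial>lborel)"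
    by (rule lborel.nn_integral_fst[symmetric]) measurable
  also have "\<dots> \<le> (\<integral>\<^sup>+t. c * indicator {l..r} t \<partial>lborel)"
    by (intro nn_integral_mono le)
  also have "\<dots> < \<infinity>"
    using c emeasure_lborel_cbox_finite[of l r]
    by (subst nn_integral_cmult_indicator) (auto simp: ennreal_mult_less_top)
  finally show "(\<integral>\<^sup>+p. ennreal (norm (F p)) \<partial>(lborel \<Otimes>\<^sub>M lborel)) < \<infinity>" .
qed measurable

lemma frechet_derivative_Basis_expansion:
  fixes \<phi> :: "'a::euclidean_space \<Rightarrow> real"
  assumes "\<phi> differentiable (at x)"
  shows "frechet_derivative \<phi> (at x) y = (\<Sum>b\<in>Basis. (y \<bullet> b) * frechet_derivative \<phi> (at x) b)"
proof -
  have l: "linear (frechet_derivative \<phi> (at x))" by (rule linear_frechet_derivative[OF assms])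
  have "frechet_derivative \<phi> (at x) y = frechet_derivative \<phi> (at x) (\<Sum>b\<in>Basis. (y \<bullet> b) *\<^sub>R b)"
    by (simp add: euclidean_representation)
  also have "\<dots> = (\<Sum>b\<in>Basis. (y \<bullet> b) * frechet_derivative \<phi> (at x) b)"
    using l by (simp add: linear_sum linear_scale)
  finally show ?thesis .
qed

text \<open>The vertex is the origin, so that contractions towards it are scalings. Integrability is
  required on the whole space, which spares any tracking of domains when variables are changed by a
  dilation.\<close>

locale weakly_differentiable_cone =
  fixes U :: "'a::euclidean_space set" and u :: "'a \<Rightarrow> real" and g :: "'a \<Rightarrow> 'a" and R :: real
  assumes open_U: "open U" and R: "0 \<le> R" "\<And>x. x \<in> U \<Longrightarrow> norm x \<le> R"
    and cone: "\<And>x t. x \<in> U \<Longrightarrow> 0 < t \<Longrightarrow> t \<le> 1 \<Longrightarrow> t *\<^sub>R x \<in> U"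
    and u_int: "integrable lborel u" and g_int: "integrable lborel g"
    and weak: "\<And>\<phi> b. test_function U \<phi> \<Longrightarrow> b \<in> Basis \<Longrightarrow>
      (\<integral>x. u x * frechet_derivative \<phi> (at x) b \<partial>lborel) = - (\<integral>x. (g x \<bullet> b) * \<phi> x \<partial>lborel)"
begin

lemma meas[measurable]: "u \<in> borel_measurable borel" "g \<in> borel_measurable borel" "U \<in> sets borel"
  using borel_measurable_integrable[OF u_int] borel_measurable_integrable[OF g_int] open_U by auto

text \<open>The divergence of the field \<open>y \<mapsto> \<phi>(s y) y\<close>.\<close>

definition radial_div :: "('a \<Rightarrow> real) \<Rightarrow> real \<Rightarrow> 'a \<Rightarrow> real" where
  "radial_div \<phi> s y = real DIM('a) * \<phi> (s *\<^sub>R y) +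
     s * (\<Sum>b\<in>Basis. (y \<bullet> b) * frechet_derivative \<phi> (at (s *\<^sub>R y)) b)"

text \<open>The weak identity is tested with the components
  \<open>(y \<bullet> b) * \<phi> (s *\<^sub>R y)\<close> of the field and summed over the basis.
  Their supports lie in the support of \<open>\<phi>\<close> shrunk by \<open>1/s\<close>, and this
  stays in \<open>U\<close> because \<open>s >= 1\<close>.\<close>

lemma integral_radial_div:
  assumes \<phi>: "test_function U \<phi>" and s: "1 \<le> s"
  shows "(\<integral>y. u y * radial_div \<phi> s y \<partial>lborel) = - (\<integral>y. (g y \<bullet> y) * \<phi> (s *\<^sub>R y) \<partial>lborel)"
proof -
  define C where "C = (\<lambda>x. inverse s *\<^sub>R x) ` closure {x. \<phi> x \<noteq> 0}"
  have sm: "smooth \<phi>" using \<phi> by (simp add: test_function_def)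
  have C: "compact C"
    using \<phi> unfolding C_def by (intro compact_scaling) (simp add: test_function_def)
  have CU: "C \<subseteq> U"
    using \<phi> s by (force simp: C_def test_function_def intro!: cone simp: inverse_le_1_iff)
  have supp: "y \<in> C" if "\<phi> (s *\<^sub>R y) \<noteq> 0" for y
    using that s closure_subset[of "{x. \<phi> x \<noteq> 0}"]
    by (auto simp: C_def image_iff intro!: bexI[of _ "s *\<^sub>R y"])
  let ?\<psi> = "\<lambda>b y. (y \<bullet> b) * \<phi> (s *\<^sub>R y)"
  have tf: "test_function U (?\<psi> b)" for b
  proof (rule test_functionI[OF _ C CU])
    show "smooth (?\<psi> b)"
      using smooth_algebra.smooth[OF sm, of 0 s]
      by (intro smooth_algebra_imp_smooth smooth_algebra.mult smooth_algebra.inner) simp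
  qed (use supp in auto)
  have D: "frechet_derivative (?\<psi> b) (at y) b =
      \<phi> (s *\<^sub>R y) + s * ((y \<bullet> b) * frechet_derivative \<phi> (at (s *\<^sub>R y)) b)" if b: "b \<in> Basis" for b y
  proof -
    have d: "\<phi> differentiable (at x)" for x by (rule smooth_differentiable[OF sm])
    have "((\<lambda>y. s *\<^sub>R y) has_derivative (\<lambda>h. s *\<^sub>R h)) (at y)"
      by (auto intro!: derivative_eq_intros)
    from has_derivative_compose[OF this has_derivative_frechet[OF d]]
    have "((\<lambda>y. \<phi> (s *\<^sub>R y)) has_derivative (\<lambda>h. frechet_derivative \<phi> (at (s *\<^sub>R y)) (s *\<^sub>R h))) (at y)" .
    then have "(?\<psi> b has_derivative (\<lambda>h. (y \<bullet> b) * frechet_derivative \<phi> (at (s *\<^sub>R y)) (s *\<^sub>R h) +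
        (h \<bullet> b) * \<phi> (s *\<^sub>R y))) (at y)"
      by (intro has_derivative_mult) (auto intro!: derivative_eq_intros)
    from frechet_derivative_at[OF this, symmetric] show ?thesis
      using b linear_frechet_derivative[OF d, of "s *\<^sub>R y"] by (simp add: linear_scale)
  qed
  have cont: "continuous_on UNIV (\<lambda>y. frechet_derivative (?\<psi> b) (at y) b)" if "b \<in> Basis" for b
    using tf that by (intro smooth_continuous_on smooth_derivative) (auto simp: test_function_def)
  have int1: "integrable lborel (\<lambda>y. u y * frechet_derivative (?\<psi> b) (at y) b)" if b: "b \<in> Basis" for b
  proof -
    have "frechet_derivative (?\<psi> b) (at x) b = 0" if "x \<notin> C" for x
      by (rule frechet_derivative_zero_outside[OF _ compact_imp_closed[OF C] that]) (use supp in auto)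
    then obtain B where B: "\<And>x. \<bar>frechet_derivative (?\<psi> b) (at x) b\<bar> \<le> B"
      using compact_support_bounded[OF cont[OF b] C] by blast
    have [measurable]: "(\<lambda>y. frechet_derivative (?\<psi> b) (at y) b) \<in> borel_measurable borel"
      using cont[OF b] by (rule borel_measurable_continuous_onI)
    show ?thesis
      by (rule integrable_mult_bounded[OF u_int _ B]) measurable
  qed
  have int2: "integrable lborel (\<lambda>y. (g y \<bullet> b) * ?\<psi> b y)" if b: "b \<in> Basis" for b
  proof -
    have c: "continuous_on UNIV (?\<psi> b)" using tf by (intro smooth_continuous_on) (simp add: test_function_def)
    have "?\<psi> b x = 0" if "x \<notin> C" for x using supp that by auto
    then obtain B where B: "\<And>x. \<bar>?\<psi> b x\<bar> \<le> B"
      using compact_support_bounded[OF c C] by blast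
    have [measurable]: "?\<psi> b \<in> borel_measurable borel"
      using c by (rule borel_measurable_continuous_onI)
    have "integrable lborel (\<lambda>y. g y \<bullet> b)" using g_int by simp
    then show ?thesis
      by (rule integrable_mult_bounded[OF _ _ B]) measurable
  qed
  have "(\<integral>y. u y * radial_div \<phi> s y \<partial>lborel) =
      (\<integral>y. (\<Sum>b\<in>Basis. u y * frechet_derivative (?\<psi> b) (at y) b) \<partial>lborel)"
    by (intro Bochner_Integration.integral_cong refl)
      (simp add: radial_div_def D sum.distrib sum_distrib_left distrib_left mult_ac cong: sum.cong)
  also have "\<dots> = (\<Sum>b\<in>Basis. \<integral>y. u y * frechet_derivative (?\<psi> b) (at y) b \<partial>lborel)"
    using int1 by (rule Bochner_Integration.integral_sum)
  also have "\<dots> = (\<Sum>b\<in>Basis. - (\<integral>y. (g y \<bullet> b) * ?\<psi> b y \<partial>lborel))"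
    by (rule sum.cong[OF refl]) (rule weak[OF tf])
  also have "\<dots> = - (\<integral>y. (\<Sum>b\<in>Basis. (g y \<bullet> b) * ?\<psi> b y) \<partial>lborel)"
    using int2 by (simp add: sum_negf)
  also have "(\<lambda>y. \<Sum>b\<in>Basis. (g y \<bullet> b) * ?\<psi> b y) = (\<lambda>y. (g y \<bullet> y) * \<phi> (s *\<^sub>R y))"
    by (subst (3) euclidean_inner) (simp add: sum_distrib_right mult.assoc)
  finally show ?thesis .
qed

text \<open>\<open>t^(-d) \<phi>(y/t)\<close> is the density \<open>\<phi>\<close> transported by
  \<open>x \<mapsto> t x\<close>. By the continuity equation its derivative in \<open>t\<close> is
  minus the divergence of the density times the velocity \<open>y/t\<close>.\<close>

lemma radial_derivative:
  assumes \<phi>: "smooth \<phi>" and t: "0 < t"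
  shows "((\<lambda>t. inverse t ^ DIM('a) * \<phi> (inverse t *\<^sub>R y)) has_real_derivative
    - (inverse t ^ (DIM('a) + 1) * radial_div \<phi> (inverse t) y)) (at t)"
proof -
  let ?D = "frechet_derivative \<phi> (at (inverse t *\<^sub>R y))"
  have d: "\<phi> differentiable (at x)" for x by (rule smooth_differentiable[OF \<phi>])
  have "((\<lambda>t. inverse t *\<^sub>R y) has_derivative (\<lambda>h. (- (h * inverse t ^ 2)) *\<^sub>R y)) (at t)"
    using t by (auto intro!: derivative_eq_intros simp: power2_eq_square)
  from has_derivative_compose[OF this has_derivative_frechet[OF d]]
  have "((\<lambda>t. \<phi> (inverse t *\<^sub>R y)) has_derivative (\<lambda>h. ?D ((- (h * inverse t ^ 2)) *\<^sub>R y))) (at t)" .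
  also have "(\<lambda>h. ?D ((- (h * inverse t ^ 2)) *\<^sub>R y)) = (*) (- (inverse t ^ 2 * ?D y))"
    using linear_frechet_derivative[OF d, of "inverse t *\<^sub>R y"]
    by (subst linear_scale) (auto simp: fun_eq_iff)
  finally have 1: "((\<lambda>t. \<phi> (inverse t *\<^sub>R y)) has_real_derivative - (inverse t ^ 2 * ?D y)) (at t)"
    by (simp only: has_field_derivative_def)
  have pw: "inverse t ^ (DIM('a) - 1) * inverse t = inverse t ^ DIM('a)"
    by (rule power_minus_mult) simp
  have 2: "((\<lambda>t. inverse t ^ DIM('a)) has_real_derivative
      - (real DIM('a) * inverse t ^ (DIM('a) + 1))) (at t)"
    using t by (auto intro!: derivative_eq_intros simp: power2_eq_square pw[symmetric])
  show ?thesis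
    by (rule DERIV_cong[OF DERIV_mult[OF 2 1]])
      (simp add: radial_div_def frechet_derivative_Basis_expansion[OF d, of _ y]
        power2_eq_square algebra_simps)
qed

text \<open>Makes one continuity statement and one bound, both for \<open>s = 1\<close>, serve all
  dilations at once.\<close>

lemma radial_div_scale: "radial_div \<phi> s y = radial_div \<phi> 1 (s *\<^sub>R y)"
  by (simp add: radial_div_def sum_distrib_left mult.assoc)

lemma continuous_on_radial_div:
  assumes \<phi>: "smooth \<phi>" shows "continuous_on UNIV (radial_div \<phi> 1)"
  unfolding radial_div_def[abs_def]
  by (auto intro!: continuous_intros smooth_continuous_on[OF \<phi>] smooth_continuous_on[OF smooth_derivative[OF \<phi>]])

text \<open>Licenses Fubini's theorem in \<open>t\<close> and \<open>x\<close>. The Jacobian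
  \<open>t^(-d)\<close> is at most \<open>l^(-d)\<close> on \<open>[l, 1]\<close>, which is why the
  rays are cut off at \<open>l > 0\<close>.\<close>

lemma scaled_gradient_integrable:
  assumes l: "0 < l"
  shows "integrable (lborel \<Otimes>\<^sub>M lborel)
    (\<lambda>(t, x). indicator {l..1} t * (indicator U x * (g (t *\<^sub>R x) \<bullet> x)))"
proof (rule integrable_pair_lborelI[where c = "ennreal (R * inverse l ^ DIM('a)) * (\<integral>\<^sup>+x. norm (g x) \<partial>lborel)" and l = l and r = 1])
  fix t :: real
  show "(\<integral>\<^sup>+x. norm (case (t, x) of (t, x) \<Rightarrow> indicator {l..1} t * (indicator U x * (g (t *\<^sub>R x) \<bullet> x))) \<partial>lborel) \<le>
    ennreal (R * inverse l ^ DIM('a)) * (\<integral>\<^sup>+x. norm (g x) \<partial>lborel) * indicator {l..1} t"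
  proof (cases "t \<in> {l..1}")
    case True
    then have t: "0 < t" using l by auto
    have "(\<integral>\<^sup>+x. norm (indicator U x * (g (t *\<^sub>R x) \<bullet> x)) \<partial>lborel) \<le>
      (\<integral>\<^sup>+x. ennreal R * norm (g (0 + t *\<^sub>R x)) \<partial>lborel)"
    proof (rule nn_integral_mono)
      fix x
      have "\<bar>g (t *\<^sub>R x) \<bullet> x\<bar> \<le> R * norm (g (t *\<^sub>R x))" if "x \<in> U"
        using Cauchy_Schwarz_ineq2[of "g (t *\<^sub>R x)" x]
          mult_left_mono[OF R(2)[OF that], of "norm (g (t *\<^sub>R x))"]
        by (simp add: mult.commute)
      then show "ennreal (norm (indicator U x * (g (t *\<^sub>R x) \<bullet> x))) \<le> ennreal R * norm (g (0 + t *\<^sub>R x))"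
        using R(1) by (auto simp: ennreal_mult[symmetric] intro!: ennreal_leI split: split_indicator)
    qed
    also have "\<dots> = ennreal R * (\<integral>\<^sup>+x. norm (g (0 + t *\<^sub>R x)) \<partial>lborel)"
      by (rule nn_integral_cmult) measurable
    also have "(\<integral>\<^sup>+x. norm (g (0 + t *\<^sub>R x)) \<partial>lborel) =
      ennreal (inverse t ^ DIM('a)) * (\<integral>\<^sup>+x. norm (g x) \<partial>lborel)"
      using t nn_integral_lborel_affine[of "\<lambda>x. norm (g x)" t 0]
      by (simp add: mult.assoc[symmetric] ennreal_mult[symmetric] power_mult_distrib[symmetric])
    also have "ennreal R * (ennreal (inverse t ^ DIM('a)) * (\<integral>\<^sup>+x. norm (g x) \<partial>lborel)) \<le>
      ennreal R * (ennreal (inverse l ^ DIM('a)) * (\<integral>\<^sup>+x. norm (g x) \<partial>lborel))"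
      using l True by (intro mult_left_mono mult_right_mono ennreal_leI power_mono) auto
    finally show ?thesis
      using True l R(1) by (simp add: ennreal_mult mult.assoc)
  qed simp
next
  have "(\<integral>\<^sup>+x. norm (g x) \<partial>lborel) < \<infinity>"
    using g_int by (simp add: integrable_iff_bounded)
  then show "ennreal (R * inverse l ^ DIM('a)) * (\<integral>\<^sup>+x. norm (g x) \<partial>lborel) < \<infinity>"
    by (simp add: ennreal_mult_less_top)
qed measurable

text \<open>The weak form of \<open>u(x) - u(l x) = \<integral> g(t x) \<bullet> x dt\<close> over
  \<open>[l, 1]\<close>. A change of variables moves the dilation from \<open>u\<close> to
  \<open>\<phi>\<close>, where the classical fundamental theorem applies; the divergence that
  appears is traded for \<open>g\<close> by \<open>integral_radial_div\<close>, and the dilation is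
  then moved back.\<close>

lemma ray_identity_weak:
  assumes l: "0 < l" "l \<le> 1" and \<phi>: "test_function U \<phi>"
  shows "(\<integral>x. (u x - u (l *\<^sub>R x)) * \<phi> x \<partial>lborel) =
    (\<integral>x. (\<integral>t. indicator {l..1} t * (g (t *\<^sub>R x) \<bullet> x) \<partial>lborel) * \<phi> x \<partial>lborel)"
proof -
  define C where "C = closure {x. \<phi> x \<noteq> 0}"
  have sm: "smooth \<phi>" and C: "compact C" using \<phi> by (auto simp: test_function_def C_def)
  have z: "\<phi> x = 0" if "x \<notin> C" for x
    using that unfolding C_def by (rule test_function_zero[OF \<phi>])
  note zU = test_function_zero_outside(1)[OF \<phi>]
  obtain B where B: "\<And>x. \<bar>\<phi> x\<bar> \<le> B" using test_function_bounded[OF \<phi>] by blast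
  have "radial_div \<phi> 1 x = 0" if "x \<notin> C" for x
    using that z frechet_derivative_zero_outside[OF z compact_imp_closed[OF C] that]
    by (simp add: radial_div_def)
  then obtain B' where B': "0 \<le> B'" "\<And>x. \<bar>radial_div \<phi> 1 x\<bar> \<le> B'"
    using compact_support_bounded[OF continuous_on_radial_div[OF sm] C] by blast
  have [measurable]: "\<phi> \<in> borel_measurable borel" "radial_div \<phi> 1 \<in> borel_measurable borel"
    using smooth_measurable[OF sm] continuous_on_radial_div[OF sm]
    by (auto intro: borel_measurable_continuous_onI)
  let ?d = "DIM('a)"
  let ?W = "\<lambda>t. - (inverse t ^ (?d + 1))"
  \<comment> \<open>\<open>?k\<close> is \<open>u\<close> times the derivative in \<open>t\<close>
    of the transported test function, restricted to \<open>[l, 1]\<close>.\<close>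
  let ?k = "\<lambda>t y. u y * (?W t * radial_div \<phi> 1 (inverse t *\<^sub>R y) * indicator {l..1} t)"
  have ftc: "(\<integral>t. ?W t * radial_div \<phi> 1 (inverse t *\<^sub>R y) * indicator {l..1} t \<partial>lborel) =
      \<phi> y - inverse l ^ ?d * \<phi> (inverse l *\<^sub>R y)" for y
  proof -
    have "(\<integral>t. ?W t * radial_div \<phi> 1 (inverse t *\<^sub>R y) * indicator {l..1} t \<partial>lborel) =
      inverse 1 ^ ?d * \<phi> (inverse 1 *\<^sub>R y) - inverse l ^ ?d * \<phi> (inverse l *\<^sub>R y)"
    proof (rule integral_FTC_Icc_real)
      fix t assume t: "l \<le> t" "t \<le> 1"
      then show "((\<lambda>t. inverse t ^ ?d * \<phi> (inverse t *\<^sub>R y)) has_real_derivative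
        ?W t * radial_div \<phi> 1 (inverse t *\<^sub>R y)) (at t)"
        using radial_derivative[OF sm, of t y] l radial_div_scale[of \<phi> "inverse t" y] by simp
      have c: "isCont (radial_div \<phi> 1) x" for x
        using continuous_on_radial_div[OF sm] by (simp add: continuous_on_eq_continuous_at)
      have inv: "isCont inverse t"
        using t l by (intro continuous_intros) auto
      have "isCont (\<lambda>t. radial_div \<phi> 1 (inverse t *\<^sub>R y)) t"
        by (rule isCont_o2[OF continuous_scaleR[OF inv continuous_const] c])
      then show "isCont (\<lambda>t. ?W t * radial_div \<phi> 1 (inverse t *\<^sub>R y)) t"
        by (intro continuous_mult continuous_minus continuous_power inv)
    qed (use l in auto)
    then show ?thesis by simp
  qed
  have int1: "integrable (lborel \<Otimes>\<^sub>M lborel)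
      (\<lambda>(t, y). ?k t y)"
  proof (rule integrable_pair_lborelI[where c = "ennreal (inverse l ^ (?d + 1) * B') * (\<integral>\<^sup>+x. norm (u x) \<partial>lborel)" and l = l and r = 1])
    fix t :: real
    show "(\<integral>\<^sup>+y. norm (case (t, y) of (t, y) \<Rightarrow> ?k t y) \<partial>lborel)
      \<le> ennreal (inverse l ^ (?d + 1) * B') * (\<integral>\<^sup>+x. norm (u x) \<partial>lborel) * indicator {l..1} t"
    proof (cases "t \<in> {l..1}")
      case True
      have "(\<integral>\<^sup>+y. norm (?k t y) \<partial>lborel)
        \<le> (\<integral>\<^sup>+y. ennreal (inverse l ^ (?d + 1) * B') * norm (u y) \<partial>lborel)"
      proof (rule nn_integral_mono)
        fix y
        have "\<bar>?W t * radial_div \<phi> 1 (inverse t *\<^sub>R y)\<bar> \<le> inverse l ^ (?d + 1) * B'"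
          unfolding abs_mult using True l B'
          by (intro mult_mono B') (auto simp del: power_Suc intro!: power_mono)
        from mult_right_mono[OF this, of "\<bar>u y\<bar>"]
        have "norm (?k t y) \<le>
          (inverse l ^ (?d + 1) * B') * norm (u y)"
          using True by (simp add: abs_mult mult_ac)
        then show "ennreal (norm (?k t y))
          \<le> ennreal (inverse l ^ (?d + 1) * B') * norm (u y)"
          using l B'(1) by (subst ennreal_mult[symmetric]) (auto intro!: ennreal_leI)
      qed
      also have "\<dots> = ennreal (inverse l ^ (?d + 1) * B') * (\<integral>\<^sup>+x. norm (u x) \<partial>lborel)"
        by (rule nn_integral_cmult) measurable
      finally show ?thesis using True by simp
    qed simp
  next
    have "(\<integral>\<^sup>+x. norm (u x) \<partial>lborel) < \<infinity>"
      using u_int by (simp add: integrable_iff_bounded)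
    then show "ennreal (inverse l ^ (?d + 1) * B') * (\<integral>\<^sup>+x. norm (u x) \<partial>lborel) < \<infinity>"
      by (simp add: ennreal_mult_less_top)
  qed measurable
  have int2: "integrable (lborel \<Otimes>\<^sub>M lborel)
      (\<lambda>(t, x). indicator {l..1} t * ((g (t *\<^sub>R x) \<bullet> x) * \<phi> x))"
  proof -
    have "integrable (lborel \<Otimes>\<^sub>M lborel) (\<lambda>p. (case p of (t, x) \<Rightarrow>
      indicator {l..1} t * (indicator U x * (g (t *\<^sub>R x) \<bullet> x))) * \<phi> (snd p))"
      by (rule integrable_mult_bounded[OF scaled_gradient_integrable[OF l(1)] _ B]) measurable
    also have "(\<lambda>p. (case p of (t, x) \<Rightarrow>
      indicator {l..1} t * (indicator U x * (g (t *\<^sub>R x) \<bullet> x))) * \<phi> (snd p)) =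
      (\<lambda>(t, x). indicator {l..1} t * ((g (t *\<^sub>R x) \<bullet> x) * \<phi> x))"
      using zU by (auto simp: fun_eq_iff split: split_indicator)
    finally show ?thesis .
  qed
  have u\<phi>: "integrable lborel (\<lambda>x. u x * \<phi> x)"
    by (rule integrable_mult_bounded[OF u_int _ B]) measurable
  have u\<phi>': "integrable lborel (\<lambda>x. u x * \<phi> (inverse l *\<^sub>R x))"
    by (rule integrable_mult_bounded[OF u_int _ B]) measurable
  note ul = integrable_lborel_scale[OF u_int l(1)]
  have ul\<phi>: "integrable lborel (\<lambda>x. u (l *\<^sub>R x) * \<phi> x)"
    by (rule integrable_mult_bounded[OF ul _ B]) measurable
  have "(\<integral>x. (u x - u (l *\<^sub>R x)) * \<phi> x \<partial>lborel) =
    (\<integral>x. u x * \<phi> x \<partial>lborel) - (\<integral>x. u (l *\<^sub>R x) * \<phi> x \<partial>lborel)"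
    using u\<phi> ul\<phi> by (simp add: left_diff_distrib)
  also have "(\<integral>x. u (l *\<^sub>R x) * \<phi> x \<partial>lborel) = inverse l ^ ?d * (\<integral>x. u x * \<phi> (inverse l *\<^sub>R x) \<partial>lborel)"
    using l integral_lborel_affine[of "\<lambda>x. u x * \<phi> (inverse l *\<^sub>R x)" l 0]
    by (simp add: mult.assoc[symmetric] power_mult_distrib[symmetric])
  also have "(\<integral>x. u x * \<phi> x \<partial>lborel) - inverse l ^ ?d * (\<integral>x. u x * \<phi> (inverse l *\<^sub>R x) \<partial>lborel) =
    (\<integral>y. (\<integral>t. ?k t y \<partial>lborel) \<partial>lborel)"
  proof -
    have "u y * (\<phi> y - inverse l ^ ?d * \<phi> (inverse l *\<^sub>R y)) =
        u y * \<phi> y - inverse l ^ ?d * (u y * \<phi> (inverse l *\<^sub>R y))" for y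
      by (simp add: algebra_simps)
    then show ?thesis
      unfolding integral_mult_right_zero ftc using u\<phi> u\<phi>'
      by (simp only: Bochner_Integration.integral_diff integrable_mult_right integral_mult_right_zero)
  qed
  also have "\<dots> = (\<integral>t. (\<integral>y. ?k t y \<partial>lborel) \<partial>lborel)"
    by (rule lborel_pair.Fubini_integral[OF int1])
  also have "\<dots> = (\<integral>t. (\<integral>x. indicator {l..1} t * ((g (t *\<^sub>R x) \<bullet> x) * \<phi> x) \<partial>lborel) \<partial>lborel)"
  proof (rule Bochner_Integration.integral_cong[OF refl])
    fix t :: real
    show "(\<integral>y. ?k t y \<partial>lborel) =
      (\<integral>x. indicator {l..1} t * ((g (t *\<^sub>R x) \<bullet> x) * \<phi> x) \<partial>lborel)"
    proof (cases "t \<in> {l..1}")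
      case True
      then have t: "0 < t" "t \<le> 1" using l by auto
      have "(\<integral>y. ?k t y \<partial>lborel) =
        (\<integral>y. ?W t * (u y * radial_div \<phi> (inverse t) y) \<partial>lborel)"
        using True radial_div_scale[of \<phi> "inverse t"] by (simp add: mult_ac)
      also have "\<dots> = ?W t * (\<integral>y. u y * radial_div \<phi> (inverse t) y \<partial>lborel)"
        by simp
      also have "(\<integral>y. u y * radial_div \<phi> (inverse t) y \<partial>lborel) =
          - (\<integral>y. (g y \<bullet> y) * \<phi> (inverse t *\<^sub>R y) \<partial>lborel)"
        by (rule integral_radial_div[OF \<phi>]) (use t in \<open>simp add: one_le_inverse_iff\<close>)
      \<comment> \<open>The substitution \<open>y = t x\<close> yields \<open>t^d\<close> from the
        Jacobian and a further \<open>t\<close> from the inner product; together they cancel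
        \<open>?W t\<close> up to its sign.\<close>
      also have "(\<integral>y. (g y \<bullet> y) * \<phi> (inverse t *\<^sub>R y) \<partial>lborel) =
          t ^ ?d * (\<integral>x. t * ((g (t *\<^sub>R x) \<bullet> x) * \<phi> x) \<partial>lborel)"
        using t integral_lborel_affine[of "\<lambda>y. (g y \<bullet> y) * \<phi> (inverse t *\<^sub>R y)" t 0]
        by (simp add: mult.assoc)
      finally show ?thesis
        using True t by (simp add: power_mult_distrib[symmetric] mult.assoc[symmetric])
          (simp add: mult.commute mult.left_commute power_mult_distrib[symmetric])
    qed simp
  qed
  also have "\<dots> = (\<integral>x. (\<integral>t. indicator {l..1} t * ((g (t *\<^sub>R x) \<bullet> x) * \<phi> x) \<partial>lborel) \<partial>lborel)"
    by (rule lborel_pair.Fubini_integral[OF int2, symmetric])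
  also have "\<dots> = (\<integral>x. (\<integral>t. indicator {l..1} t * (g (t *\<^sub>R x) \<bullet> x) \<partial>lborel) * \<phi> x \<partial>lborel)"
    by (simp add: mult.assoc[symmetric])
  finally show ?thesis .
qed

text \<open>The weak identity against all test functions gives the pointwise one almost everywhere
  in \<open>U\<close>, and Cauchy-Schwarz with \<open>norm x <= R\<close> bounds its right-hand
  side. The exceptional set depends on \<open>l\<close>, which is harmless because \<open>l\<close>
  is fixed when \<open>x\<close> is integrated.\<close>

lemma ray_bound:
  assumes l: "0 < l" "l \<le> 1"
  shows "AE x in lborel. x \<in> U \<longrightarrow> ennreal \<bar>u x - u (l *\<^sub>R x)\<bar> \<le>
    ennreal R * (\<integral>\<^sup>+t. indicator {l..1} t * ennreal (norm (g (t *\<^sub>R x))) \<partial>lborel)"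
proof -
  let ?G = "\<lambda>x. \<integral>t. indicator {l..1} t * (g (t *\<^sub>R x) \<bullet> x) \<partial>lborel"
  let ?f = "\<lambda>x. indicator U x * (u x - u (l *\<^sub>R x)) - indicator U x * ?G x"
  have iG: "integrable lborel (\<lambda>x. indicator U x * ?G x)"
  proof -
    have "integrable lborel (\<lambda>x. \<integral>t. (case (t, x) of (t, x) \<Rightarrow>
        indicator {l..1} t * (indicator U x * (g (t *\<^sub>R x) \<bullet> x))) \<partial>lborel)"
      using lborel_pair.integrable_snd[OF scaled_gradient_integrable[OF l(1)]] by simp
    then show ?thesis by (simp add: mult.left_commute)
  qed
  note ul = integrable_lborel_scale[OF u_int l(1)]
  have iu: "integrable lborel (\<lambda>x. indicator U x * (u x - u (l *\<^sub>R x)))"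
    using u_int ul integrable_mult_indicator[of U lborel "\<lambda>x. u x - u (l *\<^sub>R x)"] by simp
  have "AE x in lborel. x \<in> U \<longrightarrow> ?f x = 0"
  proof (rule AE_zero_if_test_integrals_zero[OF open_U])
    show "integrable lborel ?f" using iG iu by simp
    fix \<phi> assume \<phi>: "test_function U \<phi>"
    note zU = test_function_zero_outside(1)[OF \<phi>]
    obtain B where B: "\<And>x. \<bar>\<phi> x\<bar> \<le> B" using test_function_bounded[OF \<phi>] by blast
    have [measurable]: "\<phi> \<in> borel_measurable borel"
      using \<phi> by (simp add: test_function_def smooth_measurable)
    have e: "indicator U x * c * \<phi> x = c * \<phi> x" for x c
      using zU[of x] by (cases "x \<in> U") auto
    have "(\<integral>x. ?f x * \<phi> x \<partial>lborel) = (\<integral>x. indicator U x * (u x - u (l *\<^sub>R x)) * \<phi> x \<partial>lborel) -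
        (\<integral>x. indicator U x * ?G x * \<phi> x \<partial>lborel)"
      using integrable_mult_bounded[OF iu _ B] integrable_mult_bounded[OF iG _ B]
      by (subst left_diff_distrib) simp
    also have "\<dots> = 0"
      using ray_identity_weak[OF l \<phi>] unfolding e by simp
    finally show "(\<integral>x. ?f x * \<phi> x \<partial>lborel) = 0" .
  qed
  then show ?thesis
  proof eventually_elim
    case (elim x)
    show ?case
    proof
      assume x: "x \<in> U"
      then have "\<bar>u x - u (l *\<^sub>R x)\<bar> = norm (?G x)" using elim by simp
      also have "ennreal (norm (?G x)) \<le> (\<integral>\<^sup>+t. norm (indicator {l..1} t * (g (t *\<^sub>R x) \<bullet> x)) \<partial>lborel)"
      \<comment> \<open>If the integral along the ray does not converge, its value is 0 by
        convention and the bound is trivial.\<close>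
      proof (cases "integrable lborel (\<lambda>t. indicator {l..1} t * (g (t *\<^sub>R x) \<bullet> x))")
        case True
        then show ?thesis by (rule integral_norm_bound_ennreal)
      qed (simp add: not_integrable_integral_eq)
      also have "\<dots> \<le> (\<integral>\<^sup>+t. ennreal R * (indicator {l..1} t * ennreal (norm (g (t *\<^sub>R x)))) \<partial>lborel)"
      proof (rule nn_integral_mono)
        fix t
        have "\<bar>g (t *\<^sub>R x) \<bullet> x\<bar> \<le> R * norm (g (t *\<^sub>R x))"
          using Cauchy_Schwarz_ineq2[of "g (t *\<^sub>R x)" x]
            mult_left_mono[OF R(2)[OF x], of "norm (g (t *\<^sub>R x))"]
          by (simp add: mult.commute)
        then show "ennreal (norm (indicator {l..1} t * (g (t *\<^sub>R x) \<bullet> x))) \<le>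
          ennreal R * (indicator {l..1} t * ennreal (norm (g (t *\<^sub>R x))))"
          using R(1) by (auto simp: ennreal_mult[symmetric] intro!: ennreal_leI split: split_indicator)
      qed
      also have "\<dots> = ennreal R * (\<integral>\<^sup>+t. indicator {l..1} t * ennreal (norm (g (t *\<^sub>R x))) \<partial>lborel)"
        by (rule nn_integral_cmult) measurable
      finally show "ennreal \<bar>u x - u (l *\<^sub>R x)\<bar> \<le>
        ennreal R * (\<integral>\<^sup>+t. indicator {l..1} t * ennreal (norm (g (t *\<^sub>R x))) \<partial>lborel)" .
    qed
  qed
qed

end

section \<open>The trace inequality on a cone\<close>

text \<open>Averages over shrinking left neighbourhoods of 1. A lower bound suffices because Fatou's
  lemma is applied to them. With \<open>k + 2\<close> in the denominator the left end is at least
  1/2, so it can serve as a dilation factor \<open>l > 0\<close>.\<close>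

lemma le_liminf_average:
  fixes f :: "real \<Rightarrow> ennreal"
  assumes f: "(f \<longlongrightarrow> l) (at_left 1)"
  shows "l \<le> liminf (\<lambda>k. ennreal (real (Suc (Suc k))) *
    (\<integral>\<^sup>+t. indicator {1 - 1 / real (Suc (Suc k))..<1} t * f t \<partial>lborel))"
  unfolding le_Liminf_iff
proof (intro allI impI)
  fix y assume "y < l"
  then obtain z where z: "y < z" "z < l" using dense by blast
  have "\<forall>\<^sub>F t in at_left 1. z < f t" using order_tendstoD(1)[OF f z(2)] .
  then obtain \<delta> where \<delta>: "\<delta> < 1" "\<And>t. \<delta> < t \<Longrightarrow> t < 1 \<Longrightarrow> z < f t"
    by (auto simp: eventually_at_left[of 0])
  have "(\<lambda>k. 1 - inverse (real (Suc (Suc k)))) \<longlonglongrightarrow> 1 - 0"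
    using LIMSEQ_Suc[OF LIMSEQ_inverse_real_of_nat] by (intro tendsto_intros)
  then have "\<forall>\<^sub>F k in sequentially. \<delta> < 1 - inverse (real (Suc (Suc k)))"
    using \<delta>(1) by (intro order_tendstoD(1)) auto
  then show "\<forall>\<^sub>F k in sequentially. y < ennreal (real (Suc (Suc k))) *
    (\<integral>\<^sup>+t. indicator {1 - 1 / real (Suc (Suc k))..<1} t * f t \<partial>lborel)"
  proof eventually_elim
    case (elim k)
    let ?m = "real (Suc (Suc k))"
    have "z = ennreal ?m * ennreal (1 / ?m) * z"
      by (subst ennreal_mult[symmetric]) auto
    also have "\<dots> = ennreal ?m * (\<integral>\<^sup>+t. z * indicator {1 - 1 / ?m..<1} t \<partial>lborel)"
      by (subst nn_integral_cmult_indicator) (auto simp: mult_ac)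
    also have "\<dots> \<le> ennreal ?m * (\<integral>\<^sup>+t. indicator {1 - 1 / ?m..<1} t * f t \<partial>lborel)"
      using elim \<delta>(2) by (intro mult_left_mono nn_integral_mono)
        (auto simp: divide_inverse less_imp_le split: split_indicator)
    finally show ?case using z(1) by simp
  qed
qed

text \<open>\<open>\<eta> r\<close> bounds the slope of a subgradient of \<open>\<Phi>\<close> at \<open>r\<close>.\<close>

locale convex_growth =
  fixes \<Phi> \<eta> :: "real \<Rightarrow> real" and L :: real
  assumes \<Phi>: "\<And>s. 0 \<le> \<Phi> s" "continuous_on UNIV \<Phi>" "\<And>r s. \<Phi> r \<le> \<Phi> s + \<eta> r * \<bar>r - s\<bar>"
    and \<eta>: "\<And>s. 0 \<le> \<eta> s" "\<And>s. \<eta> s \<le> L" "continuous_on UNIV \<eta>"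
begin

lemma measurable_growth[measurable]: "\<Phi> \<in> borel_measurable borel" "\<eta> \<in> borel_measurable borel"
  using \<Phi>(2) \<eta>(3) by (auto intro: borel_measurable_continuous_onI)

lemma L_nonneg: "0 \<le> L"
  using \<eta>(1)[of 0] \<eta>(2)[of 0] by simp

lemma growth_le: "\<Phi> r \<le> \<Phi> s + L * \<bar>r - s\<bar>"
  using \<Phi>(3)[of r s] mult_right_mono[OF \<eta>(2)[of r], of "\<bar>r - s\<bar>"] by simp

end

text \<open>\<open>w\<close> is the radial boundary value of \<open>u\<close> on \<open>F\<close>.
  The limit is demanded only for almost every \<open>y\<close> and only if the open segment from the
  vertex to \<open>y\<close> runs inside \<open>U\<close>: continuity of \<open>u\<close> off a
  surface-null set provides no more than that.\<close>

locale cone_trace = weakly_differentiable_cone U u g R + convex_growth \<Phi> \<eta> L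
  for U :: "'a::euclidean_space set" and u g R \<Phi> \<eta> L +
  fixes T F :: "'a set" and n :: 'a and b :: real and w :: "'a \<Rightarrow> real"
  assumes U_eq: "U = interior T" and T: "convex T" "compact T"
    and TF: "\<And>y t. y \<in> F \<Longrightarrow> 0 < t \<Longrightarrow> t \<le> 1 \<Longrightarrow> t *\<^sub>R y \<in> T"
    and F[measurable]: "F \<in> sets borel" and F_sub: "F \<subseteq> {x. n \<bullet> x = b}"
    and n: "norm n = 1" and b: "0 < b"
    and U_sub: "\<And>x. x \<in> U \<Longrightarrow> 0 < n \<bullet> x \<and> n \<bullet> x < b"
    and u_cont: "continuous_on U u" and g_zero: "\<And>x. x \<notin> U \<Longrightarrow> g x = 0"
    and w: "AE y in hyperplane_measure {x. n \<bullet> x = b}. y \<in> F \<longrightarrow>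
      (\<forall>t. 0 < t \<and> t < 1 \<longrightarrow> t *\<^sub>R y \<in> U) \<longrightarrow> ((\<lambda>t. u (t *\<^sub>R y)) \<longlongrightarrow> w y) (at_left 1)"
begin

abbreviation "energy \<equiv> \<integral>\<^sup>+x. indicator U x * ennreal (\<Phi> (u x)) \<partial>lborel"

abbreviation "\<sigma> \<equiv> hyperplane_measure {x. n \<bullet> x = b}"

text \<open>The frontier of a convex set is a null set, so in cone coordinates almost every ray
  meets it in a null set of parameters. Such a ray has interior points \<open>s y\<close> with
  \<open>s\<close> arbitrarily small, and by convexity the open segment from an interior point to
  the point \<open>y\<close> of \<open>T\<close> is interior.\<close>

lemma AE_segment_interior: "AE y in \<sigma>. y \<in> F \<longrightarrow> (\<forall>t. 0 < t \<and> t < 1 \<longrightarrow> t *\<^sub>R y \<in> U)"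
proof -
  note [measurable_cong] = sets_hyperplane_measure
  define Z where "Z = {x \<in> T - U. 0 < n \<bullet> x}"
  have [measurable]: "T \<in> sets borel" using T by (simp add: compact_imp_closed borel_closed)
  have Zm[measurable]: "Z \<in> sets borel"
  proof -
    have "Z = (T - U) \<inter> {x. 0 < n \<bullet> x}" by (auto simp: Z_def)
    moreover have "{x. 0 < n \<bullet> x} \<in> sets borel" by (intro borel_open open_halfspace_gt)
    moreover have "T - U \<in> sets borel" by (intro sets.Diff meas) measurable
    ultimately show ?thesis by (metis sets.Int)
  qed
  have "frontier T \<in> null_sets lborel"
    using negligible_convex_frontier[OF T(1)]
    by (simp add: negligible_iff_null_sets null_sets_completion_iff borel_closed)
  then have "Z \<in> null_sets lborel"
  proof (rule null_sets_subset)
    show "Z \<in> sets lborel" using Zm by simp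
    show "Z \<subseteq> frontier T" using closure_subset[of T] by (auto simp: Z_def U_eq frontier_def)
  qed
  then have "emeasure lborel Z = 0" by (rule null_setsD1)
  then have "0 = (\<integral>\<^sup>+x. indicator Z x \<partial>lborel)"
    using Zm by simp
  also have "\<dots> = ennreal b * (\<integral>\<^sup>+y. (\<integral>\<^sup>+t. indicator {0<..} t * ennreal (t ^ (DIM('a) - 1)) *
     indicator Z (t *\<^sub>R y) \<partial>lborel) \<partial>\<sigma>)"
    by (rule nn_integral_cone[OF n _ b]) (auto simp: Z_def indicator_def split: if_splits)
  finally have "(\<integral>\<^sup>+y. (\<integral>\<^sup>+t. indicator {0<..} t * ennreal (t ^ (DIM('a) - 1)) *
     indicator Z (t *\<^sub>R y) \<partial>lborel) \<partial>\<sigma>) = 0"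
    using b by (auto simp: ennreal_eq_0_iff)
  then have "AE y in \<sigma>. (\<integral>\<^sup>+t. indicator {0<..} t * ennreal (t ^ (DIM('a) - 1)) *
     indicator Z (t *\<^sub>R y) \<partial>lborel) = 0"
    by (subst (asm) nn_integral_0_iff_AE) measurable
  then show ?thesis
  proof eventually_elim
    case (elim y)
    then have ae: "AE t in lborel. indicator {0<..} t * ennreal (t ^ (DIM('a) - 1)) *
     indicator Z (t *\<^sub>R y) = 0"
      by (subst (asm) nn_integral_0_iff_AE) measurable
    show ?case
    proof (intro impI allI)
      fix t :: real assume y: "y \<in> F" and t: "0 < t \<and> t < 1"
      have "\<exists>s. 0 < s \<and> s < t \<and> s *\<^sub>R y \<in> U"
      proof (rule ccontr)
        assume no: "\<not> ?thesis"
        from ae have "AE s in lborel. s \<notin> {0<..<t}"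
        proof eventually_elim
          case (elim s)
          have "n \<bullet> y = b" using y F_sub by auto
          then have "s *\<^sub>R y \<in> Z" if "0 < s" "s < t"
            using that no y t b TF[OF y, of s] by (auto simp: Z_def)
          then show ?case using elim not_le[THEN iffD2, OF zero_less_power[of s "DIM('a) - 1"]]
            by auto
        qed
        then have "emeasure lborel {0<..<t} = 0"
          by (subst (asm) AE_iff_measurable[where N = "{0<..<t}"]) auto
        then show False using t by simp
      qed
      then obtain s where s: "0 < s" "s < t" "s *\<^sub>R y \<in> U" by blast
      have "y \<in> closure T" using TF[OF y, of 1] closure_subset by force
      then have "open_segment (s *\<^sub>R y) y \<subseteq> U"
        using in_interior_closure_convex_segment[OF T(1), of "s *\<^sub>R y" y] s by (simp add: U_eq)
      moreover have "t *\<^sub>R y \<in> open_segment (s *\<^sub>R y) y"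
      proof -
        have "y \<noteq> 0" using y F_sub b by auto
        moreover have "t *\<^sub>R y = (1 - (t - s) / (1 - s)) *\<^sub>R s *\<^sub>R y + ((t - s) / (1 - s)) *\<^sub>R y"
        proof -
          have "(1 - c) * s + c = s + c * (1 - s)" for c :: real by (simp add: algebra_simps)
          moreover have "(t - s) / (1 - s) * (1 - s) = t - s" using s t by simp
          ultimately have "(1 - (t - s) / (1 - s)) * s + (t - s) / (1 - s) = t" by simp
          then show ?thesis by (simp add: scaleR_left_distrib[symmetric])
        qed
        moreover from \<open>y \<noteq> 0\<close> have "s *\<^sub>R y \<noteq> y"
          using s t scaleR_cancel_right[of s y 1] by simp
        ultimately show ?thesis
          unfolding in_segment using s t by (intro conjI exI[of _ "(t - s) / (1 - s)"]) auto
      qed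
      ultimately show "t *\<^sub>R y \<in> U" by blast
    qed
  qed
qed

text \<open>The gradient is evaluated at the dilated point and the weight at \<open>x\<close>
  itself, as the ray bound produces them. At \<open>t = 1\<close> this is the gradient term of the
  final inequality.\<close>

definition slope :: "real \<Rightarrow> ennreal" where
  "slope t = (\<integral>\<^sup>+x. indicator U x * (ennreal (\<eta> (u x)) * ennreal (norm (g (t *\<^sub>R x)))) \<partial>lborel)"

lemma emeasure_U_finite: "emeasure lborel U < \<infinity>"
proof -
  have "emeasure lborel U \<le> emeasure lborel T"
    using T by (intro emeasure_mono) (auto simp: U_eq interior_subset compact_imp_closed borel_closed)
  then show ?thesis using emeasure_compact_finite[OF T(2)] by simp
qed

text \<open>Follows from the linear growth of \<open>\<Phi>\<close>. It permits the cancellation of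
  the integral over \<open>l U\<close> in \<open>layer_upper_bound\<close>.\<close>

lemma finite_energy: "energy < \<infinity>"
proof -
  have le: "\<Phi> s \<le> \<Phi> 0 + L * \<bar>s\<bar>" for s
    using growth_le[of s 0] by simp
  have "energy \<le>
    (\<integral>\<^sup>+x. ennreal (\<Phi> 0) * indicator U x + ennreal L * ennreal (norm (u x)) \<partial>lborel)"
    using L_nonneg \<Phi>(1) le by (intro nn_integral_mono)
      (auto simp: ennreal_mult[symmetric] ennreal_plus[symmetric] simp del: ennreal_plus intro!: ennreal_leI split: split_indicator)
  also have "\<dots> = ennreal (\<Phi> 0) * emeasure lborel U + ennreal L * (\<integral>\<^sup>+x. norm (u x) \<partial>lborel)"
    by (simp add: nn_integral_add nn_integral_cmult)
  also have "\<dots> < \<infinity>"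
    using emeasure_U_finite u_int by (simp add: integrable_iff_bounded ennreal_mult_less_top)
  finally show ?thesis .
qed

lemma slope_1_finite: "slope 1 < \<infinity>"
proof -
  have "slope 1 \<le> (\<integral>\<^sup>+x. ennreal L * ennreal (norm (g x)) \<partial>lborel)"
    unfolding slope_def using \<eta>
    by (intro nn_integral_mono) (auto intro!: mult_right_mono ennreal_leI split: split_indicator)
  also have "\<dots> = ennreal L * (\<integral>\<^sup>+x. norm (g x) \<partial>lborel)"
    by (rule nn_integral_cmult) measurable
  also have "\<dots> < \<infinity>"
    using g_int by (simp add: integrable_iff_bounded ennreal_mult_less_top)
  finally show ?thesis .
qed

text \<open>\<open>g\<close> is merely integrable, so \<open>g(t x)\<close> need not converge
  pointwise. The substitution \<open>y = t x\<close> shifts the dilation to \<open>\<eta>(u)\<close>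
  and to the indicator of \<open>U\<close>, which do converge at points of the open set
  \<open>U\<close>; elsewhere \<open>g\<close> vanishes. The bound \<open>s k > 1/2\<close> gives
  the majorant \<open>2^d L \<bar>g\<bar>\<close>.\<close>

lemma slope_tendsto:
  assumes s: "\<And>k. 1/2 < s k" "\<And>k. s k < 1" "s \<longlonglongrightarrow> 1"
  shows "(\<lambda>k. slope (s k)) \<longlonglongrightarrow> slope 1"
proof -
  let ?d = "DIM('a)"
  have eq: "slope t = (\<integral>\<^sup>+y. ennreal (inverse t ^ ?d) * (indicator U (inverse t *\<^sub>R y) *
      (ennreal (\<eta> (u (inverse t *\<^sub>R y))) * ennreal (norm (g y)))) \<partial>lborel)" if "0 < t" for t
  proof -
    have "(\<integral>\<^sup>+y. ennreal (inverse t ^ ?d) * (indicator U (inverse t *\<^sub>R y) *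
      (ennreal (\<eta> (u (inverse t *\<^sub>R y))) * ennreal (norm (g y)))) \<partial>lborel) =
      ennreal (\<bar>t\<bar> ^ ?d) * (\<integral>\<^sup>+x. ennreal (inverse t ^ ?d) * (indicator U (inverse t *\<^sub>R (0 + t *\<^sub>R x)) *
      (ennreal (\<eta> (u (inverse t *\<^sub>R (0 + t *\<^sub>R x)))) * ennreal (norm (g (0 + t *\<^sub>R x))))) \<partial>lborel)"
      using that by (intro nn_integral_lborel_affine) auto
    also have "\<dots> = ennreal (\<bar>t\<bar> ^ ?d) * (ennreal (inverse t ^ ?d) * slope t)"
      using that by (simp add: slope_def nn_integral_cmult)
    also have "\<dots> = slope t"
      using that by (simp add: mult.assoc[symmetric] ennreal_mult[symmetric] power_mult_distrib[symmetric])
    finally show ?thesis by simp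
  qed
  let ?f = "\<lambda>k y. ennreal (inverse (s k) ^ ?d) * (indicator U (inverse (s k) *\<^sub>R y) *
      (ennreal (\<eta> (u (inverse (s k) *\<^sub>R y))) * ennreal (norm (g y))))"
  have "(\<lambda>k. \<integral>\<^sup>+y. ?f k y \<partial>lborel) \<longlonglongrightarrow>
    (\<integral>\<^sup>+y. indicator U y * (ennreal (\<eta> (u y)) * ennreal (norm (g y))) \<partial>lborel)"
  proof (rule nn_integral_dominated_convergence[where w = "\<lambda>y. ennreal (2 ^ ?d * L) * ennreal (norm (g y))"])
    show "(\<integral>\<^sup>+y. ennreal (2 ^ ?d * L) * ennreal (norm (g y)) \<partial>lborel) < \<infinity>"
      using g_int by (simp add: nn_integral_cmult integrable_iff_bounded ennreal_mult_less_top)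
    show "AE y in lborel. ?f k y \<le> ennreal (2 ^ ?d * L) * ennreal (norm (g y))" for k
    proof (rule AE_I2)
      fix y
      have "inverse (s k) \<le> 2" using s(1)[of k] by (simp add: inverse_eq_divide field_simps)
      then have "inverse (s k) ^ ?d \<le> 2 ^ ?d" using s(1)[of k] by (intro power_mono) auto
      then have "ennreal (inverse (s k) ^ ?d) * ennreal (\<eta> (u (inverse (s k) *\<^sub>R y))) \<le> ennreal (2 ^ ?d) * ennreal L"
        using \<eta> by (intro mult_mono ennreal_leI) auto
      then have "ennreal (inverse (s k) ^ ?d) * ennreal (\<eta> (u (inverse (s k) *\<^sub>R y))) * ennreal (norm (g y)) \<le>
         ennreal (2 ^ ?d * L) * ennreal (norm (g y))"
        by (intro mult_right_mono) (simp_all add: ennreal_mult')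
      then show "?f k y \<le> ennreal (2 ^ ?d * L) * ennreal (norm (g y))"
        by (simp add: mult.assoc split: split_indicator)
    qed
    show "AE y in lborel. (\<lambda>k. ?f k y) \<longlonglongrightarrow> indicator U y * (ennreal (\<eta> (u y)) * ennreal (norm (g y)))"
    proof (rule AE_I2)
      fix y
      have si: "(\<lambda>k. inverse (s k)) \<longlonglongrightarrow> inverse 1"
        using s(3) by (intro tendsto_intros) auto
      show "(\<lambda>k. ?f k y) \<longlonglongrightarrow> indicator U y * (ennreal (\<eta> (u y)) * ennreal (norm (g y)))"
      proof (cases "y \<in> U")
        case True
        have yl: "(\<lambda>k. inverse (s k) *\<^sub>R y) \<longlonglongrightarrow> y"
          using tendsto_scaleR[OF si tendsto_const[of y]] by simp
        have ev: "\<forall>\<^sub>F k in sequentially. inverse (s k) *\<^sub>R y \<in> U"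
          by (rule topological_tendstoD[OF yl open_U True])
        have "isCont u y" using u_cont open_U True by (simp add: continuous_on_eq_continuous_at)
        then have "(\<lambda>k. u (inverse (s k) *\<^sub>R y)) \<longlonglongrightarrow> u y"
          using yl by (rule isCont_tendsto_compose)
        moreover have "isCont \<eta> (u y)" using \<eta>(3) by (simp add: continuous_on_eq_continuous_at)
        ultimately have "(\<lambda>k. \<eta> (u (inverse (s k) *\<^sub>R y))) \<longlonglongrightarrow> \<eta> (u y)"
          by (rule isCont_tendsto_compose[rotated])
        then have "(\<lambda>k. inverse (s k) ^ ?d * (\<eta> (u (inverse (s k) *\<^sub>R y)) * norm (g y))) \<longlonglongrightarrow>
            inverse 1 ^ ?d * (\<eta> (u y) * norm (g y))"
          by (intro tendsto_intros si)
        then have "(\<lambda>k. ennreal (inverse (s k) ^ ?d * (\<eta> (u (inverse (s k) *\<^sub>R y)) * norm (g y)))) \<longlonglongrightarrow>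
            ennreal (\<eta> (u y) * norm (g y))"
          by (intro tendsto_ennrealI) simp
        moreover have "\<forall>\<^sub>F k in sequentially. ennreal (inverse (s k) ^ ?d * (\<eta> (u (inverse (s k) *\<^sub>R y)) * norm (g y))) = ?f k y"
          using ev by eventually_elim (use \<eta>(1) order.strict_trans[OF _ s(1)] in \<open>simp add: ennreal_mult' less_imp_le\<close>)
        ultimately show ?thesis
          using True \<eta>(1) by (simp add: ennreal_mult' Lim_transform_eventually)
      qed (simp add: g_zero)
    qed
  qed measurable
  moreover have "0 < s k" for k using s(1)[of k] by simp
  ultimately show ?thesis
    by (simp add: eq[symmetric]) (simp add: slope_def)
qed

text \<open>The energy \<open>A\<close> splits into \<open>V\<close> over \<open>l U\<close> and
  \<open>W\<close> over the layer. Rescaling gives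
  \<open>V = l^d \<integral> \<Phi>(u(l x))\<close>, and convexity with the ray bound compares this
  integral with \<open>A\<close>. Subtracting \<open>V\<close> leaves \<open>W\<close>, and
  Bernoulli's inequality replaces \<open>1 - l^d\<close> by \<open>(1 - l) d\<close>.\<close>

lemma layer_upper_bound:
  assumes l: "0 < l" "l < 1"
  shows "(\<integral>\<^sup>+x. indicator U x * (indicator (- U) (inverse l *\<^sub>R x) * ennreal (\<Phi> (u x))) \<partial>lborel) \<le>
    ennreal ((1 - l) * real DIM('a)) * energy +
    ennreal R * (\<integral>\<^sup>+t. indicator {l..1} t * slope t \<partial>lborel)"
proof -
  let ?d = "DIM('a)"
  define A where "A = energy"
  define V where "V = (\<integral>\<^sup>+x. indicator U (inverse l *\<^sub>R x) * ennreal (\<Phi> (u x)) \<partial>lborel)"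
  define W where "W = (\<integral>\<^sup>+x. indicator U x * (indicator (- U) (inverse l *\<^sub>R x) * ennreal (\<Phi> (u x))) \<partial>lborel)"
  define Q where "Q = (\<integral>\<^sup>+t. indicator {l..1} t * slope t \<partial>lborel)"
  have UV: "x \<in> U" if "inverse l *\<^sub>R x \<in> U" for x
    using cone[OF that l(1)] l by simp
  have "A = (\<integral>\<^sup>+x. indicator U (inverse l *\<^sub>R x) * ennreal (\<Phi> (u x)) +
    indicator U x * (indicator (- U) (inverse l *\<^sub>R x) * ennreal (\<Phi> (u x))) \<partial>lborel)"
    unfolding A_def using UV by (intro nn_integral_cong) (auto split: split_indicator)
  also have "\<dots> = V + W"
    unfolding V_def W_def by (rule nn_integral_add) measurable
  finally have AVW: "A = V + W" .
  have A_fin: "A < \<infinity>" unfolding A_def by (rule finite_energy)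
  have Veq: "V = ennreal (l ^ ?d) * (\<integral>\<^sup>+x. indicator U x * ennreal (\<Phi> (u (l *\<^sub>R x))) \<partial>lborel)"
    unfolding V_def using l nn_integral_lborel_affine[of "\<lambda>x. indicator U (inverse l *\<^sub>R x) * ennreal (\<Phi> (u x))" l 0]
    by simp
  have "A \<le> (\<integral>\<^sup>+x. indicator U x * ennreal (\<Phi> (u (l *\<^sub>R x))) + indicator U x * (ennreal (\<eta> (u x)) *
      (ennreal R * (\<integral>\<^sup>+t. indicator {l..1} t * ennreal (norm (g (t *\<^sub>R x))) \<partial>lborel))) \<partial>lborel)"
    unfolding A_def
  proof (rule nn_integral_mono_AE)
    have "AE x in lborel. x \<in> U \<longrightarrow> ennreal \<bar>u x - u (l *\<^sub>R x)\<bar> \<le>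
      ennreal R * (\<integral>\<^sup>+t. indicator {l..1} t * ennreal (norm (g (t *\<^sub>R x))) \<partial>lborel)"
      using l by (intro ray_bound) auto
    then show "AE x in lborel. indicator U x * ennreal (\<Phi> (u x)) \<le>
      indicator U x * ennreal (\<Phi> (u (l *\<^sub>R x))) + indicator U x * (ennreal (\<eta> (u x)) *
      (ennreal R * (\<integral>\<^sup>+t. indicator {l..1} t * ennreal (norm (g (t *\<^sub>R x))) \<partial>lborel)))"
    proof eventually_elim
      case (elim x)
      have "ennreal (\<Phi> (u x)) \<le> ennreal (\<Phi> (u (l *\<^sub>R x))) + ennreal (\<eta> (u x)) * ennreal \<bar>u x - u (l *\<^sub>R x)\<bar>"
        using \<Phi>(1) \<eta>(1) \<Phi>(3) by (simp add: ennreal_mult[symmetric] ennreal_plus[symmetric] ennreal_leI del: ennreal_plus)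
      also have "\<dots> \<le> ennreal (\<Phi> (u (l *\<^sub>R x))) + ennreal (\<eta> (u x)) *
        (ennreal R * (\<integral>\<^sup>+t. indicator {l..1} t * ennreal (norm (g (t *\<^sub>R x))) \<partial>lborel))" if "x \<in> U"
        using elim that by (intro add_left_mono mult_left_mono) auto
      finally show ?case by (auto split: split_indicator)
    qed
  qed
  also have "\<dots> = (\<integral>\<^sup>+x. indicator U x * ennreal (\<Phi> (u (l *\<^sub>R x))) \<partial>lborel) +
    (\<integral>\<^sup>+x. indicator U x * (ennreal (\<eta> (u x)) *
      (ennreal R * (\<integral>\<^sup>+t. indicator {l..1} t * ennreal (norm (g (t *\<^sub>R x))) \<partial>lborel))) \<partial>lborel)"
    by (rule nn_integral_add) measurable
  also have "(\<integral>\<^sup>+x. indicator U x * (ennreal (\<eta> (u x)) *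
      (ennreal R * (\<integral>\<^sup>+t. indicator {l..1} t * ennreal (norm (g (t *\<^sub>R x))) \<partial>lborel))) \<partial>lborel) =
      (\<integral>\<^sup>+x. ennreal R * (\<integral>\<^sup>+t. indicator {l..1} t * (indicator U x * (ennreal (\<eta> (u x)) * ennreal (norm (g (t *\<^sub>R x))))) \<partial>lborel) \<partial>lborel)"
    by (intro nn_integral_cong) (simp add: nn_integral_cmult[symmetric] mult_ac)
  also have "\<dots> = ennreal R * (\<integral>\<^sup>+x. (\<integral>\<^sup>+t. indicator {l..1} t * (indicator U x * (ennreal (\<eta> (u x)) * ennreal (norm (g (t *\<^sub>R x))))) \<partial>lborel) \<partial>lborel)"
    by (rule nn_integral_cmult) measurable
  also have "(\<integral>\<^sup>+x. (\<integral>\<^sup>+t. indicator {l..1} t * (indicator U x * (ennreal (\<eta> (u x)) * ennreal (norm (g (t *\<^sub>R x))))) \<partial>lborel) \<partial>lborel) =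
      (\<integral>\<^sup>+t. (\<integral>\<^sup>+x. indicator {l..1} t * (indicator U x * (ennreal (\<eta> (u x)) * ennreal (norm (g (t *\<^sub>R x))))) \<partial>lborel) \<partial>lborel)"
    by (rule lborel_pair.Fubini') measurable
  also have "\<dots> = Q"
    unfolding Q_def slope_def by (intro nn_integral_cong nn_integral_cmult) measurable
  finally have A1: "A \<le> (\<integral>\<^sup>+x. indicator U x * ennreal (\<Phi> (u (l *\<^sub>R x))) \<partial>lborel) + ennreal R * Q" .
  have ld: "0 \<le> l ^ ?d" "l ^ ?d \<le> 1" using l by (auto simp: power_le_one)
  \<comment> \<open>Only the share \<open>l^d A\<close> is estimated by \<open>A1\<close>; its main
    term is then exactly \<open>V\<close>, ready to be cancelled without a subtraction of extended
    reals.\<close>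
  have "V + W = ennreal (l ^ ?d) * A + ennreal (1 - l ^ ?d) * A"
    using ld unfolding AVW[symmetric] by (simp add: distrib_right[symmetric] ennreal_plus[symmetric] del: ennreal_plus)
  also have "ennreal (l ^ ?d) * A \<le> V + ennreal R * Q"
  proof -
    have "ennreal (l ^ ?d) * A \<le> ennreal (l ^ ?d) * ((\<integral>\<^sup>+x. indicator U x * ennreal (\<Phi> (u (l *\<^sub>R x))) \<partial>lborel) + ennreal R * Q)"
      by (rule mult_left_mono[OF A1]) simp
    also have "\<dots> = V + ennreal (l ^ ?d) * (ennreal R * Q)"
      unfolding Veq by (simp add: distrib_left)
    also have "ennreal (l ^ ?d) * (ennreal R * Q) \<le> 1 * (ennreal R * Q)"
      using ld by (intro mult_right_mono) auto
    finally show ?thesis by simp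
  qed
  also have "V + ennreal R * Q + ennreal (1 - l ^ ?d) * A = V + (ennreal (1 - l ^ ?d) * A + ennreal R * Q)"
    by (simp add: ac_simps)
  finally have "W \<le> ennreal (1 - l ^ ?d) * A + ennreal R * Q"
    using A_fin AVW by (auto simp: ennreal_add_left_cancel_le)
  also have "ennreal (1 - l ^ ?d) * A \<le> ennreal ((1 - l) * real ?d) * A"
    using Bernoulli_inequality[of "l - 1" ?d] l by (intro mult_right_mono ennreal_leI) (auto simp: algebra_simps)
  finally show ?thesis unfolding W_def A_def Q_def by simp
qed

text \<open>On almost every ray through \<open>F\<close> the whole piece \<open>l <= t < 1\<close>
  belongs to the layer: \<open>t y\<close> is in \<open>U\<close>, whereas \<open>t y / l\<close>
  has height at least \<open>b\<close> and \<open>U\<close> lies strictly below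
  \<open>b\<close>.\<close>

lemma layer_lower_bound:
  assumes l: "0 < l" "l < 1"
  shows "ennreal b * (\<integral>\<^sup>+y. indicator F y * (\<integral>\<^sup>+t. indicator {l..<1} t * (ennreal (t ^ (DIM('a) - 1)) *
      ennreal (\<Phi> (u (t *\<^sub>R y)))) \<partial>lborel) \<partial>\<sigma>) \<le>
    (\<integral>\<^sup>+x. indicator U x * (indicator (- U) (inverse l *\<^sub>R x) * ennreal (\<Phi> (u x))) \<partial>lborel)"
proof -
  note [measurable_cong] = sets_hyperplane_measure
  have "(\<integral>\<^sup>+x. indicator U x * (indicator (- U) (inverse l *\<^sub>R x) * ennreal (\<Phi> (u x))) \<partial>lborel) =
    ennreal b * (\<integral>\<^sup>+y. (\<integral>\<^sup>+t. indicator {0<..} t * ennreal (t ^ (DIM('a) - 1)) *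
      (indicator U (t *\<^sub>R y) * (indicator (- U) (inverse l *\<^sub>R (t *\<^sub>R y)) * ennreal (\<Phi> (u (t *\<^sub>R y))))) \<partial>lborel) \<partial>\<sigma>)"
    by (rule nn_integral_cone[OF n _ b]) (use U_sub in \<open>auto simp: indicator_def split: if_splits\<close>)
  moreover have "(\<integral>\<^sup>+y. indicator F y * (\<integral>\<^sup>+t. indicator {l..<1} t * (ennreal (t ^ (DIM('a) - 1)) *
      ennreal (\<Phi> (u (t *\<^sub>R y)))) \<partial>lborel) \<partial>\<sigma>) \<le>
      (\<integral>\<^sup>+y. (\<integral>\<^sup>+t. indicator {0<..} t * ennreal (t ^ (DIM('a) - 1)) *
      (indicator U (t *\<^sub>R y) * (indicator (- U) (inverse l *\<^sub>R (t *\<^sub>R y)) * ennreal (\<Phi> (u (t *\<^sub>R y))))) \<partial>lborel) \<partial>\<sigma>)"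
  proof (rule nn_integral_mono_AE, use AE_segment_interior in eventually_elim)
    case (elim y)
    show ?case
    proof (cases "y \<in> F")
      case True
      then have y: "n \<bullet> y = b" "\<And>t. 0 < t \<Longrightarrow> t < 1 \<Longrightarrow> t *\<^sub>R y \<in> U" using elim F_sub by auto
      have "inverse l *\<^sub>R (t *\<^sub>R y) \<notin> U" if "l \<le> t" for t
      proof
        assume "inverse l *\<^sub>R (t *\<^sub>R y) \<in> U"
        then have "inverse l * t * b < b" using U_sub[of "inverse l *\<^sub>R (t *\<^sub>R y)"] y by (simp add: mult.assoc)
        then have "inverse l * t < 1" using b by simp
        then show False using that l by (simp add: field_simps)
      qed
      then show ?thesis
        using True l y(2) by (auto intro!: nn_integral_mono split: split_indicator)
    qed simp
  qed
  ultimately show ?thesis by (simp add: mult_left_mono)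
qed

text \<open>Both layer bounds are multiplied by \<open>m = 1 / (1 - l)\<close>. On the left this
  yields averages along rays towards \<open>F\<close>, whose lower limit dominates the boundary
  value, so Fatou's lemma applies; on the right the averages of \<open>slope\<close> are controlled
  by its limit at 1.\<close>

theorem cone_trace_inequality:
  "ennreal b * (\<integral>\<^sup>+y. indicator F y * ennreal (\<Phi> (w y)) \<partial>\<sigma>) \<le>
    ennreal (real DIM('a)) * energy +
    ennreal R * (\<integral>\<^sup>+x. indicator U x * (ennreal (\<eta> (u x)) * ennreal (norm (g x))) \<partial>lborel)"
proof -
  note [measurable_cong] = sets_hyperplane_measure
  let ?d = "DIM('a)"
  let ?m = "\<lambda>k. real (Suc (Suc k))"
  let ?l = "\<lambda>k. 1 - 1 / ?m k"
  define A where "A = energy"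
  define X where "X = ennreal b * (\<integral>\<^sup>+y. indicator F y * ennreal (\<Phi> (w y)) \<partial>\<sigma>)"
  define J where "J k y = ennreal (?m k) * (\<integral>\<^sup>+t. indicator {?l k..<1} t *
    (ennreal (t ^ (?d - 1)) * ennreal (\<Phi> (u (t *\<^sub>R y)))) \<partial>lborel)" for k y
  have J[measurable]: "(\<lambda>y. indicator F y * J k y) \<in> borel_measurable \<sigma>" for k
    unfolding J_def by measurable
  have l: "0 < ?l k" "?l k < 1" for k by (auto simp: field_simps)
  have "(\<integral>\<^sup>+y. indicator F y * ennreal (\<Phi> (w y)) \<partial>\<sigma>) \<le> (\<integral>\<^sup>+y. liminf (\<lambda>k. indicator F y * J k y) \<partial>\<sigma>)"
  proof (rule nn_integral_mono_AE, use AE_segment_interior w in eventually_elim)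
    case (elim y)
    show ?case
    proof (cases "y \<in> F")
      case True
      with elim have u: "((\<lambda>t. u (t *\<^sub>R y)) \<longlongrightarrow> w y) (at_left 1)" by blast
      have "isCont \<Phi> (w y)" using \<Phi>(2) by (simp add: continuous_on_eq_continuous_at)
      then have "((\<lambda>t. \<Phi> (u (t *\<^sub>R y))) \<longlongrightarrow> \<Phi> (w y)) (at_left 1)"
        using u by (rule isCont_tendsto_compose)
      then have "((\<lambda>t. t ^ (?d - 1) * \<Phi> (u (t *\<^sub>R y))) \<longlongrightarrow> 1 ^ (?d - 1) * \<Phi> (w y)) (at_left 1)"
        by (intro tendsto_intros) (auto intro: tendsto_ident_at)
      then have "((\<lambda>t. ennreal (t ^ (?d - 1) * \<Phi> (u (t *\<^sub>R y)))) \<longlongrightarrow> ennreal (\<Phi> (w y))) (at_left 1)"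
        by (intro tendsto_ennrealI) simp
      then have "((\<lambda>t. ennreal (t ^ (?d - 1)) * ennreal (\<Phi> (u (t *\<^sub>R y)))) \<longlongrightarrow> ennreal (\<Phi> (w y))) (at_left 1)"
        by (simp add: ennreal_mult'' \<Phi>(1))
      from le_liminf_average[OF this] show ?thesis
        using True by (simp add: J_def)
    qed simp
  qed
  also have "\<dots> \<le> liminf (\<lambda>k. \<integral>\<^sup>+y. indicator F y * J k y \<partial>\<sigma>)"
    by (rule nn_integral_liminf) measurable
  finally have X1: "(\<integral>\<^sup>+y. indicator F y * ennreal (\<Phi> (w y)) \<partial>\<sigma>) \<le>
    liminf (\<lambda>k. \<integral>\<^sup>+y. indicator F y * J k y \<partial>\<sigma>)" .
  have b1: "ennreal b * (ennreal (1 / b) * z) = z" "ennreal (1 / b) * (ennreal b * z) = z" for z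
    using b by (simp_all add: mult.assoc[symmetric] ennreal_mult[symmetric])
  \<comment> \<open>Convergence gives only \<open>slope t < c\<close> near 1 for each
    \<open>c\<close> above \<open>slope 1\<close>, so the bound is proved for every such
    \<open>c\<close> before \<open>c\<close> is lowered to \<open>slope 1\<close>.\<close>
  have up: "X \<le> ennreal (real ?d) * A + ennreal R * c" if c: "slope 1 < c" for c
  proof -
    have "\<forall>\<^sub>F t in at_left 1. slope t < c"
      by (rule sequentially_imp_eventually_at_left[of "1/2"])
        (use order_tendstoD(2)[OF slope_tendsto c] in auto)
    then obtain \<delta> where \<delta>: "\<delta> < 1" "\<And>t. \<delta> < t \<Longrightarrow> t < 1 \<Longrightarrow> slope t < c"
      by (auto simp: eventually_at_left[of 0])
    have "(\<lambda>k. 1 - inverse (real (Suc (Suc k)))) \<longlonglongrightarrow> 1 - 0"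
      using LIMSEQ_Suc[OF LIMSEQ_inverse_real_of_nat] by (intro tendsto_intros)
    then have "\<forall>\<^sub>F k in sequentially. \<delta> < 1 - inverse (real (Suc (Suc k)))"
      using \<delta>(1) by (intro order_tendstoD(1)) auto
    then have "\<forall>\<^sub>F k in sequentially. ennreal b * (\<integral>\<^sup>+y. indicator F y * J k y \<partial>\<sigma>) \<le>
      ennreal (real ?d) * A + ennreal R * c"
    proof eventually_elim
      case (elim k)
      have Q: "(\<integral>\<^sup>+t. indicator {?l k..1} t * slope t \<partial>lborel) \<le> ennreal (1 / ?m k) * c"
      proof -
        have "(\<integral>\<^sup>+t. indicator {?l k..1} t * slope t \<partial>lborel) \<le> (\<integral>\<^sup>+t. c * indicator {?l k..1} t \<partial>lborel)"
        proof (rule nn_integral_mono)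
          fix t
          show "indicator {?l k..1} t * slope t \<le> c * indicator {?l k..1} t"
            using \<delta>(2)[of t] c elim
            by (cases "t = 1") (auto simp: inverse_eq_divide less_imp_le split: split_indicator)
        qed
        also have "\<dots> = c * ennreal (1 / ?m k)"
          by (subst nn_integral_cmult_indicator) auto
        finally show ?thesis by (simp add: mult.commute)
      qed
      have "ennreal b * (\<integral>\<^sup>+y. indicator F y * J k y \<partial>\<sigma>) = ennreal (?m k) * (ennreal b *
        (\<integral>\<^sup>+y. indicator F y * (\<integral>\<^sup>+t. indicator {?l k..<1} t *
          (ennreal (t ^ (?d - 1)) * ennreal (\<Phi> (u (t *\<^sub>R y)))) \<partial>lborel) \<partial>\<sigma>))"
        unfolding J_def by (subst mult.left_commute, subst nn_integral_cmult) (measurable, simp add: mult_ac)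
      also have "\<dots> \<le> ennreal (?m k) * (ennreal ((1 - ?l k) * real ?d) * A +
          ennreal R * (ennreal (1 / ?m k) * c))"
        by (rule mult_left_mono[OF order_trans[OF layer_lower_bound[OF l]
              order_trans[OF layer_upper_bound[OF l, folded A_def]]]])
          (use Q in \<open>auto intro!: add_left_mono mult_left_mono\<close>)
      also have "\<dots> = (ennreal (?m k) * ennreal (1 / ?m k)) * (ennreal (real ?d) * A + ennreal R * c)"
      proof -
        have "ennreal ((1 - ?l k) * real ?d) = ennreal (1 / ?m k) * ennreal (real ?d)"
          by (subst ennreal_mult[symmetric]) auto
        then show ?thesis by (simp only: distrib_left mult_ac)
      qed
      also have "ennreal (?m k) * ennreal (1 / ?m k) = 1"
        by (subst ennreal_mult[symmetric]) auto
      finally show ?case by simp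
    qed
    then have "\<forall>\<^sub>F k in sequentially. (\<integral>\<^sup>+y. indicator F y * J k y \<partial>\<sigma>) \<le>
      ennreal (1 / b) * (ennreal (real ?d) * A + ennreal R * c)"
      by eventually_elim (metis b1(2) mult_left_mono zero_le)
    then have "liminf (\<lambda>k. \<integral>\<^sup>+y. indicator F y * J k y \<partial>\<sigma>) \<le>
      ennreal (1 / b) * (ennreal (real ?d) * A + ennreal R * c)"
      by (intro Liminf_le) auto
    with X1 have "X \<le> ennreal b * (ennreal (1 / b) * (ennreal (real ?d) * A + ennreal R * c))"
      unfolding X_def by (intro mult_left_mono) auto
    then show ?thesis by (simp add: b1)
  qed
  have "X \<le> ennreal (real ?d) * A + ennreal R * slope 1"
  proof (rule ennreal_le_epsilon)
    fix e :: real assume "0 < e"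
    \<comment> \<open>\<open>R\<close> may be 0; division by \<open>R + 1\<close> keeps the
      tolerance finite and its product with \<open>R\<close> below \<open>e\<close>.\<close>
    then have e: "0 < e / (R + 1)" using R(1) by simp
    have "slope 1 + 0 < slope 1 + ennreal (e / (R + 1))"
      using slope_1_finite e by (subst ennreal_add_left_cancel_less) auto
    then have "X \<le> ennreal (real ?d) * A + ennreal R * (slope 1 + ennreal (e / (R + 1)))"
      by (intro up) simp
    also have "ennreal R * (slope 1 + ennreal (e / (R + 1))) = ennreal R * slope 1 + ennreal (R * (e / (R + 1)))"
      using R(1) e ennreal_mult[of R "e / (R + 1)"] by (simp only: distrib_left less_imp_le)
    also have "R * (e / (R + 1)) \<le> e"
      using R(1) \<open>0 < e\<close> by (simp add: field_simps)
    finally show "X \<le> ennreal (real ?d) * A + ennreal R * slope 1 + ennreal e"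
      by (simp add: add.assoc add_left_mono ennreal_leI)
  qed
  then show ?thesis by (simp add: X_def A_def slope_def)
qed

end

section \<open>The trace inequality on an element\<close>

lemma nn_integral_hyperplane_measure_translate:
  fixes n :: "'a::euclidean_space"
  assumes n: "norm n = 1" and [measurable]: "f \<in> borel_measurable borel"
  shows "(\<integral>\<^sup>+z. f (z + p) \<partial>hyperplane_measure {x. n \<bullet> x = b}) =
    (\<integral>\<^sup>+z. f z \<partial>hyperplane_measure {x. n \<bullet> x = n \<bullet> p + b})"
proof -
  let ?I = "\<lambda>t. indicator {-1/2..1/2::real} t :: ennreal"
  have "(\<integral>\<^sup>+z. f z \<partial>hyperplane_measure {x. n \<bullet> x = n \<bullet> p + b}) =
    (\<integral>\<^sup>+x. ?I (n \<bullet> x - (n \<bullet> p + b)) * f (x - (n \<bullet> x - (n \<bullet> p + b)) *\<^sub>R n) \<partial>lborel)"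
    by (rule nn_integral_hyperplane_measure[OF n]) measurable
  also have "\<dots> = (\<integral>\<^sup>+x. ?I (n \<bullet> (x + p) - (n \<bullet> p + b)) *
      f (x + p - (n \<bullet> (x + p) - (n \<bullet> p + b)) *\<^sub>R n) \<partial>lborel)"
    by (rule nn_integral_lborel_shift[symmetric]) measurable
  also have "\<dots> = (\<integral>\<^sup>+x. ?I (n \<bullet> x - b) * f (x - (n \<bullet> x - b) *\<^sub>R n + p) \<partial>lborel)"
    by (simp add: inner_add_right algebra_simps)
  also have "\<dots> = (\<integral>\<^sup>+z. f (z + p) \<partial>hyperplane_measure {x. n \<bullet> x = b})"
    by (rule nn_integral_hyperplane_measure[OF n, symmetric]) measurable
  finally show ?thesis ..
qed

lemma nn_integral_power_unit_interval:
  assumes "0 < d"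
  shows "(\<integral>\<^sup>+t. indicator {0<..1} t * ennreal (t ^ (d - 1)) \<partial>lborel) = ennreal (1 / real d)"
proof -
  have "(\<integral>\<^sup>+t. indicator {0<..1} t * ennreal (t ^ (d - 1)) \<partial>lborel) =
    (\<integral>\<^sup>+t. ennreal (t ^ (d - 1)) * indicator {0..1} t \<partial>lborel)"
    by (rule nn_integral_cong_AE[OF AE_mp[OF AE_lborel_singleton[of 0]]])
      (auto split: split_indicator)
  also have "\<dots> = ennreal (1 ^ d / real d - 0 ^ d / real d)"
  proof (rule nn_integral_FTC_Icc)
    show "((\<lambda>t. t ^ d / real d) has_real_derivative t ^ (d - 1)) (at t)" for t :: real
      using assms by (auto intro!: derivative_eq_intros)
  qed auto
  finally show ?thesis using assms by (simp add: zero_power)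
qed

text \<open>A simplex as the cone with vertex \<open>p\<close> over a facet \<open>F\<close>, where
  \<open>n\<close> is the unit normal of \<open>F\<close> pointing away from \<open>p\<close> and
  \<open>b\<close> the height.\<close>

locale simplex_cone =
  fixes T F :: "'a::euclidean_space set" and p n :: 'a and b :: real
  assumes T: "compact T" "convex T" and F: "compact F" and n: "norm n = 1" and b: "0 < b"
    and F_sub: "F \<subseteq> {x. n \<bullet> x = n \<bullet> p + b}"
    and T_eq: "T = {p + t *\<^sub>R (y - p) | t y. 0 \<le> t \<and> t \<le> 1 \<and> y \<in> F}"
begin

lemma T_bounds: "x \<in> T \<Longrightarrow> n \<bullet> p \<le> n \<bullet> x \<and> n \<bullet> x \<le> n \<bullet> p + b"
  using F_sub b by (auto simp: T_eq inner_add_right inner_diff_right subset_iff mult_left_le_one_le)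

lemma interior_bounds: assumes "x \<in> interior T" shows "n \<bullet> p < n \<bullet> x \<and> n \<bullet> x < n \<bullet> p + b"
proof -
  have "n \<noteq> 0" using n by auto
  moreover have "interior T \<subseteq> interior {x. n \<bullet> x \<ge> n \<bullet> p}"
    by (rule interior_mono) (use T_bounds in auto)
  moreover have "interior T \<subseteq> interior {x. n \<bullet> x \<le> n \<bullet> p + b}"
    by (rule interior_mono) (use T_bounds in auto)
  ultimately show ?thesis
    using assms by (auto simp: interior_halfspace_ge interior_halfspace_le)
qed

lemma ray_mem_iff:
  assumes "n \<bullet> y = b" "0 < t" shows "t *\<^sub>R y + p \<in> T \<longleftrightarrow> y + p \<in> F \<and> t \<le> 1"
proof
  assume "t *\<^sub>R y + p \<in> T"
  then obtain s z where s: "0 \<le> s" "s \<le> 1" "z \<in> F" "t *\<^sub>R y = s *\<^sub>R (z - p)"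
    by (auto simp: T_eq algebra_simps)
  have "n \<bullet> (t *\<^sub>R y) = n \<bullet> (s *\<^sub>R (z - p))" using s(4) by simp
  then have "t = s" using assms s(3) F_sub b by (auto simp: inner_diff_right)
  then have "y = z - p" using s(4) assms(2) by simp
  with \<open>t = s\<close> s show "y + p \<in> F \<and> t \<le> 1" by simp
next
  assume "y + p \<in> F \<and> t \<le> 1"
  then show "t *\<^sub>R y + p \<in> T"
    using assms(2) unfolding T_eq by (auto intro!: exI[of _ t] exI[of _ "y + p"])
qed

lemma borel[measurable]: "T \<in> sets borel" "F \<in> sets borel"
  using T F by (auto intro: borel_compact)

lemma surface_measure_facet: "emeasure surface_measure F =
    (\<integral>\<^sup>+y. indicator F (y + p) \<partial>hyperplane_measure {x. n \<bullet> x = b})"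
  using nn_integral_hyperplane_measure_translate[OF n, where f = "indicator F" and p = p and b = b]
    emeasure_surface_measure_hyperplane[OF n borel(2) F_sub] by simp

text \<open>In cone coordinates the radial integral of \<open>t^(d-1)\<close> over
  \<open>(0, 1]\<close> is \<open>1/d\<close>. The plane through \<open>p\<close> parallel to
  \<open>F\<close> is removed first, as a null set, to meet the support condition of
  \<open>nn_integral_cone\<close>.\<close>

lemma volume: "ennreal (real DIM('a)) * emeasure lborel T = ennreal b * emeasure surface_measure F"
proof -
  note [measurable_cong] = sets_hyperplane_measure
  let ?d = "DIM('a)"
  define f :: "'a \<Rightarrow> ennreal" where "f x = indicator T (x + p) * indicator {0<..} (n \<bullet> x)" for x
  have [measurable]: "f \<in> borel_measurable borel" unfolding f_def by measurable
  have "emeasure lborel T = (\<integral>\<^sup>+x. indicator T (x + p) \<partial>lborel)"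
    using nn_integral_lborel_shift[of "indicator T" p] by simp
  also have "\<dots> = (\<integral>\<^sup>+x. f x \<partial>lborel)"
  proof (rule nn_integral_cong_AE)
    have "n \<noteq> 0" using n by auto
    then have "{x. n \<bullet> x = 0} \<in> null_sets lborel"
      using negligible_hyperplane[of n 0] closed_hyperplane[of n 0]
      by (simp add: null_sets_completion_iff negligible_iff_null_sets borel_closed)
    from AE_not_in[OF this] show "AE x in lborel. indicator T (x + p) = f x"
    proof eventually_elim
      case (elim x)
      have "n \<bullet> x > 0" if "x + p \<in> T"
        using T_bounds[OF that] elim by (simp add: inner_add_right)
      then show ?case by (auto simp: f_def split: split_indicator)
    qed
  qed
  also have "\<dots> = ennreal b * (\<integral>\<^sup>+y. (\<integral>\<^sup>+t. indicator {0<..} t * ennreal (t ^ (?d - 1)) * f (t *\<^sub>R y) \<partial>lborel)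
      \<partial>hyperplane_measure {x. n \<bullet> x = b})"
    by (rule nn_integral_cone[OF n _ b]) (auto simp: f_def indicator_def split: if_splits)
  also have "(\<integral>\<^sup>+y. (\<integral>\<^sup>+t. indicator {0<..} t * ennreal (t ^ (?d - 1)) * f (t *\<^sub>R y) \<partial>lborel)
      \<partial>hyperplane_measure {x. n \<bullet> x = b}) =
    (\<integral>\<^sup>+y. indicator F (y + p) * ennreal (1 / real ?d) \<partial>hyperplane_measure {x. n \<bullet> x = b})"
  proof (rule nn_integral_cong_AE, use AE_hyperplane_measure_mem[OF n] in eventually_elim)
    case (elim y)
    have "(\<integral>\<^sup>+t. indicator {0<..} t * ennreal (t ^ (?d - 1)) * f (t *\<^sub>R y) \<partial>lborel) =
      (\<integral>\<^sup>+t. indicator F (y + p) * (indicator {0<..1} t * ennreal (t ^ (?d - 1))) \<partial>lborel)"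
      using ray_mem_iff[OF elim] elim b by (intro nn_integral_cong) (auto simp: f_def split: split_indicator)
    also have "\<dots> = indicator F (y + p) * ennreal (1 / real ?d)"
      using nn_integral_power_unit_interval[of ?d] by (subst nn_integral_cmult) simp_all
    finally show ?case .
  qed
  also have "\<dots> = emeasure surface_measure F * ennreal (1 / real ?d)"
    unfolding surface_measure_facet by (rule nn_integral_multc) measurable
  finally have "ennreal (real ?d) * emeasure lborel T =
      (ennreal (real ?d) * ennreal (1 / real ?d)) * (ennreal b * emeasure surface_measure F)"
    by (simp add: mult_ac)
  also have "ennreal (real ?d) * ennreal (1 / real ?d) = 1"
    by (subst ennreal_mult[symmetric]) auto
  finally show ?thesis by simp
qed

lemma height_ge:
  assumes "\<gamma> * h \<le> real DIM('a) * measure lebesgue T / measure surface_measure F"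
  shows "\<gamma> * h \<le> b"
proof -
  have "enn2real (ennreal (real DIM('a)) * emeasure lborel T) =
      enn2real (ennreal b * emeasure surface_measure F)"
    by (simp add: volume)
  moreover have "measure lebesgue T = measure lborel T" by (simp add: measure_completion)
  ultimately have "real DIM('a) * measure lebesgue T = b * measure surface_measure F"
    using b by (simp add: enn2real_mult measure_def)
  \<comment> \<open>Should \<open>F\<close> have measure 0, the quotient is 0 by convention, and
    \<open>0 < b\<close> gives the claim.\<close>
  with assms b show ?thesis by (auto split: if_splits)
qed

text \<open>Reduction to \<open>cone_trace\<close>: \<open>p\<close> is moved to the origin, and
  \<open>u\<close> and \<open>g\<close> are cut off outside the interior of \<open>T\<close>. The
  weak identity survives the cut because test functions supported in that interior are test
  functions on \<open>V\<close>. Continuity of \<open>u\<close> on \<open>S\<close>, which contains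
  \<open>F - N\<close>, supplies the radial limits.\<close>

lemma trace_inequality:
  assumes V: "open V" "interior T \<subseteq> V"
    and weak: "\<And>\<phi> c. test_function V \<phi> \<Longrightarrow> c \<in> Basis \<Longrightarrow>
      (\<integral>x. indicator V x * u x * frechet_derivative \<phi> (at x) c \<partial>lborel) = - (\<integral>x. (g x \<bullet> c) * \<phi> x \<partial>lborel)"
    and u_int: "integrable lborel (\<lambda>x. indicator V x * u x)" and g_int: "integrable lborel g"
    and S: "continuous_on S u" "V \<subseteq> S" "F - N \<subseteq> S" "N \<in> null_sets surface_measure"
    and h: "0 \<le> h" "\<And>x. x \<in> T \<Longrightarrow> dist p x \<le> h"
    and growth: "convex_growth \<Phi> \<eta> L"
  shows "ennreal b * (\<integral>\<^sup>+x. ennreal (\<Phi> (u x)) * indicator F x \<partial>surface_measure) \<le>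
    ennreal (real DIM('a)) * (\<integral>\<^sup>+x. indicator (interior T) x * ennreal (\<Phi> (u x)) \<partial>lborel) +
    ennreal h * (\<integral>\<^sup>+x. indicator (interior T) x * (ennreal (\<eta> (u x)) * ennreal (norm (g x))) \<partial>lborel)"
proof -
  interpret convex_growth \<Phi> \<eta> L by (rule growth)
  define T0 where "T0 = (+) (- p) ` T"
  define U where "U = (+) (- p) ` interior T"
  define F0 where "F0 = {y. y + p \<in> F}"
  define u0 where "u0 x = indicator U x * u (x + p)" for x
  define g0 where "g0 x = indicator U x *\<^sub>R g (x + p)" for x
  have T0: "x \<in> T0 \<longleftrightarrow> x + p \<in> T" for x
    by (auto simp: T0_def image_iff algebra_simps intro!: bexI[of _ "x + p"])
  have U: "x \<in> U \<longleftrightarrow> x + p \<in> interior T" for x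
    by (auto simp: U_def image_iff algebra_simps intro!: bexI[of _ "x + p"])
  have U_int: "U = interior T0" by (simp only: U_def T0_def interior_translation)
  have U_open: "open U" by (simp add: U_int)
  have [measurable]: "U \<in> sets borel" using U_open by simp
  have [measurable]: "g \<in> borel_measurable borel" using borel_measurable_integrable[OF g_int] by simp
  have [measurable]: "V \<in> sets borel" using V by simp
  have uV[measurable]: "(\<lambda>x. indicator V x * u x) \<in> borel_measurable borel"
    using borel_measurable_integrable[OF u_int] by simp
  have F0_meas[measurable]: "F0 \<in> sets borel"
  proof -
    have "(\<lambda>x. x + p) -` F \<inter> space borel \<in> sets borel"
      by (rule measurable_sets[of _ borel borel]) auto
    then show ?thesis by (simp add: F0_def vimage_def)
  qed
  have u0_alt: "u0 x = indicator U x * (indicator V (x + p) * u (x + p))" for x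
    using U[of x] V(2) by (auto simp: u0_def split: split_indicator)
  have [measurable]: "u0 \<in> borel_measurable borel"
    unfolding u0_alt[abs_def] using measurable_compose[OF _ uV, of "\<lambda>x. x + p" borel] by measurable
  have [measurable]: "g0 \<in> borel_measurable borel" unfolding g0_def[abs_def] by measurable
  have u0_int: "integrable lborel u0"
  proof (rule integrableI_bounded)
    have "(\<integral>\<^sup>+x. ennreal (norm (u0 x)) \<partial>lborel) \<le> (\<integral>\<^sup>+x. ennreal (norm (indicator V (x + p) * u (x + p))) \<partial>lborel)"
      by (intro nn_integral_mono) (auto simp: u0_alt split: split_indicator)
    also have "\<dots> = (\<integral>\<^sup>+x. ennreal (norm (indicator V x * u x)) \<partial>lborel)"
      by (rule nn_integral_lborel_shift) measurable
    also have "\<dots> < \<infinity>" using u_int by (simp add: integrable_iff_bounded)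
    finally show "(\<integral>\<^sup>+x. ennreal (norm (u0 x)) \<partial>lborel) < \<infinity>" .
  qed measurable
  have g0_int: "integrable lborel g0"
  proof (rule integrableI_bounded)
    have "(\<integral>\<^sup>+x. ennreal (norm (g0 x)) \<partial>lborel) \<le> (\<integral>\<^sup>+x. ennreal (norm (g (x + p))) \<partial>lborel)"
      by (intro nn_integral_mono) (auto simp: g0_def split: split_indicator)
    also have "\<dots> = (\<integral>\<^sup>+x. ennreal (norm (g x)) \<partial>lborel)"
      by (rule nn_integral_lborel_shift) measurable
    also have "\<dots> < \<infinity>" using g_int by (simp add: integrable_iff_bounded)
    finally show "(\<integral>\<^sup>+x. ennreal (norm (g0 x)) \<partial>lborel) < \<infinity>" .
  qed measurable
  note [measurable_cong] = sets_hyperplane_measure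
  have N[measurable]: "N \<in> sets borel" using S(4) by (auto simp: null_sets_def)
  have AE_N: "AE y in hyperplane_measure {x. n \<bullet> x = b}. y + p \<notin> N"
  proof -
    have "(\<integral>\<^sup>+y. indicator N (y + p) \<partial>hyperplane_measure {x. n \<bullet> x = b}) = 0"
      using null_sets_surface_measure_hyperplane[OF S(4) n, of "n \<bullet> p + b"]
      by (subst nn_integral_hyperplane_measure_translate[OF n]) (auto simp: null_sets_def)
    then have "AE y in hyperplane_measure {x. n \<bullet> x = b}. indicator N (y + p) = (0::ennreal)"
      by (subst (asm) nn_integral_0_iff_AE) measurable
    then show ?thesis by eventually_elim (auto split: split_indicator_asm)
  qed
  note FS = F_sub
  interpret cone_trace U u0 g0 h \<Phi> \<eta> L T0 F0 n b "\<lambda>y. u (y + p)"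
  proof
    show "open U" by (rule U_open)
    show "0 \<le> h" by (rule h)
    show "norm x \<le> h" if "x \<in> U" for x
    proof -
      have "x + p \<in> T" using that U interior_subset by blast
      from h(2)[OF this] show ?thesis by (simp add: dist_norm)
    qed
    show "t *\<^sub>R x \<in> U" if "x \<in> U" "0 < t" "t \<le> 1" for x t
    proof -
      have x: "x + p \<in> interior T" using that(1) U by simp
      have "F \<noteq> {}" using x interior_subset[of T] T_eq by blast
      then have "p \<in> T" unfolding T_eq by force
      then have "p - t *\<^sub>R (p - (x + p)) \<in> interior T"
        using that x closure_subset[of T] by (intro mem_interior_closure_convex_shrink[OF T(2) x]) auto
      then show ?thesis unfolding U by (simp add: algebra_simps)
    qed
    show "integrable lborel u0" by (rule u0_int)
    show "integrable lborel g0" by (rule g0_int)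
    show "(\<integral>x. u0 x * frechet_derivative \<phi> (at x) c \<partial>lborel) = - (\<integral>x. (g0 x \<bullet> c) * \<phi> x \<partial>lborel)"
      if \<phi>: "test_function U \<phi>" and c: "c \<in> Basis" for \<phi> c
    proof -
      have sm: "smooth \<phi>" and C: "compact (closure {x. \<phi> x \<noteq> 0})" "closure {x. \<phi> x \<noteq> 0} \<subseteq> U"
        using \<phi> by (auto simp: test_function_def)
      let ?\<phi> = "\<lambda>x. \<phi> (x - p)"
      note z = test_function_zero[OF \<phi>] and zU = test_function_zero_outside[OF \<phi>]
      have sm': "smooth ?\<phi>"
        using smooth_algebra_imp_smooth[OF smooth_algebra.smooth[OF sm, of "- p" 1]] by simp
      have tf: "test_function V ?\<phi>"
      proof (rule test_functionI[OF sm' compact_translation[OF C(1), of p]])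
        show "(+) p ` closure {x. \<phi> x \<noteq> 0} \<subseteq> V"
          using C(2) U V(2) by (auto simp: add.commute)
        show "x \<in> (+) p ` closure {x. \<phi> x \<noteq> 0}" if "?\<phi> x \<noteq> 0" for x
        proof
          show "x = p + (x - p)" by simp
          show "x - p \<in> closure {x. \<phi> x \<noteq> 0}" using z[of "x - p"] that by blast
        qed
      qed
      have D: "frechet_derivative ?\<phi> (at (p + x)) = frechet_derivative \<phi> (at x)" for x
      proof -
        have "((\<lambda>z. z - p) has_derivative (\<lambda>h. h)) (at (p + x))"
          by (auto intro!: derivative_eq_intros)
        moreover have "(\<phi> has_derivative frechet_derivative \<phi> (at x)) (at (p + x - p))"
          using has_derivative_frechet[OF smooth_differentiable[OF sm, of x]] by simp
        ultimately have "(?\<phi> has_derivative (\<lambda>h. frechet_derivative \<phi> (at x) h)) (at (p + x))"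
          by (rule has_derivative_compose)
        from frechet_derivative_at[OF this] show ?thesis by simp
      qed
      note [measurable] = smooth_measurable[OF sm'] smooth_measurable[OF smooth_derivative[OF sm' c]]
      have "(\<integral>x. indicator V x * u x * frechet_derivative ?\<phi> (at x) c \<partial>lborel) =
        (\<integral>x. indicator V (p + x) * u (p + x) * frechet_derivative \<phi> (at x) c \<partial>lborel)"
        using integral_lborel_affine[of "\<lambda>x. indicator V x * u x * frechet_derivative ?\<phi> (at x) c" 1 p]
        by (simp add: D)
      also have "\<dots> = (\<integral>x. u0 x * frechet_derivative \<phi> (at x) c \<partial>lborel)"
        using U V(2) zU(2)
        by (intro Bochner_Integration.integral_cong refl) (auto simp: u0_def add.commute split: split_indicator)
      finally have l: "(\<integral>x. indicator V x * u x * frechet_derivative ?\<phi> (at x) c \<partial>lborel) =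
        (\<integral>x. u0 x * frechet_derivative \<phi> (at x) c \<partial>lborel)" .
      have "(\<integral>x. (g x \<bullet> c) * ?\<phi> x \<partial>lborel) = (\<integral>x. (g (p + x) \<bullet> c) * \<phi> x \<partial>lborel)"
        using integral_lborel_affine[of "\<lambda>x. (g x \<bullet> c) * ?\<phi> x" 1 p] by simp
      also have "\<dots> = (\<integral>x. (g0 x \<bullet> c) * \<phi> x \<partial>lborel)"
        using zU(1) by (intro Bochner_Integration.integral_cong refl)
          (auto simp: g0_def add.commute split: split_indicator)
      finally show ?thesis using weak[OF tf c] l by simp
    qed
    show "U = interior T0" by (rule U_int)
    show "convex T0" unfolding T0_def using T(2) by (rule convex_translation)
    show "compact T0" unfolding T0_def using T(1) by (rule compact_translation)
    show "t *\<^sub>R y \<in> T0" if "y \<in> F0" "0 < t" "t \<le> 1" for y t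
      using that unfolding T0 T_eq F0_def by (auto intro!: exI[of _ t] exI[of _ "y + p"])
    show "F0 \<in> sets borel" by (rule F0_meas)
    show "F0 \<subseteq> {x. n \<bullet> x = b}" using F_sub by (auto simp: F0_def inner_add_right)
    show "0 < n \<bullet> x \<and> n \<bullet> x < b" if "x \<in> U" for x
      using interior_bounds[of "x + p"] that U by (auto simp: inner_add_right)
    show "continuous_on U u0"
    proof -
      have "continuous_on U (\<lambda>x. u (x + p))"
        by (rule continuous_on_compose2[OF S(1)]) (use U V(2) S(2) in \<open>auto intro!: continuous_intros\<close>)
      then show ?thesis by (rule continuous_on_eq) (simp add: u0_def)
    qed
    show "g0 x = 0" if "x \<notin> U" for x using that by (simp add: g0_def)
    show "AE y in hyperplane_measure {x. n \<bullet> x = b}. y \<in> F0 \<longrightarrow>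
      (\<forall>t. 0 < t \<and> t < 1 \<longrightarrow> t *\<^sub>R y \<in> U) \<longrightarrow> ((\<lambda>t. u0 (t *\<^sub>R y)) \<longlongrightarrow> u (y + p)) (at_left 1)"
      using AE_N
      proof eventually_elim
        case (elim y)
        show ?case
        proof (intro impI)
          assume y: "y \<in> F0" and seg: "\<forall>t. 0 < t \<and> t < 1 \<longrightarrow> t *\<^sub>R y \<in> U"
          have ev: "\<forall>\<^sub>F t in at_left 1. t *\<^sub>R y \<in> U"
            unfolding eventually_at_left[OF zero_less_one] using seg by (intro exI[of _ 0]) auto
          have "((\<lambda>t. u (t *\<^sub>R y + p)) \<longlongrightarrow> u (y + p)) (at_left 1)"
          proof (rule continuous_on_tendsto_compose[OF S(1)])
            have "((\<lambda>t. t *\<^sub>R y + p) \<longlongrightarrow> 1 *\<^sub>R y + p) (at_left 1)"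
              by (intro tendsto_intros tendsto_ident_at)
            then show "((\<lambda>t. t *\<^sub>R y + p) \<longlongrightarrow> y + p) (at_left 1)" by simp
            show "y + p \<in> S" using y elim S(3) by (auto simp: F0_def)
            show "\<forall>\<^sub>F t in at_left 1. t *\<^sub>R y + p \<in> S"
              using ev by eventually_elim (use U V(2) S(2) in blast)
          qed
          moreover have "\<forall>\<^sub>F t in at_left 1. u (t *\<^sub>R y + p) = u0 (t *\<^sub>R y)"
            using ev by eventually_elim (simp add: u0_def)
          ultimately show "((\<lambda>t. u0 (t *\<^sub>R y)) \<longlongrightarrow> u (y + p)) (at_left 1)"
            by (rule Lim_transform_eventually)
        qed
      qed
  qed (use n b in auto)
  have F_eq: "(\<integral>\<^sup>+x. ennreal (\<Phi> (u x)) * indicator F x \<partial>surface_measure) =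
    (\<integral>\<^sup>+y. indicator F0 y * ennreal (\<Phi> (u (y + p))) \<partial>hyperplane_measure {x. n \<bullet> x = b})"
  proof -
    \<comment> \<open>The translation formula needs a Borel function, so \<open>u\<close> is first
      cut off to \<open>F - N\<close>, where it is continuous.\<close>
    have "continuous_on (F - N) u" using S(1,3) by (rule continuous_on_subset)
    from borel_measurable_continuous_on_indicator[OF _ this]
    have [measurable]: "(\<lambda>x. indicator (F - N) x *\<^sub>R u x) \<in> borel_measurable borel" by simp
    have "(\<integral>\<^sup>+x. ennreal (\<Phi> (u x)) * indicator F x \<partial>surface_measure) =
      (\<integral>\<^sup>+x. ennreal (\<Phi> (indicator (F - N) x *\<^sub>R u x)) * indicator (F - N) x \<partial>surface_measure)"
      by (rule nn_integral_cong_AE[OF AE_mp[OF AE_not_in[OF S(4)]]])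
        (auto split: split_indicator)
    also have "\<dots> = (\<integral>\<^sup>+x. ennreal (\<Phi> (indicator (F - N) x *\<^sub>R u x)) * indicator (F - N) x
        \<partial>hyperplane_measure {x. n \<bullet> x = n \<bullet> p + b})"
      by (rule nn_integral_surface_measure_hyperplane[OF n]) (use FS in auto)
    also have "\<dots> = (\<integral>\<^sup>+y. ennreal (\<Phi> (indicator (F - N) (y + p) *\<^sub>R u (y + p))) * indicator (F - N) (y + p)
        \<partial>hyperplane_measure {x. n \<bullet> x = b})"
      by (rule nn_integral_hyperplane_measure_translate[OF n, symmetric]) measurable
    also have "\<dots> = (\<integral>\<^sup>+y. indicator F0 y * ennreal (\<Phi> (u (y + p))) \<partial>hyperplane_measure {x. n \<bullet> x = b})"
      by (rule nn_integral_cong_AE[OF AE_mp[OF AE_N]]) (auto simp: F0_def split: split_indicator)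
    finally show ?thesis .
  qed
  have "(\<integral>\<^sup>+x. indicator U x * ennreal (\<Phi> (u0 x)) \<partial>lborel) =
    (\<integral>\<^sup>+x. indicator (interior T) (x + p) * ennreal (\<Phi> (indicator V (x + p) * u (x + p))) \<partial>lborel)"
    using U V(2) by (intro nn_integral_cong) (auto simp: u0_alt split: split_indicator)
  also have "\<dots> = (\<integral>\<^sup>+x. indicator (interior T) x * ennreal (\<Phi> (indicator V x * u x)) \<partial>lborel)"
    by (rule nn_integral_lborel_shift) measurable
  also have "\<dots> = (\<integral>\<^sup>+x. indicator (interior T) x * ennreal (\<Phi> (u x)) \<partial>lborel)"
    using V(2) by (intro nn_integral_cong) (auto split: split_indicator)
  finally have 1: "(\<integral>\<^sup>+x. indicator U x * ennreal (\<Phi> (u0 x)) \<partial>lborel) =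
    (\<integral>\<^sup>+x. indicator (interior T) x * ennreal (\<Phi> (u x)) \<partial>lborel)" .
  have "(\<integral>\<^sup>+x. indicator U x * (ennreal (\<eta> (u0 x)) * ennreal (norm (g0 x))) \<partial>lborel) =
    (\<integral>\<^sup>+x. indicator (interior T) (x + p) * (ennreal (\<eta> (indicator V (x + p) * u (x + p))) * ennreal (norm (g (x + p)))) \<partial>lborel)"
    using U V(2) by (intro nn_integral_cong) (auto simp: u0_alt g0_def split: split_indicator)
  also have "\<dots> = (\<integral>\<^sup>+x. indicator (interior T) x * (ennreal (\<eta> (indicator V x * u x)) * ennreal (norm (g x))) \<partial>lborel)"
    by (rule nn_integral_lborel_shift) measurable
  also have "\<dots> = (\<integral>\<^sup>+x. indicator (interior T) x * (ennreal (\<eta> (u x)) * ennreal (norm (g x))) \<partial>lborel)"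
    using V(2) by (intro nn_integral_cong) (auto split: split_indicator)
  finally have 2: "(\<integral>\<^sup>+x. indicator U x * (ennreal (\<eta> (u0 x)) * ennreal (norm (g0 x))) \<partial>lborel) =
    (\<integral>\<^sup>+x. indicator (interior T) x * (ennreal (\<eta> (u x)) * ennreal (norm (g x))) \<partial>lborel)" .
  show ?thesis
    using cone_trace_inequality unfolding F_eq[symmetric] 1 2 .
qed

end

text \<open>A facet omits exactly one vertex \<open>p\<close>. The remaining vertices span a
  hyperplane that avoids \<open>p\<close> by affine independence, and the sign \<open>s\<close>
  orients its normal away from \<open>p\<close>, which makes \<open>b\<close> positive.\<close>

lemma simplex_cone_exists:
  fixes T F :: "'a::euclidean_space set"
  assumes T: "int DIM('a) simplex T" and F: "F facet_of T"
  shows "\<exists>p n b. simplex_cone T F p n b \<and> p \<in> T"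
proof -
  obtain C where C: "\<not> affine_dependent C" "int (card C) = int DIM('a) + 1" "T = convex hull C"
    using T by (auto simp: simplex_def)
  obtain p where p: "p \<in> C" "F = convex hull (C - {p})" "F \<noteq> {}"
    using F C facet_of_convex_hull_affine_independent by blast
  have fin: "finite C" using C(1) aff_independent_finite by blast
  have "aff_dim (C - {p}) = int (DIM('a) - 1)"
  proof -
    have "\<not> affine_dependent (C - {p})" using C(1) affine_dependent_subset by blast
    moreover have "card C = Suc (card (C - {p}))" using p(1) fin by (rule card.remove[rotated])
    ultimately show ?thesis using C(2) by (simp add: aff_dim_affine_independent of_nat_diff)
  qed
  then have "\<exists>a c. a \<noteq> 0 \<and> affine hull (C - {p}) = {x. a \<bullet> x = c}"
    by (simp only: aff_dim_eq_hyperplane)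
  then obtain a c where ac: "a \<noteq> 0" "affine hull (C - {p}) = {x. a \<bullet> x = c}"
    by (elim exE conjE)
  have "p \<notin> affine hull (C - {p})"
    using C(1) p(1) by (auto simp: affine_dependent_def)
  then have apc: "a \<bullet> p \<noteq> c" using ac by simp
  define s where "s = (if a \<bullet> p < c then 1 else -1 :: real)"
  define n where "n = (s / norm a) *\<^sub>R a"
  define b where "b = s * c / norm a - n \<bullet> p"
  have s: "\<bar>s\<bar> = 1" by (simp add: s_def)
  have n: "norm n = 1" using s ac(1) by (simp add: n_def)
  have b: "0 < b"
    using apc ac(1) by (auto simp: b_def n_def s_def field_simps)
  have Fs: "F \<subseteq> {x. a \<bullet> x = c}"
    using p(2) ac(2) convex_hull_subset_affine_hull by blast
  have "simplex_cone T F p n b"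
  proof
    show "compact T" "convex T" using T compact_simplex convex_simplex by auto
    show "compact F" unfolding p using fin by (simp add: finite_imp_compact_convex_hull)
    show "norm n = 1" "0 < b" by fact+
    show "F \<subseteq> {x. n \<bullet> x = n \<bullet> p + b}"
      using Fs by (auto simp: b_def n_def)
    have ne: "C - {p} \<noteq> {}" using p by auto
    have "T = convex hull (insert p (C - {p}))" using C(3) p(1) by (simp add: insert_absorb)
    also have "\<dots> = {x. \<exists>u\<ge>0. \<exists>v\<ge>0. \<exists>b. b \<in> F \<and> u + v = 1 \<and> x = u *\<^sub>R p + v *\<^sub>R b}"
      unfolding convex_hull_insert[OF ne] p(2)[symmetric] by blast
    also have "\<dots> = {p + t *\<^sub>R (y - p) | t y. 0 \<le> t \<and> t \<le> 1 \<and> y \<in> F}"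
    proof (intro equalityI subsetI; clarsimp)
      fix u v y assume "0 \<le> u" "0 \<le> v" "y \<in> F" "u + v = (1::real)"
      then show "\<exists>t z. u *\<^sub>R p + v *\<^sub>R y = p + t *\<^sub>R (z - p) \<and> 0 \<le> t \<and> t \<le> 1 \<and> z \<in> F"
        by (intro exI[of _ v] exI[of _ y]) (auto simp: algebra_simps scaleR_left_distrib[symmetric])
    next
      fix t :: real and y assume "0 \<le> t" "t \<le> 1" "y \<in> F"
      then show "\<exists>u\<ge>0. \<exists>v\<ge>0. \<exists>b. b \<in> F \<and> u + v = 1 \<and> p + t *\<^sub>R (y - p) = u *\<^sub>R p + v *\<^sub>R b"
        by (intro exI[of _ "1 - t"] exI[of _ t] conjI exI[of _ y]) (auto simp: algebra_simps)
    qed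
    finally show "T = {p + t *\<^sub>R (y - p) | t y. 0 \<le> t \<and> t \<le> 1 \<and> y \<in> F}" .
  qed
  moreover have "p \<in> T" using p(1) C(3) by (simp add: hull_inc)
  ultimately show ?thesis by blast
qed

section \<open>Summation over the boundary simplices of an element\<close>

lemma sum_indicator_interior_le:
  assumes "finite \<S>" "non_overlapping \<S>" "\<And>T. T \<in> \<S> \<Longrightarrow> interior T \<subseteq> V"
  shows "(\<Sum>T\<in>\<S>. indicator (interior T) x) \<le> (indicator V x :: ennreal)"
proof (cases "\<exists>T\<in>\<S>. x \<in> interior T")
  case True
  then obtain T where T: "T \<in> \<S>" "x \<in> interior T" by blast
  then have "x \<notin> interior T'" if "T' \<in> \<S> - {T}" for T'
    using assms(2) that unfolding non_overlapping_def pairwise_def by blast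
  then have "(\<Sum>T'\<in>\<S>. indicator (interior T') x) = (indicator (interior T) x :: ennreal)"
    using assms(1) T(1) by (subst sum.remove[of \<S> T]) auto
  then show ?thesis using T assms(3)[OF T(1)] by auto
qed simp

lemma sum_nn_integral_interior_le:
  fixes f :: "'a::euclidean_space \<Rightarrow> ennreal"
  assumes "finite \<S>" "non_overlapping \<S>" "\<And>T. T \<in> \<S> \<Longrightarrow> interior T \<subseteq> V"
    and V: "open V" and f[measurable]: "(\<lambda>x. indicator V x * f x) \<in> borel_measurable borel"
  shows "(\<Sum>T\<in>\<S>. \<integral>\<^sup>+x. indicator (interior T) x * f x \<partial>lborel) \<le> (\<integral>\<^sup>+x. indicator V x * f x \<partial>lborel)"
proof -
  have "(\<Sum>T\<in>\<S>. \<integral>\<^sup>+x. indicator (interior T) x * f x \<partial>lborel) =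
    (\<Sum>T\<in>\<S>. \<integral>\<^sup>+x. indicator (interior T) x * (indicator V x * f x) \<partial>lborel)"
    using assms(3) by (intro sum.cong nn_integral_cong refl) (auto split: split_indicator)
  also have "\<dots> = (\<integral>\<^sup>+x. (\<Sum>T\<in>\<S>. indicator (interior T) x * (indicator V x * f x)) \<partial>lborel)"
    by (rule nn_integral_sum[symmetric]) measurable
  also have "\<dots> \<le> (\<integral>\<^sup>+x. indicator V x * f x \<partial>lborel)"
  proof (rule nn_integral_mono)
    fix x
    have "(\<Sum>T\<in>\<S>. indicator (interior T) x * (indicator V x * f x)) =
      (\<Sum>T\<in>\<S>. indicator (interior T) x) * (indicator V x * f x)"
      by (simp add: sum_distrib_right)
    also have "\<dots> \<le> indicator V x * (indicator V x * f x)"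
      by (intro mult_right_mono sum_indicator_interior_le assms) auto
    also have "\<dots> = indicator V x * f x"
      by (simp split: split_indicator)
    finally show "(\<Sum>T\<in>\<S>. indicator (interior T) x * (indicator V x * f x)) \<le> indicator V x * f x" .
  qed
  finally show ?thesis .
qed

text \<open>The regularity assumption for one element in isolation, so that the estimates refer
  neither to a mesh nor to the family.\<close>

definition shape_regular :: "real \<Rightarrow> 'a::euclidean_space set \<Rightarrow> bool" where
  "shape_regular \<gamma> K \<longleftrightarrow> 0 < \<gamma> \<and> (\<exists>\<S>. simplicial_partition K \<S> \<and>
     (\<forall>T\<in>\<S>. frontier T \<inter> frontier K \<noteq> {} \<longrightarrow> (frontier T \<inter> frontier K) facet_of T \<and>
        \<gamma> * diameter K \<le> real DIM('a) * measure lebesgue T / measure surface_measure (frontier T \<inter> frontier K)))"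

lemma shape_regular_compact: "shape_regular \<gamma> K \<Longrightarrow> compact K"
  unfolding shape_regular_def simplicial_partition_def by (metis compact_Union compact_simplex)

text \<open>A frontier point of \<open>K\<close> lies in some simplex \<open>T\<close> but not in
  its interior, which is contained in that of \<open>K\<close>; hence the facets in question cover
  the boundary. The volume terms of the simplices add up to at most those of \<open>K\<close>,
  because the interiors are disjoint.\<close>

lemma element_trace_borel:
  fixes K :: "'a::euclidean_space set"
  assumes K: "shape_regular \<gamma> K"
    and weak: "\<And>\<phi> c. test_function (interior K) \<phi> \<Longrightarrow> c \<in> Basis \<Longrightarrow>
      (\<integral>x. indicator (interior K) x * u x * frechet_derivative \<phi> (at x) c \<partial>lborel) = - (\<integral>x. (g x \<bullet> c) * \<phi> x \<partial>lborel)"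
    and u_int: "integrable lborel (\<lambda>x. indicator (interior K) x * u x)" and g_int: "integrable lborel g"
    and N: "continuous_on (K - N) u" "N \<in> null_sets surface_measure" "N \<subseteq> frontier K"
    and growth: "convex_growth \<Phi> \<eta> L"
  shows "ennreal (\<gamma> * diameter K) * (\<integral>\<^sup>+x. indicator (frontier K) x * ennreal (\<Phi> (u x)) \<partial>surface_measure) \<le>
    ennreal (real DIM('a)) * (\<integral>\<^sup>+x. indicator (interior K) x * ennreal (\<Phi> (u x)) \<partial>lborel) +
    ennreal (diameter K) * (\<integral>\<^sup>+x. indicator (interior K) x * (ennreal (\<eta> (u x)) * ennreal (norm (g x))) \<partial>lborel)"
proof -
  interpret convex_growth \<Phi> \<eta> L by (rule growth)
  obtain \<S> where \<gamma>: "0 < \<gamma>" and \<S>: "simplicial_partition K \<S>"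
    and facet: "\<And>T. T \<in> \<S> \<Longrightarrow> frontier T \<inter> frontier K \<noteq> {} \<Longrightarrow> (frontier T \<inter> frontier K) facet_of T \<and>
        \<gamma> * diameter K \<le> real DIM('a) * measure lebesgue T / measure surface_measure (frontier T \<inter> frontier K)"
    using K unfolding shape_regular_def by blast
  have fin: "finite \<S>" and simp: "\<And>T. T \<in> \<S> \<Longrightarrow> int DIM('a) simplex T"
    and no: "non_overlapping \<S>" and KU: "K = \<Union>\<S>"
    using \<S> by (auto simp: simplicial_partition_def)
  have cK: "compact K" using K by (rule shape_regular_compact)
  define h where "h = diameter K"
  have h: "0 \<le> h" by (simp add: h_def diameter_ge_0 compact_imp_bounded[OF cK])
  let ?V = "interior K"
  define \<B> where "\<B> = {T \<in> \<S>. frontier T \<inter> frontier K \<noteq> {}}"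
  have \<B>: "finite \<B>" "\<B> \<subseteq> \<S>" using fin by (auto simp: \<B>_def)
  have no\<B>: "non_overlapping \<B>"
    using no \<B>(2) unfolding non_overlapping_def by (rule pairwise_subset)
  have intTK: "interior T \<subseteq> ?V" if "T \<in> \<S>" for T
    using that KU by (intro interior_mono) auto
  have each: "ennreal (\<gamma> * h) * (\<integral>\<^sup>+x. ennreal (\<Phi> (u x)) * indicator (frontier T \<inter> frontier K) x \<partial>surface_measure) \<le>
    ennreal (real DIM('a)) * (\<integral>\<^sup>+x. indicator (interior T) x * ennreal (\<Phi> (u x)) \<partial>lborel) +
    ennreal h * (\<integral>\<^sup>+x. indicator (interior T) x * (ennreal (\<eta> (u x)) * ennreal (norm (g x))) \<partial>lborel)"
    if T: "T \<in> \<B>" for T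
  proof -
    let ?F = "frontier T \<inter> frontier K"
    have TS: "T \<in> \<S>" and ne: "?F \<noteq> {}" using T by (auto simp: \<B>_def)
    obtain p n b where "simplex_cone T ?F p n b" and p: "p \<in> T"
      using simplex_cone_exists[OF simp[OF TS], of ?F] facet[OF TS ne] by blast
    interpret simplex_cone T ?F p n b by fact
    have "\<gamma> * h \<le> b" unfolding h_def by (rule height_ge) (use facet[OF TS ne] in blast)
    then have "ennreal (\<gamma> * h) * (\<integral>\<^sup>+x. ennreal (\<Phi> (u x)) * indicator ?F x \<partial>surface_measure) \<le>
      ennreal b * (\<integral>\<^sup>+x. ennreal (\<Phi> (u x)) * indicator ?F x \<partial>surface_measure)"
      by (intro mult_right_mono ennreal_leI) auto
    also have "\<dots> \<le> ennreal (real DIM('a)) * (\<integral>\<^sup>+x. indicator (interior T) x * ennreal (\<Phi> (u x)) \<partial>lborel) +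
      ennreal h * (\<integral>\<^sup>+x. indicator (interior T) x * (ennreal (\<eta> (u x)) * ennreal (norm (g x))) \<partial>lborel)"
    proof (rule trace_inequality[where V = ?V and S = "K - N" and N = N and L = L])
      show "?V \<subseteq> K - N" using N(3) interior_subset[of K] by (auto simp: frontier_def)
      show "?F - N \<subseteq> K - N" using frontier_subset_compact[OF cK] by blast
      show "dist p x \<le> h" if "x \<in> T" for x
        unfolding h_def using that p TS KU by (intro diameter_bounded_bound compact_imp_bounded cK) auto
    qed (use intTK[OF TS] weak u_int g_int N h growth in auto)
    finally show ?thesis .
  qed
  have cover: "indicator (frontier K) x \<le> (\<Sum>T\<in>\<B>. indicator (frontier T \<inter> frontier K) x :: ennreal)" for x
  proof (cases "x \<in> frontier K")
    case True
    then have "x \<in> K" using frontier_subset_compact[OF cK] by blast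
    then obtain T where T: "T \<in> \<S>" "x \<in> T" using KU by blast
    have "x \<notin> interior T" using intTK[OF T(1)] True by (auto simp: frontier_def)
    then have "x \<in> frontier T" using T(2) closure_subset[of T] by (auto simp: frontier_def)
    then have "T \<in> \<B>" using True T(1) by (auto simp: \<B>_def)
    then have "(1::ennreal) \<le> (\<Sum>T\<in>\<B>. indicator (frontier T \<inter> frontier K) x)"
      using True \<open>x \<in> frontier T\<close> member_le_sum[of T \<B> "\<lambda>T. indicator (frontier T \<inter> frontier K) x :: ennreal"] \<B>(1)
      by auto
    then show ?thesis using True by simp
  qed simp
  have [measurable]: "(\<lambda>x. indicator ?V x * u x) \<in> borel_measurable borel" "g \<in> borel_measurable borel"
    using borel_measurable_integrable[OF u_int] borel_measurable_integrable[OF g_int] by auto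
  have m1: "(\<lambda>x. indicator ?V x * ennreal (\<Phi> (u x))) \<in> borel_measurable borel"
  proof -
    have "(\<lambda>x. indicator ?V x * ennreal (\<Phi> (indicator ?V x * u x))) \<in> borel_measurable borel" by measurable
    also have "(\<lambda>x. indicator ?V x * ennreal (\<Phi> (indicator ?V x * u x))) = (\<lambda>x. indicator ?V x * ennreal (\<Phi> (u x)))"
      by (auto split: split_indicator)
    finally show ?thesis .
  qed
  have m2: "(\<lambda>x. indicator ?V x * (ennreal (\<eta> (u x)) * ennreal (norm (g x)))) \<in> borel_measurable borel"
  proof -
    have "(\<lambda>x. indicator ?V x * (ennreal (\<eta> (indicator ?V x * u x)) * ennreal (norm (g x)))) \<in> borel_measurable borel" by measurable
    also have "(\<lambda>x. indicator ?V x * (ennreal (\<eta> (indicator ?V x * u x)) * ennreal (norm (g x)))) =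
        (\<lambda>x. indicator ?V x * (ennreal (\<eta> (u x)) * ennreal (norm (g x))))"
      by (auto split: split_indicator)
    finally show ?thesis .
  qed
  \<comment> \<open>A Borel function that agrees with \<open>u\<close> almost everywhere on the
    boundary.\<close>
  define u' where "u' x = indicator (frontier K - N) x *\<^sub>R u x" for x
  have u'[measurable]: "u' \<in> borel_measurable borel"
    unfolding u'_def[abs_def] by (rule borel_measurable_continuous_on_indicator)
      (use N(2) frontier_subset_compact[OF cK] in \<open>auto simp: null_sets_def intro!: continuous_on_subset[OF N(1)]\<close>)
  have [measurable]: "frontier A \<in> sets borel" for A :: "'a set"
    by (simp add: borel_closed)
  have "(\<integral>\<^sup>+x. indicator (frontier K) x * ennreal (\<Phi> (u x)) \<partial>surface_measure) \<le>
    (\<integral>\<^sup>+x. (\<Sum>T\<in>\<B>. ennreal (\<Phi> (u' x)) * indicator (frontier T \<inter> frontier K) x) \<partial>surface_measure)"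
  proof (rule nn_integral_mono_AE, use AE_not_in[OF N(2)] in eventually_elim)
    case (elim x)
    then show ?case
      using mult_left_mono[OF cover[of x], of "ennreal (\<Phi> (u x))"]
      by (auto simp: u'_def sum_distrib_left mult.commute split: split_indicator)
  qed
  also have "\<dots> = (\<Sum>T\<in>\<B>. \<integral>\<^sup>+x. ennreal (\<Phi> (u' x)) * indicator (frontier T \<inter> frontier K) x \<partial>surface_measure)"
    by (rule nn_integral_sum) measurable
  also have "\<dots> = (\<Sum>T\<in>\<B>. \<integral>\<^sup>+x. ennreal (\<Phi> (u x)) * indicator (frontier T \<inter> frontier K) x \<partial>surface_measure)"
    by (rule sum.cong[OF refl], rule nn_integral_cong_AE, rule AE_mp[OF AE_not_in[OF N(2)]])
      (auto simp: u'_def split: split_indicator)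
  finally have "ennreal (\<gamma> * h) * (\<integral>\<^sup>+x. indicator (frontier K) x * ennreal (\<Phi> (u x)) \<partial>surface_measure) \<le>
    (\<Sum>T\<in>\<B>. ennreal (\<gamma> * h) * (\<integral>\<^sup>+x. ennreal (\<Phi> (u x)) * indicator (frontier T \<inter> frontier K) x \<partial>surface_measure))"
    unfolding sum_distrib_left[symmetric] by (rule mult_left_mono) simp
  also have "\<dots> \<le> (\<Sum>T\<in>\<B>. ennreal (real DIM('a)) * (\<integral>\<^sup>+x. indicator (interior T) x * ennreal (\<Phi> (u x)) \<partial>lborel) +
    ennreal h * (\<integral>\<^sup>+x. indicator (interior T) x * (ennreal (\<eta> (u x)) * ennreal (norm (g x))) \<partial>lborel))"
    by (rule sum_mono) (rule each)
  also have "\<dots> = ennreal (real DIM('a)) * (\<Sum>T\<in>\<B>. \<integral>\<^sup>+x. indicator (interior T) x * ennreal (\<Phi> (u x)) \<partial>lborel) +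
    ennreal h * (\<Sum>T\<in>\<B>. \<integral>\<^sup>+x. indicator (interior T) x * (ennreal (\<eta> (u x)) * ennreal (norm (g x))) \<partial>lborel)"
    by (simp add: sum.distrib sum_distrib_left)
  also have "\<dots> \<le> ennreal (real DIM('a)) * (\<integral>\<^sup>+x. indicator ?V x * ennreal (\<Phi> (u x)) \<partial>lborel) +
    ennreal h * (\<integral>\<^sup>+x. indicator ?V x * (ennreal (\<eta> (u x)) * ennreal (norm (g x))) \<partial>lborel)"
    by (intro add_mono mult_left_mono sum_nn_integral_interior_le m1 m2 \<B> no\<B> intTK) (use \<B>(2) in auto)
  finally show ?thesis unfolding h_def .
qed

section \<open>Truncated powers\<close>

text \<open>The tangent inequality for the convex function \<open>x \<mapsto> x^r\<close>, from
  Young's inequality for \<open>c^(r-1) x\<close>. The slope for \<open>r = 1\<close> is spelled out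
  because \<open>0 powr 0\<close> is 0, which would make it jump at \<open>c = 0\<close>.\<close>

lemma tangent_powr_le:
  fixes r x c :: real
  assumes r: "1 \<le> r" and x: "0 \<le> x" and c: "0 \<le> c"
  shows "c powr r + (if r = 1 then 1 else r * c powr (r - 1)) * (x - c) \<le> x powr r"
proof (cases "r = 1")
  case False
  with r have r1: "1 < r" by simp
  have "c powr (r - 1) * x \<le> (c powr (r - 1)) powr (r / (r - 1)) / (r / (r - 1)) + x powr r / r"
    using r1 x c by (intro Youngs_inequality) (auto simp: field_simps)
  also have "(c powr (r - 1)) powr (r / (r - 1)) = c powr r"
    using r1 by (simp add: powr_powr)
  finally have "r * (c powr (r - 1) * x) \<le> r * (c powr r / (r / (r - 1)) + x powr r / r)"
    using r1 by (intro mult_left_mono) auto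
  also have "\<dots> = (r - 1) * c powr r + x powr r"
    using r1 by (simp add: field_simps)
  finally have "r * (c powr (r - 1) * x) \<le> (r - 1) * c powr r + x powr r" .
  moreover have "c powr (r - 1) * c = c powr r"
    using c r1 by (cases "c = 0") (auto simp: powr_diff)
  ultimately show ?thesis
    using False by (simp add: algebra_simps)
qed (use x c in simp)

text \<open>The power of \<open>\<bar>s\<bar>\<close> up to \<open>M\<close>, continued by its
  tangent line at \<open>M\<close>.\<close>

definition trunc_powr :: "real \<Rightarrow> real \<Rightarrow> real \<Rightarrow> real" where
  "trunc_powr r M s = (min \<bar>s\<bar> M) powr r +
     (if r = 1 then 1 else r * (min \<bar>s\<bar> M) powr (r - 1)) * (\<bar>s\<bar> - min \<bar>s\<bar> M)"

definition trunc_slope :: "real \<Rightarrow> real \<Rightarrow> real \<Rightarrow> real" where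
  "trunc_slope r M s = (if r = 1 then 1 else r * (min \<bar>s\<bar> M) powr (r - 1))"

lemma trunc_slope_bounds:
  assumes "1 \<le> r" "0 < M"
  shows "0 \<le> trunc_slope r M s" "trunc_slope r M s \<le> (if r = 1 then 1 else r * M powr (r - 1))"
    "trunc_slope r M s \<le> (if r = 1 then 1 else r * \<bar>s\<bar> powr (r - 1))"
  using assms by (auto simp: trunc_slope_def intro!: mult_left_mono powr_mono2)

lemma trunc_powr_alt: "trunc_powr r M s = (min \<bar>s\<bar> M) powr r + trunc_slope r M s * (\<bar>s\<bar> - min \<bar>s\<bar> M)"
  by (simp add: trunc_powr_def trunc_slope_def)

lemma trunc_powr_nonneg: "1 \<le> r \<Longrightarrow> 0 < M \<Longrightarrow> 0 \<le> trunc_powr r M s"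
  unfolding trunc_powr_alt using trunc_slope_bounds(1)[of r M s]
  by (intro add_nonneg_nonneg mult_nonneg_nonneg) auto

lemma trunc_powr_le: "1 \<le> r \<Longrightarrow> 0 < M \<Longrightarrow> trunc_powr r M s \<le> \<bar>s\<bar> powr r"
  using tangent_powr_le[of r "\<bar>s\<bar>" "min \<bar>s\<bar> M"] by (simp add: trunc_powr_def)

lemma continuous_on_trunc:
  assumes "1 \<le> r" "0 < M"
  shows "continuous_on UNIV (trunc_slope r M)" "continuous_on UNIV (trunc_powr r M)"
proof -
  have m: "continuous_on UNIV (\<lambda>s. (min \<bar>s\<bar> M) powr a)" if "0 < a" for a :: real
    using that assms by (intro continuous_on_powr') (auto intro!: continuous_intros)
  show s: "continuous_on UNIV (trunc_slope r M)"
  proof (cases "r = 1")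
    case False
    then show ?thesis using assms m[of "r - 1"] unfolding trunc_slope_def
      by (auto intro!: continuous_on_mult_left)
  qed (simp add: trunc_slope_def)
  show "continuous_on UNIV (trunc_powr r M)"
    unfolding trunc_powr_alt[abs_def]
    by (intro continuous_on_add m continuous_on_mult s continuous_on_diff continuous_on_min
        continuous_on_rabs continuous_on_id continuous_on_const) (use assms in auto)
qed

text \<open>The tangent inequality compares the truncated values \<open>c\<close> and
  \<open>e\<close> of the two arguments. Beyond \<open>M\<close> the function grows with the slope
  at \<open>M\<close>, which is at least the slope at \<open>c\<close>. Passing from moduli to
  \<open>\<bar>a - b\<bar>\<close> is the triangle inequality.\<close>

lemma trunc_powr_convex:
  assumes r: "1 \<le> r" and M: "0 < M"
  shows "trunc_powr r M a \<le> trunc_powr r M b + trunc_slope r M a * \<bar>a - b\<bar>"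
proof -
  define c where "c = min \<bar>a\<bar> M"
  define e where "e = min \<bar>b\<bar> M"
  let ?k = "\<lambda>c. if r = 1 then 1 else r * c powr (r - 1)"
  have c: "0 \<le> c" "c \<le> M" and e: "0 \<le> e" "e \<le> \<bar>b\<bar>" using M by (auto simp: c_def e_def)
  have ka: "trunc_slope r M a = ?k c" by (simp add: trunc_slope_def c_def)
  have k0: "0 \<le> ?k c" using r by auto
  have "?k c * (\<bar>b\<bar> - e) \<le> ?k e * (\<bar>b\<bar> - e)"
  proof (cases "\<bar>b\<bar> \<le> M")
    case False
    then have "e = M" by (simp add: e_def)
    then show ?thesis using c e r by (intro mult_right_mono) (auto intro!: mult_left_mono powr_mono2)
  qed (simp add: e_def)
  with tangent_powr_le[OF r e(1) c(1)]
  have "c powr r + ?k c * (e - c) + ?k c * (\<bar>b\<bar> - e) \<le> e powr r + ?k e * (\<bar>b\<bar> - e)"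
    by (rule add_mono)
  moreover have "trunc_powr r M b = e powr r + ?k e * (\<bar>b\<bar> - e)"
    by (simp add: trunc_powr_def e_def)
  ultimately have "c powr r + ?k c * (\<bar>b\<bar> - c) \<le> trunc_powr r M b"
    by (simp add: algebra_simps split del: if_split)
  moreover have "trunc_powr r M a = c powr r + ?k c * (\<bar>a\<bar> - c)"
    by (simp add: trunc_powr_def c_def)
  moreover have "?k c * \<bar>a\<bar> \<le> ?k c * (\<bar>b\<bar> + \<bar>a - b\<bar>)"
    using k0 by (intro mult_left_mono) auto
  ultimately show ?thesis unfolding ka by (simp add: algebra_simps split del: if_split)
qed

lemma convex_growth_trunc:
  assumes "1 \<le> r" "0 < M"
  shows "convex_growth (trunc_powr r M) (trunc_slope r M) (if r = 1 then 1 else r * M powr (r - 1))"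
  by unfold_locales
    (rule trunc_powr_nonneg continuous_on_trunc trunc_powr_convex trunc_slope_bounds(1,2); rule assms)+

section \<open>Lebesgue norms\<close>

lemma Lp_norm_finite:
  assumes "Lp_norm p M f < \<infinity>"
  obtains F where "0 \<le> F" "(\<integral>\<^sup>+x. ennreal (norm (f x) powr p) \<partial>M) = ennreal F"
    "Lp_norm p M f = ennreal (F powr (1 / p))"
proof -
  have "(\<integral>\<^sup>+x. ennreal (norm (f x) powr p) \<partial>M) \<noteq> \<infinity>"
    using assms by (auto simp: Lp_norm_def)
  then show thesis
    by (intro that[of "enn2real (\<integral>\<^sup>+x. ennreal (norm (f x) powr p) \<partial>M)"])
      (auto simp: Lp_norm_def Let_def less_top)
qed

lemma Lp_norm_le:
  assumes "(\<integral>\<^sup>+x. ennreal (norm (f x) powr p) \<partial>M) \<le> ennreal F" "0 \<le> F" "0 < p"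
  shows "Lp_norm p M f \<le> ennreal (F powr (1 / p))"
proof -
  have "(\<integral>\<^sup>+x. ennreal (norm (f x) powr p) \<partial>M) \<noteq> \<infinity>"
    using assms(1) by (auto simp: top_unique)
  moreover have "enn2real (\<integral>\<^sup>+x. ennreal (norm (f x) powr p) \<partial>M) \<le> F"
    using enn2real_mono[OF assms(1)] assms(2) by simp
  ultimately show ?thesis
    using assms(3) by (auto simp: Lp_norm_def intro!: ennreal_leI powr_mono2)
qed

text \<open>Young's inequality for the functions normalised by \<open>A\<close> and
  \<open>B\<close>. A vanishing norm, which cannot be normalised, makes the product zero almost
  everywhere.\<close>

lemma Holder_nn_integral:
  fixes f g :: "'a \<Rightarrow> real"
  assumes p: "1 < p" "1 < p'" "1 / p + 1 / p' = 1"
    and [measurable]: "f \<in> borel_measurable M" "g \<in> borel_measurable M"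
    and nn: "\<And>x. 0 \<le> f x" "\<And>x. 0 \<le> g x"
    and F: "(\<integral>\<^sup>+x. ennreal (f x powr p) \<partial>M) = ennreal F" "0 \<le> F"
    and G: "(\<integral>\<^sup>+x. ennreal (g x powr p') \<partial>M) = ennreal G" "0 \<le> G"
  shows "(\<integral>\<^sup>+x. ennreal (f x * g x) \<partial>M) \<le> ennreal (F powr (1 / p) * G powr (1 / p'))"
proof (cases "F = 0 \<or> G = 0")
  case True
  have "AE x in M. f x * g x = 0"
    using True
  proof
    assume "F = 0"
    with F(1) have "(\<integral>\<^sup>+x. ennreal (f x powr p) \<partial>M) = 0" by simp
    then have "AE x in M. ennreal (f x powr p) = 0"
      by (subst (asm) nn_integral_0_iff_AE) auto
    then show ?thesis by eventually_elim auto
  next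
    assume "G = 0"
    with G(1) have "(\<integral>\<^sup>+x. ennreal (g x powr p') \<partial>M) = 0" by simp
    then have "AE x in M. ennreal (g x powr p') = 0"
      by (subst (asm) nn_integral_0_iff_AE) auto
    then show ?thesis by eventually_elim auto
  qed
  then have "(\<integral>\<^sup>+x. ennreal (f x * g x) \<partial>M) = (\<integral>\<^sup>+x. 0 \<partial>M)"
    by (intro nn_integral_cong_AE) (auto elim: eventually_mono)
  then show ?thesis by simp
next
  case False
  then have FG: "0 < F" "0 < G" using F G by auto
  define A where "A = F powr (1 / p)"
  define B where "B = G powr (1 / p')"
  have AB: "0 < A" "0 < B" "A powr p = F" "B powr p' = G"
    using FG p by (auto simp: A_def B_def powr_powr)
  have "(\<integral>\<^sup>+x. ennreal (f x * g x) \<partial>M) \<le>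
    (\<integral>\<^sup>+x. ennreal (A * B / (p * F)) * ennreal (f x powr p) + ennreal (A * B / (p' * G)) * ennreal (g x powr p') \<partial>M)"
  proof (rule nn_integral_mono)
    fix x
    have "(f x / A) * (g x / B) \<le> (f x / A) powr p / p + (g x / B) powr p' / p'"
      using p nn AB by (intro Youngs_inequality) auto
    also have "\<dots> = f x powr p / F / p + g x powr p' / G / p'"
      using nn AB by (simp add: powr_divide)
    finally have "A * B * ((f x / A) * (g x / B)) \<le> A * B * (f x powr p / F / p + g x powr p' / G / p')"
      using AB by (intro mult_left_mono) auto
    then have "f x * g x \<le> A * B / (p * F) * f x powr p + A * B / (p' * G) * g x powr p'"
      using AB by (simp add: field_simps)
    then show "ennreal (f x * g x) \<le>
      ennreal (A * B / (p * F)) * ennreal (f x powr p) + ennreal (A * B / (p' * G)) * ennreal (g x powr p')"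
      using AB FG p by (subst (1 2) ennreal_mult[symmetric]) (auto simp: ennreal_plus[symmetric] simp del: ennreal_plus intro!: ennreal_leI)
  qed
  also have "\<dots> = ennreal (A * B / (p * F)) * ennreal F + ennreal (A * B / (p' * G)) * ennreal G"
    by (simp add: nn_integral_add nn_integral_cmult F(1) G(1))
  also have "\<dots> = ennreal (A * B / (p * F) * F + A * B / (p' * G) * G)"
    using AB FG p by (subst ennreal_plus) (simp_all add: ennreal_mult[symmetric] del: ennreal_plus)
  also have "A * B / (p * F) * F + A * B / (p' * G) * G = A * B * (1 / p + 1 / p')"
    using FG p by (simp add: field_simps)
  finally show ?thesis using p(3) by (simp add: A_def B_def)
qed

lemma Lp_norm_tendsto_0:
  assumes p: "0 < p" and lim: "(\<lambda>k. Lp_norm p M (f k)) \<longlonglongrightarrow> 0"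
  shows "(\<lambda>k. \<integral>\<^sup>+x. ennreal (norm (f k x) powr p) \<partial>M) \<longlonglongrightarrow> 0"
proof -
  let ?I = "\<lambda>k. \<integral>\<^sup>+x. ennreal (norm (f k x) powr p) \<partial>M"
  have fin: "\<forall>\<^sub>F k in sequentially. Lp_norm p M (f k) < \<infinity>"
    using order_tendstoD(2)[OF lim, of \<infinity>] by simp
  have "(\<lambda>k. enn2real (Lp_norm p M (f k))) \<longlonglongrightarrow> 0"
    by (rule tendsto_enn2real) (use lim in auto)
  then have "(\<lambda>k. enn2real (Lp_norm p M (f k)) powr p) \<longlonglongrightarrow> 0 powr p"
    using p by (intro tendsto_powr') auto
  then have "(\<lambda>k. ennreal (enn2real (Lp_norm p M (f k)) powr p)) \<longlonglongrightarrow> ennreal 0"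
    using p by (intro tendsto_ennrealI) simp
  moreover have "\<forall>\<^sub>F k in sequentially. ennreal (enn2real (Lp_norm p M (f k)) powr p) = ?I k"
    using fin
  proof eventually_elim
    case (elim k)
    then obtain F where "0 \<le> F" "?I k = ennreal F" "Lp_norm p M (f k) = ennreal (F powr (1 / p))"
      by (rule Lp_norm_finite)
    then show ?case using p by (simp add: powr_powr)
  qed
  ultimately show ?thesis by (simp add: Lim_transform_eventually)
qed

text \<open>The known case of integrable functions is applied to the \<open>p\<close>-th powers of
  the norms, after dropping the finitely many indices at which these may fail to be
  integrable.\<close>

lemma Lp_AE_subseq:
  fixes f :: "nat \<Rightarrow> 'a \<Rightarrow> 'b::euclidean_space"
  assumes p: "0 < p" and [measurable]: "\<And>k. f k \<in> borel_measurable M"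
    and lim: "(\<lambda>k. Lp_norm p M (f k)) \<longlonglongrightarrow> 0"
  obtains r :: "nat \<Rightarrow> nat" where "strict_mono r" "AE x in M. (\<lambda>k. f (r k) x) \<longlonglongrightarrow> 0"
proof -
  let ?I = "\<lambda>k. \<integral>\<^sup>+x. ennreal (norm (f k x) powr p) \<partial>M"
  have I: "?I \<longlonglongrightarrow> 0" by (rule Lp_norm_tendsto_0[OF p lim])
  then have "\<forall>\<^sub>F k in sequentially. ?I k < \<infinity>"
    using order_tendstoD(2)[OF I, of \<infinity>] by simp
  then obtain m where m: "\<And>k. m \<le> k \<Longrightarrow> ?I k < \<infinity>" by (auto simp: eventually_sequentially)
  let ?a = "\<lambda>k x. norm (f (k + m) x) powr p"
  have int: "integrable M (?a k)" for k
    using m[of "k + m"] by (intro integrableI_bounded) auto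
  have "(\<lambda>k. enn2real (?I (k + m))) \<longlonglongrightarrow> 0"
    by (rule tendsto_enn2real) (use LIMSEQ_ignore_initial_segment[OF I, of m] in auto)
  then have "(\<lambda>k. \<integral>x. norm (?a k x) \<partial>M) \<longlonglongrightarrow> 0"
    by (subst integral_eq_nn_integral) auto
  from tendsto_L1_AE_subseq[OF int this] obtain r :: "nat \<Rightarrow> nat" where
    r: "strict_mono r" "AE x in M. (\<lambda>k. ?a (r k) x) \<longlonglongrightarrow> 0" by blast
  show thesis
  proof (rule that[of "\<lambda>k. r k + m"])
    show "strict_mono (\<lambda>k. r k + m)" using r(1) by (auto simp: strict_mono_def)
    show "AE x in M. (\<lambda>k. f (r k + m) x) \<longlonglongrightarrow> 0"
      using r(2)
    proof eventually_elim
      case (elim x)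
      have "(\<lambda>k. ?a (r k) x powr (1 / p)) \<longlonglongrightarrow> 0 powr (1 / p)"
        using p elim by (intro tendsto_powr') auto
      then show ?case using p by (simp add: powr_powr tendsto_norm_zero_iff)
    qed
  qed
qed

lemma integrable_Lp:
  fixes f :: "'a \<Rightarrow> 'b::euclidean_space"
  assumes q: "1 \<le> q" and M: "emeasure M (space M) < \<infinity>" and [measurable]: "f \<in> borel_measurable M"
    and f: "Lp_norm q M f < \<infinity>"
  shows "integrable M f"
proof (rule integrableI_bounded)
  obtain F where F: "(\<integral>\<^sup>+x. ennreal (norm (f x) powr q) \<partial>M) = ennreal F"
    using Lp_norm_finite[OF f] by blast
  have "(\<integral>\<^sup>+x. ennreal (norm (f x)) \<partial>M) \<le> (\<integral>\<^sup>+x. 1 + ennreal (norm (f x) powr q) \<partial>M)"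
  proof (rule nn_integral_mono)
    fix x
    have "norm (f x) \<le> 1 + norm (f x) powr q"
    proof (cases "norm (f x) \<le> 1")
      case True then show ?thesis using powr_ge_zero[of "norm (f x)" q] by linarith
    next
      case False
      then have "norm (f x) powr 1 \<le> norm (f x) powr q" using q by (intro powr_mono) auto
      then show ?thesis using False by simp
    qed
    then show "ennreal (norm (f x)) \<le> 1 + ennreal (norm (f x) powr q)"
      by (metis ennreal_1 ennreal_leI ennreal_plus powr_ge_zero zero_le_one)
  qed
  also have "\<dots> = emeasure M (space M) + ennreal F"
    by (simp add: nn_integral_add F)
  also have "\<dots> < \<infinity>" using M by simp
  finally show "(\<integral>\<^sup>+x. ennreal (norm (f x)) \<partial>M) < \<infinity>" .
qed measurable

text \<open>Hoelder's inequality against the constant 1. Convergence in mean is all that functions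
  \<open>\<Phi>\<close> of linear growth require in the limit.\<close>

lemma L1_tendsto_0_of_Lp:
  fixes f :: "nat \<Rightarrow> 'a \<Rightarrow> 'b::euclidean_space"
  assumes q: "1 \<le> q" and M: "emeasure M (space M) < \<infinity>" and [measurable]: "\<And>k. f k \<in> borel_measurable M"
    and lim: "(\<lambda>k. Lp_norm q M (f k)) \<longlonglongrightarrow> 0"
  shows "(\<lambda>k. \<integral>\<^sup>+x. ennreal (norm (f k x)) \<partial>M) \<longlonglongrightarrow> 0"
proof (cases "q = 1")
  case True
  then show ?thesis using Lp_norm_tendsto_0[OF _ lim] q by simp
next
  case False
  with q have q1: "1 < q" by simp
  define q' where "q' = q / (q - 1)"
  have q': "1 < q'" "1 / q + 1 / q' = 1" using q1 by (auto simp: q'_def field_simps)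
  let ?\<mu> = "enn2real (emeasure M (space M))"
  have le: "(\<integral>\<^sup>+x. ennreal (norm (f k x)) \<partial>M) \<le> Lp_norm q M (f k) * ennreal (?\<mu> powr (1 / q'))" if "Lp_norm q M (f k) < \<infinity>" for k
  proof -
    obtain F where F: "0 \<le> F" "(\<integral>\<^sup>+x. ennreal (norm (f k x) powr q) \<partial>M) = ennreal F"
      "Lp_norm q M (f k) = ennreal (F powr (1 / q))" by (rule Lp_norm_finite[OF \<open>Lp_norm q M (f k) < \<infinity>\<close>])
    have "(\<integral>\<^sup>+x. ennreal (norm (f k x) * 1) \<partial>M) \<le> ennreal (F powr (1 / q) * ?\<mu> powr (1 / q'))"
      by (rule Holder_nn_integral[OF q1 q' _ _ _ _ F(2,1)]) (use M in auto)
    then show ?thesis by (simp add: F(3) ennreal_mult)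
  qed
  have "(\<lambda>k. ennreal (?\<mu> powr (1 / q')) * Lp_norm q M (f k)) \<longlonglongrightarrow> ennreal (?\<mu> powr (1 / q')) * 0"
    by (rule ennreal_tendsto_cmult[OF _ lim]) simp
  then have lim': "(\<lambda>k. Lp_norm q M (f k) * ennreal (?\<mu> powr (1 / q'))) \<longlonglongrightarrow> 0" by (simp add: mult.commute)
  have "\<forall>\<^sub>F k in sequentially. (\<integral>\<^sup>+x. ennreal (norm (f k x)) \<partial>M) \<le> Lp_norm q M (f k) * ennreal (?\<mu> powr (1 / q'))"
    using order_tendstoD(2)[OF lim, of \<infinity>] by (auto elim!: eventually_mono intro: le)
  from tendsto_sandwich[OF _ this tendsto_const lim'] show ?thesis by simp
qed

section \<open>Traces of Sobolev functions\<close>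

text \<open>Local integrability gives measurability on each compact box, and countably many boxes
  cover \<open>V\<close>. It is applied to weak gradients.\<close>

lemma locally_integrable_measurable:
  assumes V: "open V" and f: "locally_integrable V f"
  shows "f \<in> borel_measurable (lebesgue_on V)"
proof -
  obtain \<D> where \<D>: "countable \<D>" "\<D> \<subseteq> Pow V" "\<And>X. X \<in> \<D> \<Longrightarrow> \<exists>a b. X = cbox a b" "\<Union>\<D> = V"
    using open_countable_Union_open_cbox[OF V] by metis
  show ?thesis
  proof (rule measurable_piecewise_restrict[OF \<D>(1)])
    fix X assume X: "X \<in> \<D>"
    then obtain a b where ab: "X = cbox a b" using \<D>(3) by blast
    have XV: "X \<subseteq> V" using X \<D>(2) by blast
    show "X \<inter> space (lebesgue_on V) \<in> sets (lebesgue_on V)"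
      using XV V by (auto simp: ab sets_restrict_space Int_absorb2 intro!: image_eqI[of _ _ "cbox a b"])
    have "f absolutely_integrable_on X"
      using f XV by (simp add: locally_integrable_def ab)
    then have "f \<in> borel_measurable (lebesgue_on X)"
      by (intro absolutely_integrable_measurable[THEN iffD1, THEN conjunct1]) (auto simp: ab)
    moreover have "restrict_space (lebesgue_on V) X = lebesgue_on X"
      using XV V by (simp add: restrict_restrict_space ab Int_absorb1)
    ultimately show "f \<in> borel_measurable (restrict_space (lebesgue_on V) X)" by simp
  qed (use \<D>(4) in simp)
qed

text \<open>Weak gradients are only Lebesgue measurable, whereas the ray arguments compose them with
  \<open>(t, x) \<mapsto> t x\<close> and use Fubini's theorem for Borel functions.\<close>

lemma borel_representative:
  fixes G :: "'a::euclidean_space \<Rightarrow> 'a"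
  assumes "G \<in> borel_measurable lebesgue"
  obtains g where "g \<in> borel_measurable borel" "AE x in lborel. G x = g x"
proof -
  have "\<exists>h\<in>borel_measurable lborel. AE x in lborel. G x \<bullet> i = h x" for i
    by (intro completion_ex_borel_measurable_real borel_measurable_inner assms borel_measurable_const)
  then have "\<forall>i. \<exists>h. h \<in> borel_measurable borel \<and> (AE x in lborel. G x \<bullet> i = h x)"
    by (simp add: Bex_def)
  from choice[OF this] obtain h
    where "\<forall>i. h i \<in> borel_measurable borel \<and> (AE x in lborel. G x \<bullet> i = h i x)" by (elim exE)
  then have h: "\<And>i. h i \<in> borel_measurable borel" "\<And>i. AE x in lborel. G x \<bullet> i = h i x"
    by simp_all
  show thesis
  proof
    show "(\<lambda>x. \<Sum>i\<in>Basis. h i x *\<^sub>R i) \<in> borel_measurable borel"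
      using h(1) by measurable
    have "AE x in lborel. \<forall>i\<in>Basis. G x \<bullet> i = h i x"
      using h(2) by (intro AE_finite_allI) auto
    then show "AE x in lborel. G x = (\<Sum>i\<in>Basis. h i x *\<^sub>R i)"
    proof eventually_elim
      case (elim x)
      then have "(\<Sum>i\<in>Basis. h i x *\<^sub>R i) = (\<Sum>i\<in>Basis. (G x \<bullet> i) *\<^sub>R i)" by simp
      then show ?case by (simp add: euclidean_representation)
    qed
  qed
qed

text \<open>The choice operator picks some weak gradient, with no control of its norm. This explains
  the hypothesis \<open>gv_fin\<close> below: where it fails, the right-hand side of the estimate is
  infinite.\<close>

lemma weak_gradient_W1: "u \<in> W1 q V \<Longrightarrow> has_weak_gradient V u (weak_gradient V u)"
  unfolding weak_gradient_def by (rule someI_ex[of "has_weak_gradient V u"]) (auto simp: W1_def)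

lemma nn_integral_lebesgue_on:
  fixes V :: "'a::euclidean_space set"
  assumes "open V"
  shows "(\<integral>\<^sup>+x. f x \<partial>lebesgue_on V) = (\<integral>\<^sup>+x. indicator V x * f x \<partial>lborel)"
  using assms by (simp add: nn_integral_restrict_space nn_integral_completion mult.commute)

lemma nn_integral_boundary:
  "(\<integral>\<^sup>+x. f x \<partial>boundary_measure K) = (\<integral>\<^sup>+x. indicator (frontier K) x * f x \<partial>surface_measure)"
  by (simp add: nn_integral_restrict_space borel_closed mult.commute)

text \<open>\<open>u\<close> is Borel on the interior because it is continuous there, and
  \<open>g\<close> is replaced by a Borel representative; this leaves all the integrals
  unchanged.\<close>

lemma element_trace_lebesgue:
  fixes K :: "'a::euclidean_space set"
  assumes K: "shape_regular \<gamma> K"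
    and wg: "has_weak_gradient (interior K) u g"
    and u: "integrable (lebesgue_on (interior K)) u" and g: "integrable (lebesgue_on (interior K)) g"
    and N: "continuous_on (K - N) u" "N \<in> null_sets surface_measure" "N \<subseteq> frontier K"
    and growth: "convex_growth \<Phi> \<eta> L"
  shows "ennreal (\<gamma> * diameter K) * (\<integral>\<^sup>+x. ennreal (\<Phi> (u x)) \<partial>boundary_measure K) \<le>
    ennreal (real DIM('a)) * (\<integral>\<^sup>+x. ennreal (\<Phi> (u x)) \<partial>lebesgue_on (interior K)) +
    ennreal (diameter K) * (\<integral>\<^sup>+x. ennreal (\<eta> (u x)) * ennreal (norm (g x)) \<partial>lebesgue_on (interior K))"
proof -
  let ?V = "interior K"
  have VB[measurable]: "?V \<in> sets borel" by simp
  have VL: "?V \<inter> space lebesgue \<in> sets lebesgue" by simp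
  define G where "G x = indicator ?V x *\<^sub>R g x" for x
  have G: "G \<in> borel_measurable lebesgue"
    unfolding G_def[abs_def] using borel_measurable_integrable[OF g]
    by (subst borel_measurable_restrict_space_iff[OF VL, symmetric])
  obtain g' where g'[measurable]: "g' \<in> borel_measurable borel" and g'_eq: "AE x in lborel. G x = g' x"
    using borel_representative[OF G] by blast
  define g0 where "g0 x = indicator ?V x *\<^sub>R g' x" for x
  have [measurable]: "g0 \<in> borel_measurable borel" unfolding g0_def[abs_def] by measurable
  have g0_eq: "AE x in lborel. indicator ?V x *\<^sub>R g x = g0 x"
    using g'_eq by eventually_elim (auto simp: G_def g0_def split: split_indicator)
  have cont: "continuous_on ?V u"
    using N(1) by (rule continuous_on_subset) (use N(3) interior_subset[of K] in \<open>auto simp: frontier_def\<close>)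
  have [measurable]: "(\<lambda>x. indicator ?V x * u x) \<in> borel_measurable borel"
    using borel_measurable_continuous_on_indicator[OF VB cont] by simp
  have u_int: "integrable lborel (\<lambda>x. indicator ?V x * u x)"
  proof (rule integrableI_bounded)
    have "(\<integral>\<^sup>+x. ennreal (norm (indicator ?V x * u x)) \<partial>lborel) = (\<integral>\<^sup>+x. ennreal (norm (u x)) \<partial>lebesgue_on ?V)"
      unfolding nn_integral_lebesgue_on[OF open_interior]
      by (intro nn_integral_cong) (auto split: split_indicator)
    also have "\<dots> < \<infinity>" using u by (simp add: integrable_iff_bounded)
    finally show "(\<integral>\<^sup>+x. ennreal (norm (indicator ?V x * u x)) \<partial>lborel) < \<infinity>" .
  qed measurable
  have g0_int: "integrable lborel g0"
  proof (rule integrableI_bounded)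
    have "(\<integral>\<^sup>+x. ennreal (norm (g0 x)) \<partial>lborel) = (\<integral>\<^sup>+x. ennreal (norm (g x)) \<partial>lebesgue_on ?V)"
      unfolding nn_integral_lebesgue_on[OF open_interior] using g0_eq
      by (intro nn_integral_cong_AE) (auto elim!: eventually_mono simp: g0_def split: split_indicator split_indicator_asm)
    also have "\<dots> < \<infinity>" using g by (simp add: integrable_iff_bounded)
    finally show "(\<integral>\<^sup>+x. ennreal (norm (g0 x)) \<partial>lborel) < \<infinity>" .
  qed measurable
  have weak: "(\<integral>x. indicator ?V x * u x * frechet_derivative \<phi> (at x) c \<partial>lborel) = - (\<integral>x. (g0 x \<bullet> c) * \<phi> x \<partial>lborel)"
    if \<phi>: "test_function ?V \<phi>" and c: "c \<in> Basis" for \<phi> c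
  proof -
    have sm: "smooth \<phi>" using \<phi> by (simp add: test_function_def)
    note [measurable] = smooth_measurable[OF sm] smooth_measurable[OF smooth_derivative[OF sm c]]
    have "(\<integral>x. u x * frechet_derivative \<phi> (at x) c \<partial>lebesgue_on ?V) =
      (\<integral>x. indicator ?V x * u x * frechet_derivative \<phi> (at x) c \<partial>lebesgue)"
      by (simp add: integral_restrict_space mult.assoc)
    also have "\<dots> = (\<integral>x. indicator ?V x * u x * frechet_derivative \<phi> (at x) c \<partial>lborel)"
      by (rule integral_completion) measurable
    finally have 1: "(\<integral>x. u x * frechet_derivative \<phi> (at x) c \<partial>lebesgue_on ?V) =
      (\<integral>x. indicator ?V x * u x * frechet_derivative \<phi> (at x) c \<partial>lborel)" .
    have "(\<integral>x. (g x \<bullet> c) * \<phi> x \<partial>lebesgue_on ?V) = (\<integral>x. (G x \<bullet> c) * \<phi> x \<partial>lebesgue)"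
      by (simp add: integral_restrict_space G_def mult.assoc)
    also have "\<dots> = (\<integral>x. (g0 x \<bullet> c) * \<phi> x \<partial>lebesgue)"
    proof (rule integral_cong_AE)
      have "\<phi> \<in> borel_measurable lebesgue" "g0 \<in> borel_measurable lebesgue"
        by (auto intro!: measurable_completion)
      then show "(\<lambda>x. (G x \<bullet> c) * \<phi> x) \<in> borel_measurable lebesgue"
        "(\<lambda>x. (g0 x \<bullet> c) * \<phi> x) \<in> borel_measurable lebesgue"
        using G by measurable
      show "AE x in lebesgue. (G x \<bullet> c) * \<phi> x = (g0 x \<bullet> c) * \<phi> x"
        using AE_completion[OF g0_eq] by eventually_elim (simp add: G_def)
    qed
    also have "\<dots> = (\<integral>x. (g0 x \<bullet> c) * \<phi> x \<partial>lborel)"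
      by (rule integral_completion) measurable
    finally show ?thesis
      using wg \<phi> c 1 unfolding has_weak_gradient_def by simp
  qed
  have "(\<integral>\<^sup>+x. ennreal (\<eta> (u x)) * ennreal (norm (g x)) \<partial>lebesgue_on ?V) =
    (\<integral>\<^sup>+x. indicator ?V x * (ennreal (\<eta> (u x)) * ennreal (norm (g0 x))) \<partial>lborel)"
    unfolding nn_integral_lebesgue_on[OF open_interior] using g0_eq
    by (intro nn_integral_cong_AE) (auto elim!: eventually_mono split: split_indicator split_indicator_asm)
  then show ?thesis
    using element_trace_borel[OF K weak u_int g0_int N growth]
    by (simp add: nn_integral_lebesgue_on nn_integral_boundary)
qed

section \<open>Passage from approximating functions to the trace\<close>

lemma ennreal_mult_le_iff_divide:
  assumes "0 < c" shows "ennreal c * x \<le> y \<longleftrightarrow> x \<le> ennreal (1 / c) * y"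
proof -
  have c: "ennreal c * (ennreal (1 / c) * z) = z" "ennreal (1 / c) * (ennreal c * z) = z" for z
    using assms by (simp_all add: mult.assoc[symmetric] ennreal_mult[symmetric])
  show ?thesis
    using mult_left_mono[of "ennreal c * x" y "ennreal (1 / c)"]
      mult_left_mono[of x "ennreal (1 / c) * y" "ennreal c"] by (auto simp: c)
qed

lemma emeasure_lebesgue_on_interior_finite:
  assumes "compact K"
  shows "emeasure (lebesgue_on (interior K)) (space (lebesgue_on (interior K))) < \<infinity>"
proof -
  have "emeasure lebesgue (interior K) \<le> emeasure lebesgue K"
    using assms by (intro emeasure_mono interior_subset) (auto intro: lmeasurable_compact fmeasurableD)
  also have "\<dots> < \<infinity>" using lmeasurable_compact[OF assms] by (auto simp: fmeasurable_def)
  finally show ?thesis by (simp add: emeasure_restrict_space)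
qed

text \<open>On the boundary Fatou's lemma suffices. In the interior, \<open>\<Phi>(u)\<close>
  exceeds \<open>\<Phi>(v)\<close> by at most \<open>L \<bar>u - v\<bar>\<close>, and the gradient
  term splits into \<open>\<eta>(u) \<bar>\<nabla>v\<bar>\<close>, which converges by domination,
  and at most \<open>L \<bar>\<nabla>u - \<nabla>v\<bar>\<close>. Both errors vanish in
  mean.\<close>

lemma trace_inequality_limit:
  fixes K :: "'a::euclidean_space set"
  assumes K: "shape_regular \<gamma> K" and q: "1 \<le> q" and v: "v \<in> W1 q (interior K)"
    and gv_fin: "Lp_norm q (lebesgue_on (interior K)) (weak_gradient (interior K) v) < \<infinity>"
    and w: "has_trace q K v w"
    and growth: "convex_growth \<Phi> \<eta> L"
  shows "ennreal (\<gamma> * diameter K) * (\<integral>\<^sup>+x. ennreal (\<Phi> (w x)) \<partial>boundary_measure K) \<le>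
    ennreal (real DIM('a)) * (\<integral>\<^sup>+x. ennreal (\<Phi> (v x)) \<partial>lebesgue_on (interior K)) +
    ennreal (diameter K) * (\<integral>\<^sup>+x. ennreal (\<eta> (v x)) * ennreal (norm (weak_gradient (interior K) v x)) \<partial>lebesgue_on (interior K))"
proof (cases "diameter K = 0")
  case False
  interpret convex_growth \<Phi> \<eta> L by (rule growth)
  define h where "h = diameter K"
  have cK: "compact K" by (rule shape_regular_compact[OF K])
  have \<gamma>: "0 < \<gamma>" using K by (simp add: shape_regular_def)
  have h: "0 < h" using False diameter_ge_0[OF compact_imp_bounded[OF cK]] by (simp add: h_def)
  define \<mu> where "\<mu> = lebesgue_on (interior K)"
  define \<beta> where "\<beta> = boundary_measure K"
  define gv where "gv = weak_gradient (interior K) v"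
  obtain u where u: "\<And>n. u n \<in> W1 q (interior K)" "\<And>n. u n \<in> Lp_space q \<beta>"
      "\<And>n. \<exists>N \<in> null_sets surface_measure. N \<subseteq> frontier K \<and> continuous_on (K - N) (u n)"
    and lim_u: "(\<lambda>n. Lp_norm q \<mu> (\<lambda>x. u n x - v x)) \<longlonglongrightarrow> 0"
    and lim_g: "(\<lambda>n. Lp_norm q \<mu> (\<lambda>x. weak_gradient (interior K) (u n) x - gv x)) \<longlonglongrightarrow> 0"
    and lim_w: "(\<lambda>n. Lp_norm q \<beta> (\<lambda>x. u n x - w x)) \<longlonglongrightarrow> 0"
    and w_Lp: "w \<in> Lp_space q \<beta>"
    using w unfolding has_trace_def \<mu>_def \<beta>_def gv_def by blast
  define g where "g n = weak_gradient (interior K) (u n)" for n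
  have \<mu>_fin: "emeasure \<mu> (space \<mu>) < \<infinity>"
    unfolding \<mu>_def by (rule emeasure_lebesgue_on_interior_finite[OF cK])
  have grad_meas: "weak_gradient (interior K) z \<in> borel_measurable \<mu>" if "z \<in> W1 q (interior K)" for z
    using weak_gradient_W1[OF that] unfolding \<mu>_def has_weak_gradient_def
    by (intro locally_integrable_measurable) auto
  have W1D: "z \<in> borel_measurable \<mu> \<and> Lp_norm q \<mu> z < \<infinity>" if "z \<in> W1 q (interior K)" for z
    using that by (auto simp: W1_def Lp_space_def \<mu>_def)
  have [measurable]: "v \<in> borel_measurable \<mu>" "gv \<in> borel_measurable \<mu>"
    using v W1D grad_meas by (auto simp: gv_def)
  have [measurable]: "u n \<in> borel_measurable \<mu>" "g n \<in> borel_measurable \<mu>" for n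
    using u(1) W1D grad_meas by (auto simp: g_def)
  have [measurable]: "w \<in> borel_measurable \<beta>" "u n \<in> borel_measurable \<beta>" for n
    using w_Lp u(2) by (auto simp: Lp_space_def)
  have gv_int: "integrable \<mu> gv"
    by (rule integrable_Lp[OF q \<mu>_fin]) (measurable, use gv_fin in \<open>simp add: \<mu>_def gv_def\<close>)
  obtain m where m: "\<And>n. m \<le> n \<Longrightarrow> Lp_norm q \<mu> (\<lambda>x. g n x - gv x) < \<infinity>"
    using order_tendstoD(2)[OF lim_g, of \<infinity>] by (auto simp: eventually_sequentially g_def)
  obtain r1 :: "nat \<Rightarrow> nat" where r1: "strict_mono r1" "AE x in \<mu>. (\<lambda>k. u (r1 k) x - v x) \<longlonglongrightarrow> 0"
    using Lp_AE_subseq[OF _ _ lim_u] q by auto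
  have "(\<lambda>n. Lp_norm q \<beta> (\<lambda>x. u (r1 n) x - w x)) \<longlonglongrightarrow> 0"
    using LIMSEQ_subseq_LIMSEQ[OF lim_w r1(1)] by (simp add: o_def)
  then obtain r2 :: "nat \<Rightarrow> nat" where r2: "strict_mono r2" "AE x in \<beta>. (\<lambda>k. u (r1 (r2 k)) x - w x) \<longlonglongrightarrow> 0"
    using Lp_AE_subseq[of q "\<lambda>n x. u (r1 n) x - w x" \<beta>] q by auto
  \<comment> \<open>\<open>r1\<close> gives convergence almost everywhere in \<open>K\<close>, the
    further extraction \<open>r2\<close> on the boundary, and the shift by \<open>m\<close> skips
    the indices at which the gradient error may be infinite.\<close>
  define s where "s k = r1 (r2 (k + m))" for k
  have s: "strict_mono s" using r1(1) r2(1) by (auto simp: s_def strict_mono_def)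
  have sm: "m \<le> s k" for k
    using seq_suble[OF r1(1), of "r2 (k + m)"] seq_suble[OF r2(1), of "k + m"] by (simp add: s_def)
  have ae_v: "AE x in \<mu>. (\<lambda>k. u (s k) x) \<longlonglongrightarrow> v x"
    using r1(2)
  proof eventually_elim
    case (elim x)
    have "strict_mono (\<lambda>k. r2 (k + m))" using r2(1) by (auto simp: strict_mono_def)
    from LIMSEQ_subseq_LIMSEQ[OF elim this] show ?case by (simp add: o_def s_def LIM_zero_iff)
  qed
  have ae_w: "AE x in \<beta>. (\<lambda>k. u (s k) x) \<longlonglongrightarrow> w x"
    using r2(2)
  proof eventually_elim
    case (elim x)
    from LIMSEQ_ignore_initial_segment[OF elim, of m] show ?case by (simp add: s_def LIM_zero_iff)
  qed
  define E where "E k = (\<integral>\<^sup>+x. ennreal (norm (u (s k) x - v x)) \<partial>\<mu>)" for k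
  define D where "D k = (\<integral>\<^sup>+x. ennreal (norm (g (s k) x - gv x)) \<partial>\<mu>)" for k
  define H where "H k = (\<integral>\<^sup>+x. ennreal (\<eta> (u (s k) x)) * ennreal (norm (gv x)) \<partial>\<mu>)" for k
  define B where "B k = ennreal (real DIM('a)) * ((\<integral>\<^sup>+x. ennreal (\<Phi> (v x)) \<partial>\<mu>) + ennreal L * E k) +
    ennreal h * (H k + ennreal L * D k)" for k
  have E: "E \<longlonglongrightarrow> 0" unfolding E_def[abs_def]
    by (rule L1_tendsto_0_of_Lp[OF q \<mu>_fin]) (use LIMSEQ_subseq_LIMSEQ[OF lim_u s] in \<open>auto simp: o_def\<close>)
  have D: "D \<longlonglongrightarrow> 0" unfolding D_def[abs_def]
  proof (rule L1_tendsto_0_of_Lp[OF q \<mu>_fin])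
    show "(\<lambda>x. g (s k) x - gv x) \<in> borel_measurable \<mu>" for k by measurable
    show "(\<lambda>k. Lp_norm q \<mu> (\<lambda>x. g (s k) x - gv x)) \<longlonglongrightarrow> 0"
      using LIMSEQ_subseq_LIMSEQ[OF lim_g s] by (simp add: o_def g_def)
  qed
  have H: "H \<longlonglongrightarrow> (\<integral>\<^sup>+x. ennreal (\<eta> (v x)) * ennreal (norm (gv x)) \<partial>\<mu>)"
    unfolding H_def[abs_def]
  proof (rule nn_integral_dominated_convergence[where w = "\<lambda>x. ennreal L * ennreal (norm (gv x))"])
    show "(\<integral>\<^sup>+x. ennreal L * ennreal (norm (gv x)) \<partial>\<mu>) < \<infinity>"
      using gv_int by (simp add: nn_integral_cmult integrable_iff_bounded ennreal_mult_less_top)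
    show "AE x in \<mu>. ennreal (\<eta> (u (s k) x)) * ennreal (norm (gv x)) \<le> ennreal L * ennreal (norm (gv x))" for k
      using \<eta>(2) by (intro AE_I2 mult_right_mono ennreal_leI) auto
    show "AE x in \<mu>. (\<lambda>k. ennreal (\<eta> (u (s k) x)) * ennreal (norm (gv x))) \<longlonglongrightarrow> ennreal (\<eta> (v x)) * ennreal (norm (gv x))"
      using ae_v
    proof eventually_elim
      case (elim x)
      have "isCont \<eta> (v x)" using \<eta>(3) by (simp add: continuous_on_eq_continuous_at)
      from isCont_tendsto_compose[OF this elim]
      have "(\<lambda>k. ennreal (\<eta> (u (s k) x) * norm (gv x))) \<longlonglongrightarrow> ennreal (\<eta> (v x) * norm (gv x))"
        by (intro tendsto_ennrealI tendsto_mult tendsto_const)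
      then show ?case by (simp add: ennreal_mult \<eta>(1))
    qed
  qed measurable
  have B_lim: "B \<longlonglongrightarrow> ennreal (real DIM('a)) * ((\<integral>\<^sup>+x. ennreal (\<Phi> (v x)) \<partial>\<mu>) + ennreal L * 0) +
    ennreal h * ((\<integral>\<^sup>+x. ennreal (\<eta> (v x)) * ennreal (norm (gv x)) \<partial>\<mu>) + ennreal L * 0)"
    unfolding B_def[abs_def]
    by (intro tendsto_add ennreal_tendsto_cmult tendsto_const E D H) auto
  have step: "ennreal (\<gamma> * h) * (\<integral>\<^sup>+x. ennreal (\<Phi> (u (s k) x)) \<partial>\<beta>) \<le> B k" for k
  proof -
    have "integrable \<mu> (\<lambda>x. g (s k) x - gv x)"
      by (rule integrable_Lp[OF q \<mu>_fin _ m[OF sm]]) measurable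
    from Bochner_Integration.integrable_add[OF this gv_int] have gi: "integrable \<mu> (g (s k))" by simp
    have ui: "integrable \<mu> (u (s k))"
      using integrable_Lp[OF q \<mu>_fin] W1D[OF u(1)] by blast
    obtain N where N: "N \<in> null_sets surface_measure" "N \<subseteq> frontier K" "continuous_on (K - N) (u (s k))"
      using u(3) by blast
    have "ennreal (\<gamma> * h) * (\<integral>\<^sup>+x. ennreal (\<Phi> (u (s k) x)) \<partial>\<beta>) \<le>
      ennreal (real DIM('a)) * (\<integral>\<^sup>+x. ennreal (\<Phi> (u (s k) x)) \<partial>\<mu>) +
      ennreal h * (\<integral>\<^sup>+x. ennreal (\<eta> (u (s k) x)) * ennreal (norm (g (s k) x)) \<partial>\<mu>)"
      unfolding \<beta>_def \<mu>_def h_def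
      by (rule element_trace_lebesgue[OF K _ _ _ N(3,1,2) growth])
        (use weak_gradient_W1[OF u(1)] ui gi in \<open>auto simp: \<mu>_def g_def\<close>)
    also have "(\<integral>\<^sup>+x. ennreal (\<Phi> (u (s k) x)) \<partial>\<mu>) \<le> (\<integral>\<^sup>+x. ennreal (\<Phi> (v x)) \<partial>\<mu>) + ennreal L * E k"
    proof -
      have "(\<integral>\<^sup>+x. ennreal (\<Phi> (u (s k) x)) \<partial>\<mu>) \<le>
        (\<integral>\<^sup>+x. ennreal (\<Phi> (v x)) + ennreal L * ennreal (norm (u (s k) x - v x)) \<partial>\<mu>)"
      proof (rule nn_integral_mono)
        fix x
        have "\<Phi> (u (s k) x) \<le> \<Phi> (v x) + L * norm (u (s k) x - v x)"
          using growth_le[of "u (s k) x" "v x"] by simp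
        then have "ennreal (\<Phi> (u (s k) x)) \<le> ennreal (\<Phi> (v x) + L * norm (u (s k) x - v x))"
          by (rule ennreal_leI)
        then show "ennreal (\<Phi> (u (s k) x)) \<le> ennreal (\<Phi> (v x)) + ennreal L * ennreal (norm (u (s k) x - v x))"
          using L_nonneg \<Phi>(1) by (simp add: ennreal_mult)
      qed
      also have "\<dots> = (\<integral>\<^sup>+x. ennreal (\<Phi> (v x)) \<partial>\<mu>) + ennreal L * E k"
        unfolding E_def by (simp add: nn_integral_add nn_integral_cmult)
      finally show ?thesis .
    qed
    also have "(\<integral>\<^sup>+x. ennreal (\<eta> (u (s k) x)) * ennreal (norm (g (s k) x)) \<partial>\<mu>) \<le> H k + ennreal L * D k"
    proof -
      have "(\<integral>\<^sup>+x. ennreal (\<eta> (u (s k) x)) * ennreal (norm (g (s k) x)) \<partial>\<mu>) \<le>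
        (\<integral>\<^sup>+x. ennreal (\<eta> (u (s k) x)) * ennreal (norm (gv x)) + ennreal L * ennreal (norm (g (s k) x - gv x)) \<partial>\<mu>)"
      proof (rule nn_integral_mono)
        fix x
        have "\<eta> (u (s k) x) * norm (g (s k) x) \<le> \<eta> (u (s k) x) * (norm (gv x) + norm (g (s k) x - gv x))"
          using norm_triangle_sub[of "g (s k) x" "gv x"] \<eta>(1) by (intro mult_left_mono) auto
        also have "\<dots> \<le> \<eta> (u (s k) x) * norm (gv x) + L * norm (g (s k) x - gv x)"
          using mult_right_mono[OF \<eta>(2)[of "u (s k) x"], of "norm (g (s k) x - gv x)"] by (simp add: distrib_left)
        finally have "ennreal (\<eta> (u (s k) x) * norm (g (s k) x)) \<le> ennreal (\<eta> (u (s k) x) * norm (gv x) + L * norm (g (s k) x - gv x))"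
          by (rule ennreal_leI)
        then show "ennreal (\<eta> (u (s k) x)) * ennreal (norm (g (s k) x)) \<le>
          ennreal (\<eta> (u (s k) x)) * ennreal (norm (gv x)) + ennreal L * ennreal (norm (g (s k) x - gv x))"
          using L_nonneg \<eta>(1) by (simp add: ennreal_mult)
      qed
      also have "\<dots> = H k + ennreal L * D k"
        unfolding H_def D_def by (simp add: nn_integral_add nn_integral_cmult)
      finally show ?thesis .
    qed
    finally show ?thesis unfolding B_def by (simp add: add_mono mult_left_mono)
  qed
  have c: "0 < \<gamma> * h" using \<gamma> h by simp
  have "(\<integral>\<^sup>+x. ennreal (\<Phi> (w x)) \<partial>\<beta>) \<le> (\<integral>\<^sup>+x. liminf (\<lambda>k. ennreal (\<Phi> (u (s k) x))) \<partial>\<beta>)"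
  proof (rule nn_integral_mono_AE, use ae_w in eventually_elim)
    case (elim x)
    have "isCont \<Phi> (w x)" using \<Phi>(2) by (simp add: continuous_on_eq_continuous_at)
    from isCont_tendsto_compose[OF this elim]
    have "(\<lambda>k. ennreal (\<Phi> (u (s k) x))) \<longlonglongrightarrow> ennreal (\<Phi> (w x))" by (rule tendsto_ennrealI)
    then show ?case by (simp add: lim_imp_Liminf)
  qed
  also have "\<dots> \<le> liminf (\<lambda>k. \<integral>\<^sup>+x. ennreal (\<Phi> (u (s k) x)) \<partial>\<beta>)"
    by (rule nn_integral_liminf) measurable
  also have "\<dots> \<le> liminf (\<lambda>k. ennreal (1 / (\<gamma> * h)) * B k)"
    using step by (intro Liminf_mono always_eventually allI) (simp add: ennreal_mult_le_iff_divide[OF c])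
  also have "\<dots> = ennreal (1 / (\<gamma> * h)) * (ennreal (real DIM('a)) * ((\<integral>\<^sup>+x. ennreal (\<Phi> (v x)) \<partial>\<mu>) + ennreal L * 0) +
    ennreal h * ((\<integral>\<^sup>+x. ennreal (\<eta> (v x)) * ennreal (norm (gv x)) \<partial>\<mu>) + ennreal L * 0))"
    by (intro lim_imp_Liminf ennreal_tendsto_cmult B_lim) auto
  finally show ?thesis
    unfolding h_def[symmetric] \<mu>_def[symmetric] \<beta>_def[symmetric] gv_def[symmetric]
    by (simp add: ennreal_mult_le_iff_divide[OF c])
qed simp

text \<open>The truncated powers satisfy the inequality with a right-hand side that does not depend
  on \<open>M\<close>. At each point the truncation is eventually exact, so Fatou's lemma on the
  boundary removes it.\<close>

lemma trace_powr_inequality: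
  fixes K :: "'a::euclidean_space set"
  assumes K: "shape_regular \<gamma> K" "0 < diameter K" and q: "1 \<le> q" and v: "v \<in> W1 q (interior K)"
    and gv_fin: "Lp_norm q (lebesgue_on (interior K)) (weak_gradient (interior K) v) < \<infinity>"
    and w: "has_trace q K v w" and r: "1 \<le> r"
  shows "ennreal (\<gamma> * diameter K) * (\<integral>\<^sup>+x. ennreal (\<bar>w x\<bar> powr r) \<partial>boundary_measure K) \<le>
    ennreal (real DIM('a)) * (\<integral>\<^sup>+x. ennreal (\<bar>v x\<bar> powr r) \<partial>lebesgue_on (interior K)) +
    ennreal (diameter K) * (\<integral>\<^sup>+x. ennreal ((if r = 1 then 1 else r * \<bar>v x\<bar> powr (r - 1)) *
      norm (weak_gradient (interior K) v x)) \<partial>lebesgue_on (interior K))" (is "_ \<le> ?R")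
proof -
  define gv where "gv = weak_gradient (interior K) v"
  let ?\<mu> = "lebesgue_on (interior K)" and ?\<beta> = "boundary_measure K"
  have c: "0 < \<gamma> * diameter K" using K by (simp add: shape_regular_def)
  have [measurable]: "w \<in> borel_measurable ?\<beta>" using w by (simp add: has_trace_def Lp_space_def)
  have [measurable]: "trunc_powr r (real (Suc k)) \<in> borel_measurable borel" for k
    using r by (intro borel_measurable_continuous_onI continuous_on_trunc) auto
  have step: "(\<integral>\<^sup>+x. ennreal (trunc_powr r (real (Suc k)) (w x)) \<partial>?\<beta>) \<le> ennreal (1 / (\<gamma> * diameter K)) * ?R" for k
  proof -
    let ?M = "real (Suc k)"
    have M: "0 < ?M" by simp
    have "ennreal (\<gamma> * diameter K) * (\<integral>\<^sup>+x. ennreal (trunc_powr r ?M (w x)) \<partial>?\<beta>) \<le>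
      ennreal (real DIM('a)) * (\<integral>\<^sup>+x. ennreal (trunc_powr r ?M (v x)) \<partial>?\<mu>) +
      ennreal (diameter K) * (\<integral>\<^sup>+x. ennreal (trunc_slope r ?M (v x)) * ennreal (norm (gv x)) \<partial>?\<mu>)"
      unfolding gv_def
      by (rule trace_inequality_limit[OF K(1) q v gv_fin w convex_growth_trunc[OF r M]])
    also have "\<dots> \<le> ?R"
    proof (intro add_mono mult_left_mono nn_integral_mono)
      show "ennreal (trunc_powr r ?M (v x)) \<le> ennreal (\<bar>v x\<bar> powr r)" for x
        by (rule ennreal_leI[OF trunc_powr_le[OF r M]])
      show "ennreal (trunc_slope r ?M (v x)) * ennreal (norm (gv x)) \<le>
        ennreal ((if r = 1 then 1 else r * \<bar>v x\<bar> powr (r - 1)) * norm (weak_gradient (interior K) v x))" for x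
        unfolding gv_def using trunc_slope_bounds[OF r M, of "v x"]
        by (subst ennreal_mult[symmetric]) (auto intro!: ennreal_leI mult_right_mono split del: if_split)
    qed auto
    finally show ?thesis by (simp only: ennreal_mult_le_iff_divide[OF c])
  qed
  have "(\<integral>\<^sup>+x. ennreal (\<bar>w x\<bar> powr r) \<partial>?\<beta>) = (\<integral>\<^sup>+x. liminf (\<lambda>k. ennreal (trunc_powr r (real (Suc k)) (w x))) \<partial>?\<beta>)"
  proof (rule nn_integral_cong)
    fix x
    obtain m :: nat where m: "\<bar>w x\<bar> \<le> real m" using real_arch_simple by blast
    have "trunc_powr r (real (Suc k)) (w x) = \<bar>w x\<bar> powr r" if "m \<le> k" for k
      using m that by (simp add: trunc_powr_def min_def)
    then have "\<forall>\<^sub>F k in sequentially. ennreal (trunc_powr r (real (Suc k)) (w x)) = ennreal (\<bar>w x\<bar> powr r)"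
      unfolding eventually_sequentially by (intro exI[of _ m]) auto
    then have "(\<lambda>k. ennreal (trunc_powr r (real (Suc k)) (w x))) \<longlonglongrightarrow> ennreal (\<bar>w x\<bar> powr r)"
      by (rule tendsto_eventually)
    then show "ennreal (\<bar>w x\<bar> powr r) = liminf (\<lambda>k. ennreal (trunc_powr r (real (Suc k)) (w x)))"
      by (simp add: lim_imp_Liminf)
  qed
  also have "\<dots> \<le> liminf (\<lambda>k. \<integral>\<^sup>+x. ennreal (trunc_powr r (real (Suc k)) (w x)) \<partial>?\<beta>)"
    by (rule nn_integral_liminf) measurable
  also have "\<dots> \<le> ennreal (1 / (\<gamma> * diameter K)) * ?R"
    using step by (intro Liminf_le always_eventually allI) auto
  finally show ?thesis by (simp only: ennreal_mult_le_iff_divide[OF c])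
qed

text \<open>The origin of the summand \<open>r - 1\<close>: both coefficients \<open>D\<close> and 1
  are at most \<open>D + (r - 1)\<close>, and the tangent inequality at \<open>S\<close> bounds the
  remaining sum by \<open>(S + B)^r\<close>.\<close>

lemma trace_constant_bound:
  fixes r D S B \<gamma> Y :: real
  assumes r: "1 \<le> r" and D: "1 \<le> D" and "0 \<le> S" "0 \<le> B" "0 < \<gamma>" "0 \<le> Y"
    and Y: "\<gamma> * Y \<le> D * S powr r + (if r = 1 then 1 else r * S powr (r - 1)) * B"
  shows "Y powr (1 / r) \<le> ((D + (r - 1)) / \<gamma>) powr (1 / r) * (S + B)"
proof -
  define k where "k = (if r = 1 then 1 else r * S powr (r - 1))"
  have k: "0 \<le> k" using r by (auto simp: k_def)
  have "D * S powr r + k * B \<le> (D + (r - 1)) * S powr r + (D + (r - 1)) * (k * B)"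
    using r D k assms by (intro add_mono mult_right_mono) (auto intro: order_trans[OF _ mult_right_mono[of 1]])
  also have "\<dots> = (D + (r - 1)) * (S powr r + k * B)" by (simp add: distrib_left)
  also have "\<dots> \<le> (D + (r - 1)) * (S + B) powr r"
    using tangent_powr_le[OF r, of "S + B" S] r D assms by (intro mult_left_mono) (auto simp: k_def)
  finally have "Y \<le> ((D + (r - 1)) / \<gamma>) * (S + B) powr r"
    using Y \<open>0 < \<gamma>\<close> by (simp add: k_def[symmetric] field_simps)
  then have "Y powr (1 / r) \<le> (((D + (r - 1)) / \<gamma>) * (S + B) powr r) powr (1 / r)"
    using r assms by (intro powr_mono2) auto
  also have "\<dots> = ((D + (r - 1)) / \<gamma>) powr (1 / r) * ((S + B) powr r) powr (1 / r)"
    by (rule powr_mult)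
  also have "((S + B) powr r) powr (1 / r) = S + B"
    using r assms by (simp add: powr_powr)
  finally show ?thesis .
qed

lemma trace_norm_bound:
  fixes w :: "'a \<Rightarrow> real"
  assumes r: "1 \<le> r" and D: "1 \<le> D" and SB: "0 \<le> S" "0 \<le> B" and "0 < \<gamma>" "0 < h"
    and X: "ennreal (\<gamma> * h) * (\<integral>\<^sup>+x. ennreal (\<bar>w x\<bar> powr r) \<partial>M) \<le>
      ennreal (h * (D * S powr r + (if r = 1 then 1 else r * S powr (r - 1)) * B))"
  shows "Lp_norm r M w \<le> ennreal (((D + (r - 1)) / \<gamma>) powr (1 / r) * (S + B))"
proof -
  define N where "N = D * S powr r + (if r = 1 then 1 else r * S powr (r - 1)) * B"
  have N: "0 \<le> N"
    unfolding N_def using assms by (intro add_nonneg_nonneg mult_nonneg_nonneg) auto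
  have "(\<integral>\<^sup>+x. ennreal (norm (w x) powr r) \<partial>M) \<le> ennreal (1 / (\<gamma> * h)) * ennreal (h * N)"
    using X assms by (simp add: ennreal_mult_le_iff_divide N_def)
  also have "\<dots> = ennreal (N / \<gamma>)"
    using N assms by (subst ennreal_mult[symmetric]) auto
  finally have "Lp_norm r M w \<le> ennreal ((N / \<gamma>) powr (1 / r))"
    by (rule Lp_norm_le) (use N assms in auto)
  also have "(N / \<gamma>) powr (1 / r) \<le> ((D + (r - 1)) / \<gamma>) powr (1 / r) * (S + B)"
    by (rule trace_constant_bound[OF r D SB]) (use N assms in \<open>auto simp: N_def[symmetric]\<close>)
  finally show ?thesis by (simp add: ennreal_leI)
qed

text \<open>Hoelder's inequality with \<open>q\<close> and its conjugate \<open>p\<close>. The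
  relation between the indices says \<open>(r - 1) p = s\<close>, and it holds both for
  \<open>r = s = q\<close> and for the Sobolev pair.\<close>

lemma nn_integral_powr_gradient_le:
  fixes v :: "'a \<Rightarrow> real" and g :: "'a \<Rightarrow> 'b::euclidean_space"
  assumes q: "1 \<le> q" and [measurable]: "v \<in> borel_measurable M" "g \<in> borel_measurable M"
    and F: "(\<integral>\<^sup>+x. ennreal (norm (v x) powr s) \<partial>M) = ennreal (S powr s)" "0 \<le> S"
    and G: "(\<integral>\<^sup>+x. ennreal (norm (g x) powr q) \<partial>M) = ennreal G" "0 \<le> G"
    and r: "1 \<le> r" "r - 1 = s * (q - 1) / q" "0 < s"
  shows "(\<integral>\<^sup>+x. ennreal ((if r = 1 then 1 else r * \<bar>v x\<bar> powr (r - 1)) * norm (g x)) \<partial>M) \<le>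
    ennreal ((if r = 1 then 1 else r * S powr (r - 1)) * G powr (1 / q))"
proof (cases "q = 1")
  case True
  with r have "r = 1" by simp
  with True G show ?thesis by simp
next
  case False
  with q have q1: "1 < q" by simp
  with r have r1: "r \<noteq> 1" by auto
  define p where "p = q / (q - 1)"
  have p: "1 < p" "1 / p + 1 / q = 1" "(r - 1) * p = s" "s * (1 / p) = r - 1"
    using q1 r by (auto simp: p_def field_simps)
  have "(\<integral>\<^sup>+x. ennreal (\<bar>v x\<bar> powr (r - 1) * norm (g x)) \<partial>M) \<le> ennreal ((S powr s) powr (1 / p) * G powr (1 / q))"
    by (rule Holder_nn_integral[OF p(1) q1 p(2)]) (use F G in \<open>auto simp: powr_powr p(3)\<close>)
  also have "(S powr s) powr (1 / p) = S powr (r - 1)" by (simp only: powr_powr p(4))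
  finally have "ennreal r * (\<integral>\<^sup>+x. ennreal (\<bar>v x\<bar> powr (r - 1) * norm (g x)) \<partial>M) \<le>
    ennreal r * ennreal (S powr (r - 1) * G powr (1 / q))" by (rule mult_left_mono) simp
  then show ?thesis
    using r r1 by (simp add: nn_integral_cmult[symmetric] ennreal_mult'[symmetric] mult.assoc)
qed

text \<open>Justifies \<open>D >= 1\<close> in the Sobolev case: the cube with edge
  \<open>1/d\<close> and a corner at the origin lies in the unit ball, as the Euclidean norm is at
  most the sum of the moduli of the coordinates.\<close>

lemma dim_times_unit_ball_vol_ge_1:
  "1 \<le> real DIM('a::euclidean_space) * unit_ball_vol (real DIM('a)) powr (1 / real DIM('a))"
proof -
  let ?d = "DIM('a)"
  have "cbox 0 ((1 / real ?d) *\<^sub>R One) \<subseteq> cball (0::'a) 1"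
  proof
    fix x :: 'a assume x: "x \<in> cbox 0 ((1 / real ?d) *\<^sub>R One)"
    have "norm x \<le> (\<Sum>b\<in>Basis. \<bar>x \<bullet> b\<bar>)" by (rule norm_le_l1)
    also have "\<dots> \<le> (\<Sum>b\<in>(Basis::'a set). 1 / real ?d)"
      using x by (intro sum_mono) (auto simp: mem_box)
    also have "\<dots> = 1" by simp
    finally show "x \<in> cball 0 1" by simp
  qed
  then have "emeasure lborel (cbox 0 ((1 / real ?d) *\<^sub>R One) :: 'a set) \<le> emeasure lborel (cball (0::'a) 1)"
    by (intro emeasure_mono) auto
  then have "ennreal ((1 / real ?d) ^ ?d) \<le> ennreal (unit_ball_vol (real ?d))"
    by (simp add: emeasure_lborel_cbox_eq emeasure_cball)
  then have "(1 / real ?d) ^ ?d \<le> unit_ball_vol (real ?d)"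
    by (simp add: ennreal_le_iff)
  then have "((1 / real ?d) powr real ?d) powr (1 / real ?d) \<le> unit_ball_vol (real ?d) powr (1 / real ?d)"
    by (intro powr_mono2) (auto simp: powr_realpow)
  then have "1 / real ?d \<le> unit_ball_vol (real ?d) powr (1 / real ?d)"
    by (simp add: powr_powr)
  then show ?thesis by (simp add: field_simps)
qed

section \<open>The constant and the two estimates\<close>

lemma C_TR_pos:
  assumes "1 \<le> r" "0 < d" "0 < \<gamma>" shows "0 < C_TR r s d \<gamma>"
proof -
  have "0 < Gamma (real d / 2 + 1)" by (rule Gamma_real_pos) simp
  then have "Gamma (real d / 2 + 1) \<noteq> 0" by linarith
  then have "0 < real d * pi powr (real d * (s - r) / (2 * s)) / (\<gamma> * Gamma (real d / 2 + 1) powr ((s - r) / s))"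
    using assms by simp
  then have "0 < real d * pi powr (real d * (s - r) / (2 * s)) /
        (\<gamma> * Gamma (real d / 2 + 1) powr ((s - r) / s)) + (r - 1) / \<gamma>"
    using assms by (intro add_pos_nonneg) auto
  then show ?thesis by (simp add: C_TR_def)
qed

lemma C_TR_diagonal:
  assumes "0 < q" shows "C_TR q q d \<gamma> = ((real d + (q - 1)) / \<gamma>) powr (1 / q)"
proof -
  have "0 < Gamma (real d / 2 + 1)" by (rule Gamma_real_pos) simp
  then have "Gamma (real d / 2 + 1) \<noteq> 0" by linarith
  then show ?thesis by (simp add: C_TR_def add_divide_distrib)
qed

lemma C_TR_sobolev:
  assumes "0 < s" "(s - r) / s = 1 / real d" "0 < d"
  shows "C_TR r s d \<gamma> = ((real d * unit_ball_vol (real d) powr (1 / real d) + (r - 1)) / \<gamma>) powr (1 / r)"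
proof -
  have G: "0 < Gamma (real d / 2 + 1)" by (rule Gamma_real_pos) simp
  have "real d * (s - r) / (2 * s) = real d / 2 * ((s - r) / s)" by simp
  also have "\<dots> = real d / 2 * (1 / real d)" by (simp only: assms(2))
  finally have e: "real d * (s - r) / (2 * s) = real d / 2 * (1 / real d)" .
  have ub: "unit_ball_vol (real d) powr (1 / real d) =
      pi powr (real d / 2 * (1 / real d)) / Gamma (real d / 2 + 1) powr (1 / real d)"
    unfolding unit_ball_vol_def using G by (simp add: powr_divide powr_powr)
  show ?thesis
    unfolding C_TR_def e assms(2) ub
    by (simp only: add_divide_distrib divide_divide_eq_left times_divide_eq_right mult.commute[of \<gamma>])
qed

lemma trace_inequality_q:
  fixes K :: "'a::euclidean_space set"
  assumes K: "shape_regular \<gamma> K" "0 < diameter K" and q: "1 \<le> q" and v: "v \<in> W1 q (interior K)"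
    and w: "has_trace q K v w"
  shows "Lp_norm q (boundary_measure K) w \<le>
      ennreal (C_TR q q DIM('a) \<gamma>) *
        (ennreal (diameter K powr (- 1 / q)) * Lp_norm q (lebesgue_on (interior K)) v +
         ennreal (diameter K powr (1 / conj_index q)) *
           Lp_norm q (lebesgue_on (interior K)) (weak_gradient (interior K) v))"
proof (cases "Lp_norm q (lebesgue_on (interior K)) (weak_gradient (interior K) v) = \<infinity>")
  \<comment> \<open>The constant and the weight are positive, so an infinite gradient norm makes the
    right-hand side infinite.\<close>
  case True
  have "0 < \<gamma>" using K by (simp add: shape_regular_def)
  then have "0 < C_TR q q DIM('a) \<gamma>" using q by (intro C_TR_pos) auto
  then show ?thesis using True K(2) by (simp add: ennreal_mult_eq_top_iff ennreal_mult_top)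
next
  case False
  let ?\<mu> = "lebesgue_on (interior K)" and ?\<beta> = "boundary_measure K" and ?d = "real DIM('a)"
  define h where "h = diameter K"
  define gv where "gv = weak_gradient (interior K) v"
  have h: "0 < h" using K(2) by (simp add: h_def)
  have \<gamma>: "0 < \<gamma>" using K by (simp add: shape_regular_def)
  have gfin: "Lp_norm q ?\<mu> gv < \<infinity>" using False by (simp add: gv_def less_top)
  obtain G where G: "0 \<le> G" "(\<integral>\<^sup>+x. ennreal (norm (gv x) powr q) \<partial>?\<mu>) = ennreal G"
    "Lp_norm q ?\<mu> gv = ennreal (G powr (1 / q))" by (rule Lp_norm_finite[OF gfin])
  have vL: "v \<in> borel_measurable ?\<mu>" "Lp_norm q ?\<mu> v < \<infinity>"
    using v by (auto simp: W1_def Lp_space_def)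
  obtain F where F: "0 \<le> F" "(\<integral>\<^sup>+x. ennreal (norm (v x) powr q) \<partial>?\<mu>) = ennreal F"
    "Lp_norm q ?\<mu> v = ennreal (F powr (1 / q))" by (rule Lp_norm_finite[OF vL(2)])
  define S where "S = F powr (1 / q)"
  define B where "B = G powr (1 / q)"
  have SB: "0 \<le> S" "0 \<le> B" by (simp_all add: S_def B_def)
  have FS: "F = S powr q" using F(1) q by (simp add: S_def powr_powr)
  have gm: "gv \<in> borel_measurable ?\<mu>"
    using weak_gradient_W1[OF v] unfolding gv_def has_weak_gradient_def
    by (intro locally_integrable_measurable) auto
  \<comment> \<open>The weighted norms of the statement. \<open>S'^q\<close> carries the factor
    \<open>1/h\<close>, while in \<open>S'^(q-1) B'\<close> the powers of \<open>h\<close> cancel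
    because \<open>(q - 1)/q = 1/q'\<close>; so \<open>h\<close> can be factored out of both
    terms.\<close>
  define S' where "S' = h powr (- 1 / q) * S"
  define B' where "B' = h powr (1 / conj_index q) * B"
  define k where "k = (if q = 1 then 1 else q * S powr (q - 1))"
  have k: "0 \<le> k" using q by (simp add: k_def)
  have grad: "(\<integral>\<^sup>+x. ennreal ((if q = 1 then 1 else q * \<bar>v x\<bar> powr (q - 1)) * norm (gv x)) \<partial>?\<mu>) \<le> ennreal (k * B)"
    unfolding k_def B_def
    by (rule nn_integral_powr_gradient_le[OF q vL(1) gm _ SB(1) G(2,1) q]) (use q F FS in auto)
  have "ennreal (\<gamma> * h) * (\<integral>\<^sup>+x. ennreal (\<bar>w x\<bar> powr q) \<partial>?\<beta>) \<le>
    ennreal ?d * (\<integral>\<^sup>+x. ennreal (\<bar>v x\<bar> powr q) \<partial>?\<mu>) +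
    ennreal h * (\<integral>\<^sup>+x. ennreal ((if q = 1 then 1 else q * \<bar>v x\<bar> powr (q - 1)) * norm (gv x)) \<partial>?\<mu>)"
    unfolding h_def gv_def
    by (rule trace_powr_inequality[OF K q v _ w q]) (use gfin in \<open>simp add: gv_def\<close>)
  also have "\<dots> \<le> ennreal ?d * ennreal (S powr q) + ennreal h * ennreal (k * B)"
    using grad F(2) FS by (intro add_mono mult_left_mono) auto
  also have "\<dots> = ennreal (?d * S powr q + h * (k * B))"
    using h k SB by (simp add: ennreal_mult)
  also have "?d * S powr q + h * (k * B) = h * (?d * S' powr q +
      (if q = 1 then 1 else q * S' powr (q - 1)) * B')"
  proof -
    have "S' powr q = h powr - 1 * S powr q"
      using q by (simp add: S'_def powr_mult powr_powr)
    then have "S powr q = h * S' powr q"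
      using h by (simp add: powr_minus)
    moreover have "k * B = (if q = 1 then 1 else q * S' powr (q - 1)) * B'"
    proof (cases "q = 1")
      case False
      have "S' powr (q - 1) * B' = S powr (q - 1) * B * (h powr (- 1 / q * (q - 1)) * h powr (1 / conj_index q))"
        by (simp add: S'_def B'_def powr_mult powr_powr)
      also have "h powr (- 1 / q * (q - 1)) * h powr (1 / conj_index q) = 1"
        using h q by (simp add: powr_add[symmetric] conj_index_def)
      finally show ?thesis using False by (simp add: k_def)
    qed (use h in \<open>simp add: k_def B'_def conj_index_def\<close>)
    ultimately show ?thesis by (simp add: distrib_left)
  qed
  finally have "Lp_norm q ?\<beta> w \<le> ennreal (((?d + (q - 1)) / \<gamma>) powr (1 / q) * (S' + B'))"
    by (rule trace_norm_bound[OF q _ _ _ \<gamma> h, rotated 3]) (use SB in \<open>auto simp: S'_def B'_def\<close>)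
  also have "\<dots> = ennreal (C_TR q q DIM('a) \<gamma> * (h powr (- 1 / q) * S + h powr (1 / conj_index q) * B))"
    using q by (simp add: C_TR_diagonal S'_def B'_def)
  also have "ennreal (C_TR q q DIM('a) \<gamma> * (h powr (- 1 / q) * S + h powr (1 / conj_index q) * B)) =
    ennreal (C_TR q q DIM('a) \<gamma>) * (ennreal (h powr (- 1 / q)) * Lp_norm q ?\<mu> v +
      ennreal (h powr (1 / conj_index q)) * Lp_norm q ?\<mu> gv)"
    using SB by (simp add: F(3) G(3) S_def[symmetric] B_def[symmetric] ennreal_mult C_TR_def)
  finally show ?thesis unfolding h_def gv_def by (simp add: ennreal_leI)
qed

text \<open>Hoelder's inequality with exponents \<open>s/r\<close> and \<open>d\<close> bounds the
  volume term by \<open>\<bar>K\<bar>^(1/d) S^r\<close>. Since \<open>K\<close> lies in a ball of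
  radius \<open>h\<close> about any of its points, \<open>\<bar>K\<bar>^(1/d) <= c h\<close>. Thus
  both terms on the right carry the factor \<open>h\<close> of the left-hand side, and no power of
  \<open>h\<close> remains.\<close>

lemma trace_inequality_sobolev:
  fixes K :: "'a::euclidean_space set"
  assumes d2: "2 \<le> DIM('a)" and K: "shape_regular \<gamma> K" "0 < diameter K" and q: "1 \<le> q" "q < real DIM('a)"
    and v: "v \<in> W1 q (interior K)" and w: "has_trace q K v w"
  shows "Lp_norm (trace_index DIM('a) q) (boundary_measure K) w \<le>
        ennreal (C_TR (trace_index DIM('a) q) (sobolev_index DIM('a) q) DIM('a) \<gamma>) *
          (Lp_norm (sobolev_index DIM('a) q) (lebesgue_on (interior K)) v +
           Lp_norm q (lebesgue_on (interior K)) (weak_gradient (interior K) v))"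
proof -
  let ?\<mu> = "lebesgue_on (interior K)" and ?\<beta> = "boundary_measure K" and ?d = "real DIM('a)"
  define r where "r = trace_index DIM('a) q"
  define s where "s = sobolev_index DIM('a) q"
  define h where "h = diameter K"
  define gv where "gv = weak_gradient (interior K) v"
  have h: "0 < h" using K(2) by (simp add: h_def)
  have \<gamma>: "0 < \<gamma>" using K by (simp add: shape_regular_def)
  have dq: "0 < ?d - q" using q by simp
  have s: "0 < s" using q dq by (simp add: s_def sobolev_index_def)
  have "q * ?d - ?d * 1 \<ge> 0" using q mult_right_mono[of 1 q ?d] by (simp add: mult.commute)
  then have r: "1 \<le> r" using dq by (simp add: r_def trace_index_def field_simps)
  have rs: "r - 1 = s * (q - 1) / q" "(s - r) / s = 1 / ?d" "r < s"
  proof -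
    have sr: "s - r = q / (?d - q)"
      by (simp add: r_def s_def trace_index_def sobolev_index_def diff_divide_distrib[symmetric] algebra_simps)
    show "(s - r) / s = 1 / ?d"
      unfolding sr using q dq by (simp add: s_def sobolev_index_def)
    have "0 < q / (?d - q)" using q dq by simp
    then show "r < s" using sr by linarith
    have "r - 1 = ?d * (q - 1) / (?d - q)"
      using dq by (simp add: r_def trace_index_def field_simps)
    also have "\<dots> = s * (q - 1) / q" using q by (simp add: s_def sobolev_index_def)
    finally show "r - 1 = s * (q - 1) / q" .
  qed
  have C: "0 < C_TR r s DIM('a) \<gamma>" using r \<gamma> by (intro C_TR_pos) auto
  show ?thesis
  proof (cases "Lp_norm s ?\<mu> v = \<infinity> \<or> Lp_norm q ?\<mu> gv = \<infinity>")
    case True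
    then have "Lp_norm s ?\<mu> v + Lp_norm q ?\<mu> gv = \<infinity>" by auto
    with C have "ennreal (C_TR r s DIM('a) \<gamma>) * (Lp_norm s ?\<mu> v + Lp_norm q ?\<mu> gv) = \<infinity>"
      by (auto simp: ennreal_mult_eq_top_iff)
    then show ?thesis unfolding r_def s_def gv_def by simp
  next
    case False
    then have fin: "Lp_norm s ?\<mu> v < \<infinity>" "Lp_norm q ?\<mu> gv < \<infinity>" by (auto simp: less_top)
    obtain G where G: "0 \<le> G" "(\<integral>\<^sup>+x. ennreal (norm (gv x) powr q) \<partial>?\<mu>) = ennreal G"
      "Lp_norm q ?\<mu> gv = ennreal (G powr (1 / q))" by (rule Lp_norm_finite[OF fin(2)])
    obtain F where F: "0 \<le> F" "(\<integral>\<^sup>+x. ennreal (norm (v x) powr s) \<partial>?\<mu>) = ennreal F"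
      "Lp_norm s ?\<mu> v = ennreal (F powr (1 / s))" by (rule Lp_norm_finite[OF fin(1)])
    define S where "S = F powr (1 / s)"
    define B where "B = G powr (1 / q)"
    have SB: "0 \<le> S" "0 \<le> B" by (simp_all add: S_def B_def)
    have FS: "F = S powr s" using F(1) s by (simp add: S_def powr_powr)
    have vm[measurable]: "v \<in> borel_measurable ?\<mu>" using v by (auto simp: W1_def Lp_space_def)
    have gm: "gv \<in> borel_measurable ?\<mu>"
      using weak_gradient_W1[OF v] unfolding gv_def has_weak_gradient_def
      by (intro locally_integrable_measurable) auto
    define k where "k = (if r = 1 then 1 else r * S powr (r - 1))"
    have k: "0 \<le> k" using r by (simp add: k_def)
    have grad: "(\<integral>\<^sup>+x. ennreal ((if r = 1 then 1 else r * \<bar>v x\<bar> powr (r - 1)) * norm (gv x)) \<partial>?\<mu>) \<le> ennreal (k * B)"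
      unfolding k_def B_def
      by (rule nn_integral_powr_gradient_le[OF q(1) vm gm _ SB(1) G(2,1) r rs(1) s]) (use F FS in auto)
    define c where "c = unit_ball_vol ?d powr (1 / ?d)"
    have c: "0 \<le> c" by (simp add: c_def)
    define m where "m = enn2real (emeasure ?\<mu> (space ?\<mu>))"
    have cK: "compact K" by (rule shape_regular_compact[OF K(1)])
    have m: "emeasure ?\<mu> (space ?\<mu>) = ennreal m" "0 \<le> m"
      using emeasure_lebesgue_on_interior_finite[OF cK] by (auto simp: m_def)
    have "m powr (1 / ?d) \<le> c * h"
    proof -
      have "K \<noteq> {}" using K(2) by auto
      then obtain x where x: "x \<in> K" by blast
      have "interior K \<subseteq> cball x h"
        using x interior_subset[of K] diameter_bounded_bound[OF compact_imp_bounded[OF cK] x]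
        by (auto simp: h_def)
      then have "emeasure lborel (interior K) \<le> emeasure lborel (cball x h)"
        by (intro emeasure_mono) auto
      moreover have "emeasure ?\<mu> (space ?\<mu>) = emeasure lborel (interior K)"
        by (simp add: emeasure_restrict_space)
      ultimately have "ennreal m \<le> ennreal (unit_ball_vol ?d * h ^ DIM('a))"
        using m h by (simp add: emeasure_cball)
      then have "m \<le> unit_ball_vol ?d * h ^ DIM('a)"
        using h by (subst (asm) ennreal_le_iff) auto
      then have "m powr (1 / ?d) \<le> (unit_ball_vol ?d * h powr ?d) powr (1 / ?d)"
        using m(2) h by (intro powr_mono2) (auto simp: powr_realpow)
      also have "\<dots> = c * h" using h by (simp add: c_def powr_mult powr_powr)
      finally show ?thesis .
    qed
    have vr: "(\<integral>\<^sup>+x. ennreal (\<bar>v x\<bar> powr r) \<partial>?\<mu>) \<le> ennreal (c * h * S powr r)"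
    proof -
      have e: "r * (s / r) = s" "s * (1 / (s / r)) = r" using r s by auto
      have "1 / (s / r) = 1 - (s - r) / s" using r s by (simp add: diff_divide_distrib)
      then have p: "1 < s / r" "1 < ?d" "1 / (s / r) + 1 / ?d = 1"
        using r rs(2,3) d2 by simp_all
      have "(\<integral>\<^sup>+x. ennreal (\<bar>v x\<bar> powr r * 1) \<partial>?\<mu>) \<le> ennreal ((S powr s) powr (1 / (s / r)) * m powr (1 / ?d))"
        by (rule Holder_nn_integral[OF p]) (use F FS m e in \<open>auto simp: powr_powr\<close>)
      also have "(S powr s) powr (1 / (s / r)) = S powr r" by (simp only: powr_powr e)
      finally have "(\<integral>\<^sup>+x. ennreal (\<bar>v x\<bar> powr r) \<partial>?\<mu>) \<le> ennreal (S powr r * m powr (1 / ?d))" by simp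
      also have "\<dots> \<le> ennreal (c * h * S powr r)"
        using mult_left_mono[OF \<open>m powr (1 / ?d) \<le> c * h\<close>, of "S powr r"]
        by (intro ennreal_leI) (simp add: mult.commute)
      finally show ?thesis .
    qed
    have "ennreal (\<gamma> * h) * (\<integral>\<^sup>+x. ennreal (\<bar>w x\<bar> powr r) \<partial>?\<beta>) \<le>
      ennreal ?d * (\<integral>\<^sup>+x. ennreal (\<bar>v x\<bar> powr r) \<partial>?\<mu>) +
      ennreal h * (\<integral>\<^sup>+x. ennreal ((if r = 1 then 1 else r * \<bar>v x\<bar> powr (r - 1)) * norm (gv x)) \<partial>?\<mu>)"
      unfolding h_def gv_def
      by (rule trace_powr_inequality[OF K q(1) v _ w r]) (use fin in \<open>simp add: gv_def\<close>)
    also have "\<dots> \<le> ennreal ?d * ennreal (c * h * S powr r) + ennreal h * ennreal (k * B)"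
      using grad vr by (intro add_mono mult_left_mono) auto
    also have "\<dots> = ennreal (h * (?d * c * S powr r + k * B))"
      using h k SB c by (simp add: ennreal_mult[symmetric] ennreal_plus[symmetric] algebra_simps del: ennreal_plus)
    finally have "Lp_norm r ?\<beta> w \<le> ennreal (((?d * c + (r - 1)) / \<gamma>) powr (1 / r) * (S + B))"
      unfolding k_def c_def
      by (rule trace_norm_bound[OF r dim_times_unit_ball_vol_ge_1 SB \<gamma> h])
    also have "\<dots> = ennreal (C_TR r s DIM('a) \<gamma> * (S + B))"
      unfolding C_TR_sobolev[OF s rs(2) DIM_positive] c_def ..
    also have "ennreal (C_TR r s DIM('a) \<gamma> * (S + B)) =
      ennreal (C_TR r s DIM('a) \<gamma>) * (Lp_norm s ?\<mu> v + Lp_norm q ?\<mu> gv)"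
      using SB C by (simp add: F(3) G(3) S_def[symmetric] B_def[symmetric] ennreal_mult)
    finally show ?thesis unfolding r_def s_def gv_def by (simp add: ennreal_leI)
  qed
qed

text \<open>The divisions by \<open>\<gamma> * diameter K\<close> in the estimates rest on this. The
  nonempty interior of the pieces in \<open>polytopic\<close> places a ball inside
  \<open>K\<close>.\<close>

lemma polytopic_diameter_pos:
  assumes "polytopic K" "compact K"
  shows "0 < diameter K"
proof -
  obtain P where "interior P \<noteq> {}" "P \<subseteq> K"
    using assms(1) unfolding polytopic_def by blast
  then have "interior K \<noteq> {}" using interior_mono by blast
  then obtain x where "x \<in> interior K" by blast
  then obtain e where e: "0 < e" "cball x e \<subseteq> K" by (auto simp: mem_interior_cball)
  have "diameter (cball x e) \<le> diameter K"
    using assms e by (intro diameter_subset compact_imp_bounded)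
  then show ?thesis using e by simp
qed

theorem corollary1p2:
  fixes \<Omega> :: "'a::euclidean_space set"
    and \<T> :: "nat \<Rightarrow> 'a set set"
    and \<gamma> q :: real
  assumes "DIM('a) \<ge> 2"
    and "lipschitz_domain \<Omega>" and "polytopic (closure \<Omega>)" and "star_shaped_wrt_ball \<Omega>"
    and "\<forall>n. polytopic_mesh \<Omega> (\<T> n)"
    and "regular_mesh_family \<gamma> \<T>"
    and "1 \<le> q"
  shows "\<forall>n. \<forall>K\<in>\<T> n. \<forall>v\<in>W1 q (interior K). \<forall>w. has_trace q K v w \<longrightarrow>
    Lp_norm q (boundary_measure K) w \<le>
      ennreal (C_TR q q DIM('a) \<gamma>) *
        (ennreal (diameter K powr (- 1 / q)) * Lp_norm q (lebesgue_on (interior K)) v +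
         ennreal (diameter K powr (1 / conj_index q)) *
           Lp_norm q (lebesgue_on (interior K)) (weak_gradient (interior K) v)) \<and>
    (q < real DIM('a) \<longrightarrow>
      Lp_norm (trace_index DIM('a) q) (boundary_measure K) w \<le>
        ennreal (C_TR (trace_index DIM('a) q) (sobolev_index DIM('a) q) DIM('a) \<gamma>) *
          (Lp_norm (sobolev_index DIM('a) q) (lebesgue_on (interior K)) v +
           Lp_norm q (lebesgue_on (interior K)) (weak_gradient (interior K) v)))"
proof (intro allI ballI impI, goal_cases)
  case (1 n K v w)
  have reg: "shape_regular \<gamma> K"
    using assms(6) 1(1) unfolding regular_mesh_family_def shape_regular_def Let_def by blast
  have "polytopic K" using assms(5) 1(1) by (auto simp: polytopic_mesh_def)
  then have "0 < diameter K"
    by (rule polytopic_diameter_pos[OF _ shape_regular_compact[OF reg]])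
  then show ?case
    using trace_inequality_q[OF reg _ assms(7) 1(2,3)]
      trace_inequality_sobolev[OF assms(1) reg _ assms(7) _ 1(2,3)] by blast
qed

end
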